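(* Let $\psi:\mathbb R_+\to\mathbb R_+$ be a non-increasing positive function, and let $t_0\ge 1$ be such that $t\psi(t)<1$ for all $t\ge t_0$. Put $$\Psi(t):=\frac{t\psi(t)}{1-t\psi(t)}\qquad (t\ge t_0),$$ and assume that $\Psi$ is non-decreasing on $[t_0,\infty)$. Let $n\ge 1$, let $a_1,\dots,a_n\ge 0$ be real numbers, at least one of which is non-zero, and let $f$ be a dimension function which for all sufficiently small $x>0$ is given by $$f(x)=x\,\big(\log(1/x)\big)^{a_1}\big(\log\log(1/x)\big)^{a_2}\cdots\big(\underbrace{\log\log\cdots\log}_{n}(1/x)\big)^{a_n}.$$ Then $$\mathcal H^f\big(D^c(\psi)\big)=\begin{cases}0 & \text{if } \displaystyle\sum_{q\in\mathbb N,\ q\ge t_0} q\,\log\big(\Psi(q)\big)\,f\!\left(\frac{1}{q^2\Psi(q)}\right)<\infty;\\[2ex] \infty & \text{if } \displaystyle\sum_{q\in\mathbb N,\ q\ge t_0} q\,\log\big(\Psi(q)\big)\,f\!\left(\frac{1}{q^2\Psi(q)}\right)=\infty.\end{cases}$$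
   Context: A dimension function is an increasing, continuous function $f:\mathbb R_+\to\mathbb R_+$ with $f(r)\to 0$ as $r\to 0$. $\mathcal H^f$ denotes the $f$-dimensional Hausdorff measure: $\mathcal H^f(E)=\lim_{\rho\to0}\inf\sum_i f(\mathrm{diam}(B_i))$, the infimum being over countable covers $\{B_i\}$ of $E$ by balls of diameter at most $\rho$. For a non-increasing $\psi:\mathbb R_+\to\mathbb R_+$, the set $D(\psi)$ of $\psi$-Dirichlet improvable numbers is the set of all $x\in[0,1)$ for which there exists $N$ such that for every real $t>N$ the system $|qx-p|<\psi(t)$, $|q|<t$ has a non-trivial solution in integers $(p,q)\neq(0,0)$. $D^c(\psi):=[0,1)\setminus D(\psi)$ is the set of $\psi$-Dirichlet non-improvable numbers.
   Formalization: The formal theorem additionally assumes Ψ(t) > 1 for some t ≥ t₀; if Ψ ≤ 1 throughout (e.g. ψ(t) = 1/(2t)), the sum is ≤ 0 yet D^c(ψ) contains every irrational in [0,1) and has infinite measure, so the printed claim fails. *)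

theory Defs
  imports "HOL-Analysis.Analysis"
begin

text \<open>Functions on \<open>\<real>\<^sub>+\<close> are total functions on \<^typ>\<open>real\<close> of which only the restriction to
  \<open>{0<..}\<close> is constrained and used.  ``Increasing'' is read in the weak sense.\<close>

definition dimension_function :: "(real \<Rightarrow> real) \<Rightarrow> bool" where
  "dimension_function f \<longleftrightarrow>
     (\<forall>r>0. 0 \<le> f r) \<and> mono_on {0<..} f \<and> continuous_on {0<..} f \<and> (f \<longlongrightarrow> 0) (at_right 0)"

definition ball_covers :: "real \<Rightarrow> real set \<Rightarrow> real set set set" where
  "ball_covers \<rho> E =
     {\<B>. countable \<B> \<and> (\<forall>B\<in>\<B>. (\<exists>c r. 0 < r \<and> B = ball c r) \<and> diameter B \<le> \<rho>) \<and> E \<subseteq> \<Union>\<B>}"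

definition hausdorff_premeasure :: "(real \<Rightarrow> real) \<Rightarrow> real \<Rightarrow> real set \<Rightarrow> ennreal" where
  "hausdorff_premeasure f \<rho> E =
     (INF \<B>\<in>ball_covers \<rho> E. \<Sum>\<^sub>\<infinity>B\<in>\<B>. ennreal (f (diameter B)))"

definition hausdorff_measure :: "(real \<Rightarrow> real) \<Rightarrow> real set \<Rightarrow> ennreal" where
  "hausdorff_measure f E = Lim (at_right 0) (\<lambda>\<rho>. hausdorff_premeasure f \<rho> E)"

text \<open>The limit in the definition always exists, so \<^const>\<open>Lim\<close> is never unspecified.\<close>

lemma hausdorff_premeasure_antimono:
  assumes "\<rho> \<le> \<rho>'"
  shows "hausdorff_premeasure f \<rho>' E \<le> hausdorff_premeasure f \<rho> E"
  unfolding hausdorff_premeasure_def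
  by (rule INF_superset_mono) (use assms in \<open>auto simp: ball_covers_def intro: order_trans\<close>)

lemma hausdorff_premeasure_tendsto:
  "((\<lambda>\<rho>. hausdorff_premeasure f \<rho> E) \<longlongrightarrow> (SUP \<rho>\<in>{0<..}. hausdorff_premeasure f \<rho> E)) (at_right 0)"
proof (rule order_tendstoI)
  fix y assume "y < (SUP \<rho>\<in>{0<..}. hausdorff_premeasure f \<rho> E)"
  then obtain \<rho> where \<rho>: "\<rho> > 0" "y < hausdorff_premeasure f \<rho> E"
    by (auto simp: less_SUP_iff)
  show "\<forall>\<^sub>F \<rho> in at_right 0. y < hausdorff_premeasure f \<rho> E"
    unfolding eventually_at_right_field
    using \<rho> hausdorff_premeasure_antimono[of _ \<rho> f E]
    by (intro exI[of _ \<rho>]) (auto intro: less_le_trans)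
next
  fix y assume y: "(SUP \<rho>\<in>{0<..}. hausdorff_premeasure f \<rho> E) < y"
  show "\<forall>\<^sub>F \<rho> in at_right 0. hausdorff_premeasure f \<rho> E < y"
    unfolding eventually_at_right_field
    by (intro exI[of _ 1]) (auto intro!: le_less_trans[OF _ y] SUP_upper)
qed

lemma hausdorff_measure_eq_SUP:
  "hausdorff_measure f E = (SUP \<rho>\<in>{0<..}. hausdorff_premeasure f \<rho> E)"
  unfolding hausdorff_measure_def
  by (rule tendsto_Lim) (simp_all add: hausdorff_premeasure_tendsto)

definition dirichlet_improvable :: "(real \<Rightarrow> real) \<Rightarrow> real set" where
  "dirichlet_improvable \<psi> =
     {x\<in>{0..<1}. \<exists>N::real. \<forall>t>N. \<exists>p q :: int. (p, q) \<noteq> (0, 0) \<and>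
        \<bar>of_int q * x - of_int p\<bar> < \<psi> t \<and> of_int \<bar>q\<bar> < t}"

definition dirichlet_non_improvable :: "(real \<Rightarrow> real) \<Rightarrow> real set" where
  "dirichlet_non_improvable \<psi> = {0..<1} - dirichlet_improvable \<psi>"

definition Psi :: "(real \<Rightarrow> real) \<Rightarrow> real \<Rightarrow> real" where
  "Psi \<psi> t = t * \<psi> t / (1 - t * \<psi> t)"

text \<open>The terms of the series are negative or zero as long as \<open>Psi \<psi> q \<le> 1\<close>.  If this persists for all \<open>q\<close>
  (e.g. \<open>\<psi> t = 1 / (2 * t)\<close>, where every term is \<open>0\<close>), the zero-infinity law fails: then every
  irrational number in \<open>{0..<1}\<close> is non-improvable.  Hence \<open>1 < Psi \<psi> t\<close> has to be required for some \<open>t\<close>.\<close>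

definition series_term :: "(real \<Rightarrow> real) \<Rightarrow> (real \<Rightarrow> real) \<Rightarrow> nat \<Rightarrow> real" where
  "series_term \<psi> f q = real q * ln (Psi \<psi> (real q)) * f (1 / ((real q)\<^sup>2 * Psi \<psi> (real q)))"

end

theory Submission
  imports Defs
begin

text \<open>
  Let \<open>x\<close> be irrational and let \<open>p'/q'\<close>, \<open>p/q\<close> be consecutive convergents, \<open>q' < q\<close>. Since
  \<open>q' \<bar>q x - p\<bar> + q \<bar>q' x - p'\<bar> = 1\<close>, and since \<open>q'\<close> gives the best approximation among all
  denominators below \<open>q\<close>, the system at \<open>t = q\<close> is unsolvable exactly if
  \<open>q' \<bar>q x - p\<bar> \<le> 1 - q \<psi>(q) = 1 / (1 + \<Psi>(q))\<close>. So \<open>x\<close> is non-improvable iff it lies, for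
  infinitely many \<open>q\<close>, in a window of length about \<open>1 / (q q' \<Psi>(q))\<close> with endpoint \<open>p/q\<close>; here
  \<open>q'\<close> runs over the residues prime to \<open>q\<close> and determines \<open>p\<close> up to a sign.

  \<^emph>\<open>Convergence.\<close> These windows form a cover. Summing over \<open>q'\<close> produces the harmonic sum from
  \<open>q / \<Psi>(q)\<close> to \<open>q\<close>, hence the factor \<open>log \<Psi>(q)\<close>, and the cost of a fixed \<open>q\<close> is a constant times
  the \<open>q\<close>-th term of the series (\<open>measure_zero_of_summable\<close>).

  \<^emph>\<open>Divergence.\<close> Write \<open>f r = r L(r)\<close>; \<open>L\<close> increases to infinity as \<open>r\<close> decreases to \<open>0\<close>, but so
  slowly that \<open>L(r\<^sup>2) \<le> D L(r)\<close>. The windows are grouped by the \<^emph>\<open>smaller\<close> denominator: level \<open>k\<close>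
  consists of the fractions \<open>p'/q'\<close> with \<open>16^k \<le> q' < 16^(k+1)\<close> and, for each of them, of its
  children with denominators \<open>q = b q' + q''\<close>, \<open>1 \<le> b \<le> m\<^sub>k\<close>, where \<open>m\<^sub>k\<close> is \<open>1 + \<Psi>\<close> at \<open>16^(3k)\<close>.
  Per unit length the windows of level \<open>k\<close> have total \<open>f\<close>-mass comparable to
  \<open>L(16^(-k)) log m\<^sub>k / m\<^sub>k\<close>. If the series of the theorem diverges, so does the series of these
  weights, because passing from \<open>q\<close> to a fixed power of \<open>q\<close> changes \<open>L\<close> by a bounded factor only
  (\<open>level_weights_diverge\<close>).

  Two estimates carry the argument. Inside an interval \<open>J\<close> finitely many levels have \<open>f\<close>-mass at
  least a constant times \<open>W |J|\<close>, where \<open>W\<close> is the sum of their weights and can be made as large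
  as desired (\<open>family_lower\<close>). Conversely the windows of length at most \<open>\<beta>\<close> that meet a given
  interval of length \<open>\<beta>\<close> have \<open>f\<close>-mass at most a constant times \<open>\<beta> W + f \<beta>\<close> (\<open>family_upper\<close>); for
  levels finer than \<open>\<beta>\<close> this is counting, for coarser levels it holds because two fractions with
  denominators below \<open>\<beta>\<close> to the power \<open>-1/2\<close> cannot be closer than \<open>\<beta>\<close>, so that a single \<open>p/q\<close> and
  a single \<open>p'/q'\<close> are responsible for everything. A Vitali selection then yields disjoint windows
  in \<open>J\<close> with the same two properties (\<open>local_subfamily\<close>).

  Suppose now that the set of non-improvable numbers had finite measure, and take a cover by short
  balls with finite total cost, where a ball of diameter \<open>\<beta>\<close> costs \<open>f \<beta>\<close>. Let \<open>\<kappa>\<close> be a large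
  constant, and call an interval \<open>J\<close> light if \<open>\<kappa>\<close> times the cost of the balls meeting it is at
  most \<open>f |J|\<close>. Choose one of the windows in \<open>J\<close> at random, with probability proportional to its
  \<open>f\<close>-mass. If it is not light, the quantities \<open>min 1 (\<kappa> f \<beta> / f \<alpha>)\<close>, for the balls meeting it,
  have sum at least \<open>1\<close>; here \<open>\<alpha>\<close> is the length of the window and \<open>\<beta>\<close> that of a ball. But the
  expected contribution of a single ball is at most \<open>(C + 1) f \<beta> / f |J|\<close> with \<open>C\<close> independent of
  \<open>\<kappa>\<close>: the windows shorter than the ball are controlled by the second estimate, and the longer
  ones, of which at most two meet the ball, contribute little since the total mass has been made
  large after \<open>\<kappa>\<close> was fixed. So, if \<open>\<kappa> > C + 1\<close> and \<open>J\<close> is light, one of the windows is light as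
  well. This gives a nested sequence of light windows. Its common point is non-improvable, but no
  ball can contain it, since the mass of the windows tends to \<open>0\<close>
  (\<open>measure_infinite_of_divergence\<close>).
\<close>

section \<open>Gauges slightly larger than length\<close>

text \<open>What the proof uses of the gauge: \<open>f r / r\<close> tends to infinity at \<open>0\<close>, monotonically and slowly.
  The condition on \<open>r\<^sup>2\<close> says that \<open>f r / r\<close> hardly distinguishes a scale from a fixed power of
  it, which is what allows numbers of very different size, such as \<open>q\<close> and \<open>q\<^sup>2 \<Psi>(q)\<close>, to be
  exchanged.\<close>

locale slow_gauge =
  fixes f :: "real \<Rightarrow> real" and D r\<^sub>0 :: real
  assumes gauge_mono: "mono_on {0<..} f"
    and gauge_pos: "0 < r \<Longrightarrow> 0 < f r"
    and gauge_lim: "(f \<longlongrightarrow> 0) (at_right 0)"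
    and r0_pos: "0 < r\<^sub>0" and r0_less: "r\<^sub>0 < 1"
    and ratio_antimono: "0 < r \<Longrightarrow> r \<le> s \<Longrightarrow> s \<le> r\<^sub>0 \<Longrightarrow> f s / s \<le> f r / r"
    and ratio_square: "0 < r \<Longrightarrow> r \<le> r\<^sub>0 \<Longrightarrow> f (r\<^sup>2) / r\<^sup>2 \<le> D * (f r / r)"
    and ratio_at_top: "filterlim (\<lambda>r. f r / r) at_top (at_right 0)"
    and ratio_small: "\<forall>\<^sub>F r in at_right 0. f r / r \<le> (1 / r) powr (1 / 100)"

lemma filterlim_iterated_ln: "filterlim ((ln ^^ i) :: real \<Rightarrow> real) at_top at_top"
proof (induction i)
  case 0
  then show ?case by (simp add: filterlim_ident id_def)
next
  case (Suc i)
  then show ?case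
    by (simp add: o_def filterlim_compose[OF ln_at_top])
qed

lemma iterated_ln_ge_one:
  obtains Y :: real where "1 \<le> Y" "\<And>y i. Y \<le> y \<Longrightarrow> i \<le> n \<Longrightarrow> 1 \<le> (ln ^^ i) y"
proof -
  have "\<forall>\<^sub>F y in at_top. 1 \<le> (ln ^^ i) (y::real)" for i
    using filterlim_iterated_ln[of i] by (auto simp: filterlim_at_top)
  then have "\<forall>\<^sub>F y in at_top. \<forall>i\<in>{..n}. 1 \<le> (ln ^^ i) (y::real)"
    by (intro eventually_ball_finite) auto
  then obtain Y where "\<forall>y\<ge>Y. \<forall>i\<in>{..n}. 1 \<le> (ln ^^ i) (y::real)"
    by (auto simp: eventually_at_top_linorder)
  then show thesis
    by (intro that[of "max 1 Y"]) auto
qed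

text \<open>Iterated logarithms are increasing, and \<open>y\<^sup>2\<close> at most doubles each of them: the first one exactly,
  and every further one because \<open>ln (2 z) = ln 2 + ln z \<le> 2 ln z\<close> once \<open>ln z \<ge> 1\<close>. One nonzero
  exponent makes the product unbounded.\<close>

lemma gauge_of_iterated_logs:
  fixes f :: "real \<Rightarrow> real" and n :: nat and a :: "nat \<Rightarrow> real"
  assumes a_nonneg: "\<forall>i\<in>{1..n}. 0 \<le> a i"
    and a_nonzero: "\<exists>i\<in>{1..n}. a i \<noteq> 0"
    and f_dim: "dimension_function f"
    and f_eq: "\<forall>\<^sub>F x in at_right 0. f x = x * (\<Prod>i=1..n. ((ln ^^ i) (1 / x)) powr a i)"
  shows "\<exists>D r\<^sub>0. slow_gauge f D r\<^sub>0"
proof -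
  obtain Y :: real where Y: "1 \<le> Y" "\<And>y i. Y \<le> y \<Longrightarrow> i \<le> n \<Longrightarrow> 1 \<le> (ln ^^ i) y"
    using iterated_ln_ge_one[of n] by blast
  obtain r\<^sub>1 where r1: "0 < r\<^sub>1"
    "\<And>x. 0 < x \<Longrightarrow> x < r\<^sub>1 \<Longrightarrow> f x = x * (\<Prod>i=1..n. ((ln ^^ i) (1 / x)) powr a i)"
    using f_eq by (auto simp: eventually_at_right_field)
  define P where "P y = (\<Prod>i=1..n. ((ln ^^ i) y) powr a i)" for y :: real
  define r\<^sub>0 where "r\<^sub>0 = min (r\<^sub>1 / 2) (min (1 / Y) (1 / 2))"
  define D where "D = (\<Prod>i=1..n. 2 powr a i :: real)"
  have r0: "0 < r\<^sub>0" "r\<^sub>0 < 1" "r\<^sub>0 < r\<^sub>1" "r\<^sub>0 \<le> 1 / Y"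
    using r1(1) Y(1) by (auto simp: r\<^sub>0_def)
  have big: "Y \<le> 1 / r" if "0 < r" "r \<le> r\<^sub>0" for r
  proof -
    have "r \<le> 1 / Y" using that r0(4) by simp
    then show ?thesis using that Y(1) by (simp add: field_simps)
  qed
  have ratio: "f r / r = P (1 / r)" if "0 < r" "r \<le> r\<^sub>0" for r
    using r1(2)[of r] that r0 by (simp add: P_def)
  have ln_mono: "(ln ^^ i) y \<le> (ln ^^ i) y'" if "Y \<le> y" "y \<le> y'" "i \<le> n" for i and y y' :: real
    using that(3)
  proof (induction i)
    case (Suc i)
    then have "1 \<le> (ln ^^ i) y" using Y(2) that by simp
    with Suc show ?case by simp
  qed (use that in simp)
  have ln_le: "(ln ^^ i) y \<le> ln y" if "Y \<le> y" "1 \<le> i" "i \<le> n" for i and y :: real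
    using that(2,3)
  proof (induction i rule: dec_induct)
    case base
    then show ?case by simp
  next
    case (step i)
    then have "1 \<le> (ln ^^ i) y" using Y(2) that by simp
    then have "ln ((ln ^^ i) y) \<le> (ln ^^ i) y" by (intro ln_bound) simp
    with step show ?case by simp
  qed
  have ln_sq: "(ln ^^ i) (y\<^sup>2) \<le> 2 * (ln ^^ i) y" if "Y \<le> y" "1 \<le> i" "i \<le> n" for i and y :: real
    using that(2,3)
  proof (induction i rule: dec_induct)
    case base
    then show ?case using that Y(1) by (simp add: ln_realpow)
  next
    case (step i)
    have one: "1 \<le> (ln ^^ i) y" "1 \<le> (ln ^^ Suc i) y"
      using Y(2)[of y i] Y(2)[of y "Suc i"] that step by auto
    have "Y \<le> y\<^sup>2" using that Y(1) by (meson order_trans self_le_power zero_less_numeral)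
    then have "1 \<le> (ln ^^ i) (y\<^sup>2)" using Y(2) step by simp
    then have "ln ((ln ^^ i) (y\<^sup>2)) \<le> ln (2 * (ln ^^ i) y)" using step by simp
    also have "\<dots> = ln 2 + ln ((ln ^^ i) y)" using one by (simp add: ln_mult)
    also have "ln 2 \<le> (1::real)" using ln_2_less_1 by simp
    finally show ?case using one by simp
  qed
  have P_ge_one: "1 \<le> P y" if "Y \<le> y" for y
    unfolding P_def by (intro prod_ge_1) (use Y(2)[of y] that a_nonneg in \<open>auto intro!: ge_one_powr_ge_zero\<close>)
  have P_mono: "P y \<le> P y'" if "Y \<le> y" "y \<le> y'" for y y'
    unfolding P_def
    by (intro prod_mono) (use that ln_mono[of y y'] Y(2)[of y] a_nonneg in \<open>fastforce intro!: powr_mono2\<close>)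
  have P_sq: "P (y\<^sup>2) \<le> D * P y" if "Y \<le> y" for y
  proof -
    have yy: "Y \<le> y\<^sup>2" using that Y(1) by (meson order_trans self_le_power zero_less_numeral)
    have "P (y\<^sup>2) \<le> (\<Prod>i=1..n. (2 * (ln ^^ i) y) powr a i)"
      unfolding P_def
      by (intro prod_mono conjI powr_mono2)
        (use that ln_sq[of y] a_nonneg Y(2)[OF yy] in \<open>force simp: less_imp_le\<close>)+
    also have "\<dots> = (\<Prod>i=1..n. 2 powr a i * (ln ^^ i) y powr a i)"
      by (intro prod.cong refl powr_mult)
    also have "\<dots> = D * P y" by (simp add: D_def P_def prod.distrib)
    finally show ?thesis .
  qed
  obtain j where j: "j \<in> {1..n}" "0 < a j" using a_nonzero a_nonneg by force
  have P_ge: "(ln ^^ j) y powr a j \<le> P y" if "Y \<le> y" for y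
  proof -
    have "(\<Prod>i\<in>{j}. (ln ^^ i) y powr a i) \<le> P y"
      unfolding P_def
      by (intro prod_mono2) (use j Y(2)[of y] that a_nonneg in \<open>auto intro!: ge_one_powr_ge_zero\<close>)
    then show ?thesis by simp
  qed
  have "filterlim (\<lambda>y. (ln ^^ j) y powr a j) at_top at_top"
    using filterlim_iterated_ln[of j] j(2)
    by (intro filterlim_compose[OF real_powr_at_top]) auto
  then have "filterlim P at_top at_top"
    by (rule filterlim_at_top_mono) (use P_ge in \<open>auto simp: eventually_at_top_linorder\<close>)
  then have P_lim: "filterlim (\<lambda>r. P (1 / r)) at_top (at_right 0)"
    by (rule filterlim_compose)
      (use filterlim_inverse_at_top_right in \<open>simp add: inverse_eq_divide\<close>)
  have near: "\<forall>\<^sub>F r in at_right 0. 0 < r \<and> r \<le> r\<^sub>0"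
    using r0(1) by (auto simp: eventually_at_right_field intro!: exI[of _ r\<^sub>0])
  have at_top: "filterlim (\<lambda>r. f r / r) at_top (at_right 0)"
    using P_lim by (rule filterlim_at_top_mono) (use near ratio in \<open>auto elim!: eventually_mono\<close>)
  define A where "A = (\<Sum>i=1..n. a i)"
  have "P y \<le> ln y powr A" if "Y \<le> y" for y
  proof -
    have "P y \<le> (\<Prod>i=1..n. ln y powr a i)"
      unfolding P_def
      by (intro prod_mono) (use that ln_le[of y] Y(2)[of y] a_nonneg in \<open>fastforce intro!: powr_mono2\<close>)
    also have "\<dots> = ln y powr A" 
      using Y(2)[of y 1] that j by (simp add: A_def powr_sum)
    finally show ?thesis .
  qed
  note P_le = this
  have A: "0 < A"
    unfolding A_def using j a_nonneg by (intro sum_pos2[of _ j]) auto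
  define B where "B = (200 * A) powr A"
  have "\<forall>\<^sub>F y in at_top. ln y powr A \<le> y powr (1 / 100)"
    using eventually_ge_at_top[of 1] eventually_ge_at_top[of "B powr 200"]
  proof eventually_elim
    case (elim y)
    have "ln y powr A \<le> (y powr (1 / (200 * A)) / (1 / (200 * A))) powr A"
      using elim A ln_powr_bound[of y "1 / (200 * A)"] by (intro powr_mono2) auto
    also have "\<dots> = (200 * A * y powr (1 / (200 * A))) powr A" by (simp add: mult.commute)
    also have "\<dots> = B * (y powr (1 / (200 * A))) powr A"
      by (simp add: B_def powr_mult)
    also have "(y powr (1 / (200 * A))) powr A = y powr (1 / 200)"
      using A by (simp add: powr_powr)
    also have "B = (B powr 200) powr (1 / 200)" using A by (simp add: powr_powr B_def)
    also have "(B powr 200) powr (1 / 200) * y powr (1 / 200) \<le> y powr (1 / 200) * y powr (1 / 200)"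
      using elim by (intro mult_right_mono powr_mono2) auto
    also have "\<dots> = y powr (1 / 100)" by (simp flip: powr_add)
    finally show ?case .
  qed
  then have "\<forall>\<^sub>F y in at_top. P y \<le> y powr (1 / 100)"
    using eventually_ge_at_top[of Y] by eventually_elim (use P_le order_trans in blast)
  then have "\<forall>\<^sub>F r in at_right 0. P (1 / r) \<le> (1 / r) powr (1 / 100)"
    using filterlim_inverse_at_top_right
    by (auto simp: filterlim_iff inverse_eq_divide)
  then have small: "\<forall>\<^sub>F r in at_right 0. f r / r \<le> (1 / r) powr (1 / 100)"
    using near by eventually_elim (use ratio in auto)
  have mono: "mono_on {0<..} f" and lim: "(f \<longlongrightarrow> 0) (at_right 0)"
    using f_dim by (auto simp: dimension_function_def)
  have pos: "0 < f r" if "0 < r" for r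
  proof -
    define s where "s = min r r\<^sub>0"
    have s: "0 < s" "s \<le> r\<^sub>0" "s \<le> r" using that r0 by (auto simp: s_def)
    have "f s / s \<ge> 1" using ratio[of s] P_ge_one big s by simp
    then have "0 < f s" using s by (simp add: field_simps)
    also have "f s \<le> f r" using mono s that by (auto simp: mono_on_def)
    finally show ?thesis .
  qed
  have "slow_gauge f D r\<^sub>0"
  proof
    show "mono_on {0<..} f" "(f \<longlongrightarrow> 0) (at_right 0)" "0 < r\<^sub>0" "r\<^sub>0 < 1"
      by fact+
    show "0 < f r" if "0 < r" for r using pos that .
    show "f s / s \<le> f r / r" if "0 < r" "r \<le> s" "s \<le> r\<^sub>0" for r s
      using that ratio[of r] ratio[of s] big[of s] P_mono[of "1 / s" "1 / r"]
      by (simp add: field_simps)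
    show "f (r\<^sup>2) / r\<^sup>2 \<le> D * (f r / r)" if "0 < r" "r \<le> r\<^sub>0" for r
    proof -
      have "r\<^sup>2 \<le> r" using that r0 by (simp add: power2_eq_square mult_left_le)
      then have "f (r\<^sup>2) / r\<^sup>2 = P ((1 / r)\<^sup>2)"
        using ratio[of "r\<^sup>2"] that by (simp add: power_one_over)
      then show ?thesis using P_sq[OF big[OF that]] ratio that by simp
    qed
  qed (fact at_top small)+
  then show ?thesis by blast
qed

section \<open>Non-improvability and consecutive convergents\<close>

definition non_improvable_at :: "(real \<Rightarrow> real) \<Rightarrow> real \<Rightarrow> real \<Rightarrow> bool" where
  "non_improvable_at \<psi> t x \<longleftrightarrow>
     (\<forall>p q :: int. (p, q) \<noteq> (0, 0) \<longrightarrow> of_int \<bar>q\<bar> < t \<longrightarrow> \<psi> t \<le> \<bar>of_int q * x - of_int p\<bar>)"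

lemma dirichlet_non_improvable_iff:
  "x \<in> dirichlet_non_improvable \<psi> \<longleftrightarrow> x \<in> {0..<1} \<and> (\<forall>N. \<exists>t>N. non_improvable_at \<psi> t x)"
  unfolding dirichlet_non_improvable_def dirichlet_improvable_def non_improvable_at_def
  by (auto simp: not_less) (metis not_less)+

text \<open>The vectors \<open>(p, q)\<close> and \<open>(p', q')\<close> form a basis of the lattice, and their errors have opposite
  signs. A combination whose coefficients have equal signs has a denominator that is too large,
  and for the other combinations with \<open>\<gamma> \<noteq> 0\<close> the errors add up.\<close>

lemma unimodular_best_approximation:
  fixes p q p' q' u v :: int and x :: real
  assumes det: "p * q' - p' * q = 1" and q': "0 < q'"
    and below: "of_int p' \<le> of_int q' * x" and above: "of_int q * x \<le> of_int p"
    and nz: "(u, v) \<noteq> (0, 0)" and v: "\<bar>v\<bar> < q"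
  shows "of_int q' * x - of_int p' \<le> \<bar>of_int v * x - of_int u\<bar>"
proof -
  define \<alpha> \<gamma> where "\<alpha> = u * q' - v * p'" and "\<gamma> = v * p - u * q"
  define d0 d1 where "d0 = of_int p - of_int q * x" and "d1 = of_int q' * x - of_int p'"
  have d: "0 \<le> d0" "0 \<le> d1" using below above by (auto simp: d0_def d1_def)
  have "\<alpha> * q + \<gamma> * q' = v * (p * q' - p' * q)" "\<alpha> * p + \<gamma> * p' = u * (p * q' - p' * q)"
    by (auto simp: \<alpha>_def \<gamma>_def algebra_simps)
  then have v_eq: "v = \<alpha> * q + \<gamma> * q'" and u_eq: "u = \<alpha> * p + \<gamma> * p'" using det by auto
  have diff: "of_int v * x - of_int u = of_int \<gamma> * d1 - of_int \<alpha> * d0"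
    by (simp add: v_eq u_eq d0_def d1_def algebra_simps)
  have \<gamma>: "\<gamma> \<noteq> 0"
  proof
    assume "\<gamma> = 0"
    then have "v = \<alpha> * q" "u = \<alpha> * p" using v_eq u_eq by auto
    then have "\<alpha> \<noteq> 0" using nz by auto
    then have "\<bar>q\<bar> \<le> \<bar>v\<bar>" using \<open>v = \<alpha> * q\<close> by (auto simp: abs_mult mult_le_cancel_right1)
    then show False using v by simp
  qed
  consider "0 < \<gamma>" "0 < \<alpha>" | "0 < \<gamma>" "\<alpha> \<le> 0" | "\<gamma> < 0" "\<alpha> < 0" | "\<gamma> < 0" "0 \<le> \<alpha>" using \<gamma> by linarith
  then show ?thesis
  proof cases
    case 1
    then have "q \<le> \<alpha> * q" "0 \<le> \<gamma> * q'" using v q' by (auto simp: mult_le_cancel_right1)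
    then show ?thesis using v v_eq by simp
  next
    case 3
    then have "\<alpha> * q \<le> (-1) * q" using v by (intro mult_right_mono) auto
    moreover have "\<gamma> * q' \<le> 0" using 3 q' by (simp add: mult_nonpos_nonneg)
    ultimately show ?thesis using v v_eq by simp
  next
    case 2
    have "1 * d1 \<le> of_int \<gamma> * d1" using 2 d by (intro mult_right_mono) auto
    moreover have "of_int \<alpha> * d0 \<le> 0" using 2 d by (simp add: mult_nonpos_nonneg)
    ultimately show ?thesis unfolding diff using d1_def by linarith
  next
    case 4
    have "of_int \<gamma> * d1 \<le> (-1) * d1" using 4 d by (intro mult_right_mono) auto
    moreover have "0 \<le> of_int \<alpha> * d0" using 4 d by simp
    ultimately show ?thesis unfolding diff using d1_def by linarith
  qed
qed

text \<open>Between \<open>p'/q'\<close> and \<open>p/q\<close> the two errors satisfy \<open>q' (p - q x) + q (q' x - p') = 1\<close>, so closeness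
  to \<open>p/q\<close> forces the error of \<open>p'/q'\<close>, the best one available below \<open>q\<close>, to be almost \<open>1/q\<close>.\<close>

lemma non_improvable_at_convergent:
  fixes p q p' q' :: int and x \<psi> m
  assumes det: "p * q' - p' * q = 1" and q': "0 < q'" and q: "0 < q" and m: "1 < m"
    and psi: "of_int q * \<psi> (of_int q) \<le> 1 - 1 / m"
    and x: "of_int p / of_int q - 1 / (of_int q * of_int q' * m) \<le> x" "x \<le> of_int p / of_int q"
  shows "non_improvable_at \<psi> (of_int q) x"
  unfolding non_improvable_at_def
proof (intro allI impI)
  fix u v :: int
  assume nz: "(u, v) \<noteq> (0, 0)" and "of_int \<bar>v\<bar> < (of_int q :: real)"
  then have v: "\<bar>v\<bar> < q" by simp
  have above: "of_int q * x \<le> of_int p" using x(2) q by (simp add: field_simps)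
  have "(of_int p / of_int q - 1 / (of_int q * of_int q' * m)) * (of_int q * of_int q') \<le> x * (of_int q * of_int q')"
    using x(1) q q' by (intro mult_right_mono) auto
  then have "of_int p * of_int q' - 1 / m \<le> x * (of_int q * of_int q')"
    using q q' m by (simp add: left_diff_distrib)
  moreover have det_real: "of_int p * of_int q' - of_int p' * of_int q = (1::real)"
    using det by (metis of_int_1 of_int_diff of_int_mult)
  ultimately have *: "1 - 1 / m \<le> of_int q * (of_int q' * x - of_int p')"
    by (simp add: algebra_simps)
  have "0 \<le> 1 - 1 / m" using m by simp
  with * have "0 \<le> of_int q * (of_int q' * x - of_int p')" by linarith
  then have below: "of_int p' \<le> of_int q' * x" using q by (simp add: zero_le_mult_iff)
  have "of_int q * \<psi> (of_int q) \<le> of_int q * (of_int q' * x - of_int p')" using psi * by linarith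
  then have "\<psi> (of_int q) \<le> of_int q' * x - of_int p'" using q by simp
  also have "\<dots> \<le> \<bar>of_int v * x - of_int u\<bar>"
    by (rule unimodular_best_approximation[OF det q' below above nz v])
  finally show "\<psi> (of_int q) \<le> \<bar>of_int v * x - of_int u\<bar>" .
qed

lemma rational_improvable:
  assumes psi_pos: "\<forall>t>0. 0 < \<psi> t" and "x \<in> \<rat>"
  shows "x \<notin> dirichlet_non_improvable \<psi>"
proof
  assume "x \<in> dirichlet_non_improvable \<psi>"
  obtain p q :: int where pq: "0 < q" "x = of_int p / of_int q"
    using \<open>x \<in> \<rat>\<close> by (metis Rats_cases')
  obtain t where t: "of_int q < t" "non_improvable_at \<psi> t x"
    using \<open>x \<in> dirichlet_non_improvable \<psi>\<close> dirichlet_non_improvable_iff by blast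
  have "\<psi> t \<le> \<bar>of_int q * x - of_int p\<bar>"
    using t(2) pq t(1) unfolding non_improvable_at_def by (metis Pair_inject abs_of_pos less_irrefl)
  also have "\<dots> = 0" using pq by simp
  moreover have "0 < t" using t(1) pq(1) by (smt (verit) of_int_pos)
  ultimately show False using psi_pos by force
qed

text \<open>The denominators \<open>q'\<close> and \<open>q\<close> of the last convergent before \<open>t\<close> and of its successor, found
  without continued fractions: \<open>q'\<close> minimises the error below \<open>t\<close>, and \<open>(p, q)\<close> is the lattice
  point on the next line parallel to \<open>(p', q')\<close> that comes closest to \<open>x\<close> from the other side.
  Minimality of \<open>q'\<close> forces \<open>q \<ge> t\<close>, and Dirichlet's theorem ensures that \<open>q\<close> is positive.\<close>

lemma consecutive_convergents:
  fixes x t :: real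
  assumes irr: "x \<notin> \<rat>" and t: "1 < t"
  obtains p q p' q' :: int where "0 < q'" "of_int q' < t" "t \<le> of_int q"
    "\<bar>p * q' - p' * q\<bar> = 1"
    "\<bar>of_int q * x - of_int p\<bar> < 1 / of_int q"
    "of_int q' * \<bar>of_int q * x - of_int p\<bar> + of_int q * \<bar>of_int q' * x - of_int p'\<bar> = 1"
proof -
  define dst where "dst v = \<bar>of_int v * x - of_int (round (of_int v * x))\<bar>" for v :: int
  have dst_le: "dst v \<le> \<bar>of_int v * x - of_int u\<bar>" for u v
    unfolding dst_def using round_diff_minimal[of "of_int v * x" u] by (simp add: abs_minus_commute)
  have dst_pos: "0 < dst v" if "0 < v" for v
  proof -
    have "of_int v * x \<noteq> of_int u" for u :: int
    proof
      assume "of_int v * x = of_int u"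
      then have "x = of_int u / of_int v" using that by (simp add: field_simps)
      then show False using irr by auto
    qed
    then show ?thesis by (simp add: dst_def)
  qed
  define V where "V = {v::int. 0 < v \<and> of_int v < t}"
  have "V \<subseteq> {0..\<lceil>t\<rceil>}" by (auto simp: V_def) linarith
  then have "finite V" using finite_subset by blast
  moreover have "V \<noteq> {}" using t by (auto simp: V_def intro!: exI[of _ 1])
  ultimately obtain q' where q': "q' \<in> V" "\<And>v. v \<in> V \<Longrightarrow> dst q' \<le> dst v"
    using arg_min_if_finite(1)[of V dst] arg_min_least[of V _ dst] by blast
  have q'0: "0 < q'" "of_int q' < t" using q' by (auto simp: V_def)
  \<comment> \<open>the largest integer below \<open>t\<close>, also if \<open>t\<close> is an integer\<close>
  define N where "N = nat (\<lceil>t\<rceil> - 1)"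
  have N: "0 < N" "real N < t" "\<And>v. v \<le> int N \<Longrightarrow> of_int v < t" "\<And>v. of_int v < t \<Longrightarrow> v \<le> int N"
    using t unfolding N_def by linarith+
  obtain u v where uv: "0 < v" "v \<le> int N" "\<bar>of_int v * x - of_int u\<bar> < 1 / real N"
    using Dirichlet_approx[OF N(1)] by metis
  have "v \<in> V" using uv(1) N(3)[OF uv(2)] by (simp add: V_def)
  then have "dst q' \<le> dst v" by (rule q'(2))
  then have "dst q' < 1 / real N" using dst_le[of v u] uv(3) by linarith
  moreover have "of_int q' \<le> real N" using N(4)[OF q'0(2)] by (metis of_int_le_iff of_int_of_nat_eq)
  ultimately have small: "of_int q' * dst q' < 1"
  proof -
    have "of_int q' * dst q' \<le> real N * dst q'"
      using \<open>of_int q' \<le> real N\<close> dst_pos[OF q'0(1)] by (intro mult_right_mono) auto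
    also have "\<dots> < 1" using \<open>dst q' < 1 / real N\<close> N(1) by (simp add: field_simps)
    finally show ?thesis .
  qed
  define p' where "p' = round (of_int q' * x)"
  define d where "d = of_int q' * x - of_int p'"
  have dst_d: "dst q' = \<bar>d\<bar>" by (simp add: dst_def d_def p'_def)
  have "coprime p' q'"
  proof (rule ccontr)
    assume "\<not> coprime p' q'"
    define g where "g = gcd p' q'"
    have g: "1 < g" using \<open>\<not> coprime p' q'\<close> q'0(1)
      by (smt (verit, best) coprime_iff_gcd_eq_1 g_def gcd_pos_int)
    obtain p1 q1 where pq1: "p' = g * p1" "q' = g * q1" by (metis dvdE g_def gcd_dvd1 gcd_dvd2)
    have q1: "0 < q1" "q1 \<le> q'" using pq1 g q'0(1)
      by (auto simp: zero_less_mult_iff mult_le_cancel_right1)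
    then have "q1 \<in> V" using q'0 by (auto simp: V_def)
    then have "dst q' \<le> dst q1" using q' by blast
    also have "\<dots> \<le> \<bar>of_int q1 * x - of_int p1\<bar>" by (rule dst_le)
    finally have "of_int g * dst q' \<le> of_int g * \<bar>of_int q1 * x - of_int p1\<bar>"
      using g by (intro mult_left_mono) auto
    also have "\<dots> = \<bar>of_int g * (of_int q1 * x - of_int p1)\<bar>" using g by (simp add: abs_mult)
    also have "of_int g * (of_int q1 * x - of_int p1) = d" by (simp add: d_def pq1 algebra_simps)
    finally have "(of_int g - 1) * dst q' \<le> 0" using dst_d by (simp add: algebra_simps)
    moreover have "0 < (of_int g - 1) * dst q'" using g dst_pos[OF q'0(1)] by simp
    ultimately show False by simp
  qed
  \<comment> \<open>a Bezout partner of \<open>p'/q'\<close> on the other side of \<open>x\<close>, then shifted by a multiple of \<open>(q', p')\<close>\<close>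
  define \<epsilon> :: int where "\<epsilon> = (if 0 \<le> d then 1 else -1)"
  have eps: "of_int \<epsilon> * d = dst q'" "\<epsilon> * \<epsilon> = 1" "\<bar>\<epsilon>\<bar> = 1" by (auto simp: \<epsilon>_def dst_d)
  obtain r s :: int where rs: "r * q' - p' * s = \<epsilon>"
  proof -
    obtain a b where "a * p' + b * q' = gcd p' q'" using bezout_int by blast
    then have "a * p' + b * q' = 1" using \<open>coprime p' q'\<close> by simp
    then have "(\<epsilon> * b) * q' - p' * (- \<epsilon> * a) = \<epsilon>"
      by (simp add: algebra_simps) (metis distrib_left mult.commute mult.left_commute mult.right_neutral)
    then show thesis using that by blast
  qed
  define e0 where "e0 = of_int \<epsilon> * (of_int r - of_int s * x)"
  define j where "j = \<lfloor>e0 / dst q'\<rfloor>"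
  define p q where "p = r + j * p'" and "q = s + j * q'"
  define e where "e = e0 - of_int j * dst q'"
  have dpos: "0 < dst q'" using dst_pos q'0 by blast
  have "of_int j \<le> e0 / dst q'" "e0 / dst q' < of_int j + 1" unfolding j_def by linarith+
  then have e: "0 \<le> e" "e < dst q'"
    unfolding e_def using dpos by (auto simp: field_simps)
  have e_eq: "e = of_int \<epsilon> * (of_int p - of_int q * x)"
    unfolding e_def e0_def p_def q_def eps(1)[symmetric] d_def by (simp add: algebra_simps)
  then have e_abs: "e = \<bar>of_int q * x - of_int p\<bar>"
    using e(1) by (auto simp: \<epsilon>_def split: if_splits)
  have det: "p * q' - p' * q = \<epsilon>" unfolding p_def q_def using rs by (simp add: algebra_simps)
  then have det_real: "of_int p * of_int q' - of_int p' * of_int q = (of_int \<epsilon> :: real)"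
    by (metis of_int_diff of_int_mult)
  have "of_int q' * e + of_int q * dst q' = of_int \<epsilon> * (of_int p * of_int q' - of_int p' * of_int q)"
    unfolding e_eq eps(1)[symmetric] d_def by (simp add: algebra_simps)
  also have "\<dots> = 1" unfolding det_real using eps(2) by (metis of_int_1 of_int_mult)
  finally have sum1: "of_int q' * e + of_int q * dst q' = 1" .
  have "of_int q' * e \<le> of_int q' * dst q'" using e q'0 by (intro mult_left_mono) auto
  then have "0 < of_int q * dst q'" using sum1 small by linarith
  then have q0: "0 < q" using dpos by (simp add: zero_less_mult_iff)
  have tq: "t \<le> of_int q"
  proof (rule ccontr)
    assume "\<not> ?thesis"
    then have "q \<in> V" using q0 by (auto simp: V_def)
    then have "dst q' \<le> e" using q' dst_le[of q p] e_abs by force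
    then show False using e by simp
  qed
  have "0 \<le> of_int q' * e" using q'0 e by simp
  then have "of_int q * dst q' \<le> 1" using sum1 by linarith
  then have "dst q' \<le> 1 / of_int q" using q0 by (simp add: field_simps)
  then have "e < 1 / of_int q" using e by linarith
  then show thesis
    using that[of q' q p p'] q'0 tq det eps(3) sum1 e_abs dst_d by (simp add: d_def)
qed

text \<open>As \<open>\<psi>\<close> is non-increasing, a real \<open>t\<close> without solutions can be moved up to the next convergent
  denominator \<open>q\<close>.\<close>

lemma non_improvable_cover:
  fixes x \<psi> t
  assumes psi_noninc: "antimono_on {0<..} \<psi>" and irr: "x \<notin> \<rat>" and t: "1 < t"
    and ni: "non_improvable_at \<psi> t x"
  obtains p q p' q' :: int where "0 < q'" "q' < q" "t \<le> of_int q" "\<bar>p * q' - p' * q\<bar> = 1"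
    "\<bar>of_int q * x - of_int p\<bar> < 1 / of_int q"
    "of_int q' * \<bar>of_int q * x - of_int p\<bar> \<le> 1 - of_int q * \<psi> (of_int q)"
proof -
  obtain p q p' q' :: int where pq: "0 < q'" "of_int q' < t" "t \<le> of_int q"
    "\<bar>p * q' - p' * q\<bar> = 1" "\<bar>of_int q * x - of_int p\<bar> < 1 / of_int q"
    "of_int q' * \<bar>of_int q * x - of_int p\<bar> + of_int q * \<bar>of_int q' * x - of_int p'\<bar> = 1"
    using consecutive_convergents[OF irr t] .
  have "\<psi> (of_int q) \<le> \<psi> t"
    using psi_noninc pq(3) t by (auto simp: monotone_on_def)
  also have "\<dots> \<le> \<bar>of_int q' * x - of_int p'\<bar>"
    using ni pq(1,2) unfolding non_improvable_at_def
    by (metis Pair_inject abs_of_pos less_irrefl)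
  finally have "\<psi> (of_int q) \<le> \<bar>of_int q' * x - of_int p'\<bar>" .
  then have "of_int q * \<psi> (of_int q) \<le> of_int q * \<bar>of_int q' * x - of_int p'\<bar>"
    using pq(3) t by (intro mult_left_mono) linarith+
  then have "of_int q' * \<bar>of_int q * x - of_int p\<bar> \<le> 1 - of_int q * \<psi> (of_int q)"
    using pq(6) by linarith
  moreover have "real_of_int q' < of_int q" using pq(2,3) by linarith
  ultimately show thesis using that[of q' q p p'] pq by simp
qed

section \<open>The convergence case\<close>

lemma hausdorff_measure_zeroI:
  assumes "\<And>\<rho> e. 0 < \<rho> \<Longrightarrow> 0 < e \<Longrightarrow>
     \<exists>\<B>\<in>ball_covers \<rho> E. \<forall>F. finite F \<and> F \<subseteq> \<B> \<longrightarrow> (\<Sum>B\<in>F. ennreal (f (diameter B))) \<le> ennreal e"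
  shows "hausdorff_measure f E = 0"
proof -
  have "hausdorff_premeasure f \<rho> E = 0" if "0 < \<rho>" for \<rho>
  proof (rule antisym)
    show "hausdorff_premeasure f \<rho> E \<le> 0"
    proof (rule ennreal_le_epsilon)
      fix e :: real assume "0 < e"
      note cover = assms[OF that \<open>0 < e\<close>]
      then obtain \<B> where \<B>: "\<B> \<in> ball_covers \<rho> E"
        "\<forall>F. finite F \<and> F \<subseteq> \<B> \<longrightarrow> (\<Sum>B\<in>F. ennreal (f (diameter B))) \<le> ennreal e"
        by (elim bexE)
      have "hausdorff_premeasure f \<rho> E \<le> (\<Sum>\<^sub>\<infinity>B\<in>\<B>. ennreal (f (diameter B)))"
        unfolding hausdorff_premeasure_def by (rule INF_lower[OF \<B>(1)])
      also have "\<dots> \<le> ennreal e"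
        by (rule infsum_le_finite_sums) (use \<B>(2) in \<open>auto intro!: nonneg_summable_on_complete\<close>)
      finally show "hausdorff_premeasure f \<rho> E \<le> 0 + ennreal e" by simp
    qed
  qed simp
  then show ?thesis unfolding hausdorff_measure_eq_SUP by simp
qed

text \<open>The lengths of the covering intervals with centre of denominator \<open>q\<close>: for \<open>j\<close> up to \<open>q / \<Psi>\<close> the
  bound \<open>1 / q\<^sup>2\<close> is the better one, and from there on the sum is a difference of harmonic
  numbers, of size \<open>ln q - ln (q / \<Psi>) = ln \<Psi>\<close>.\<close>

lemma sum_min_inverse_le:
  fixes \<Psi> :: real
  assumes "1 \<le> \<Psi>" "0 < q"
  shows "(\<Sum>j=1..q. min (1 / (real q * real j * \<Psi>)) (1 / (real q)\<^sup>2)) \<le> (2 + ln \<Psi>) / (real q * \<Psi>)"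
proof -
  define z where "z = nat \<lfloor>real q / \<Psi>\<rfloor>"
  have z: "real z \<le> real q / \<Psi>" "real q / \<Psi> < real z + 1"
    using assms by (auto simp: z_def)
  have "real q / \<Psi> \<le> real q / 1" using assms by (intro divide_left_mono) auto
  then have zq: "z \<le> q" using z(1) by linarith
  have "harm q \<le> 1 + ln (real q)"
    using euler_mascheroni_sequence_decreasing[of 1 q] assms by (simp add: harm_def)
  moreover have "ln (real q / \<Psi>) \<le> ln (real z + 1)" using z assms by (intro ln_mono) auto
  ultimately have harm_diff: "harm q - harm z \<le> 1 + ln \<Psi>"
    using harm_ge_ln[of z] assms by (simp add: ln_div)
  have "(\<Sum>j=1..q. min (1 / (real q * real j * \<Psi>)) (1 / (real q)\<^sup>2))
      \<le> (\<Sum>j=1..q. if j \<le> z then 1 / (real q)\<^sup>2 else 1 / (real q * real j * \<Psi>))"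
    by (intro sum_mono) auto
  also have "\<dots> = (\<Sum>j\<in>{1..q} \<inter> {j. j \<le> z}. 1 / (real q)\<^sup>2) + (\<Sum>j\<in>{1..q} \<inter> - {j. j \<le> z}. 1 / (real q * real j * \<Psi>))"
    by (simp add: sum.If_cases)
  also have "{1..q} \<inter> {j. j \<le> z} = {1..z}" using zq by auto
  also have "{1..q} \<inter> - {j. j \<le> z} = {z<..q}" by auto
  also have "(\<Sum>j=1..z. 1 / (real q)\<^sup>2) = real z / (real q)\<^sup>2" by simp
  also have "\<dots> \<le> (real q / \<Psi>) / (real q)\<^sup>2" using z by (intro divide_right_mono) auto
  also have "\<dots> = 1 / (real q * \<Psi>)" using assms by (simp add: power2_eq_square)
  also have "(\<Sum>j\<in>{z<..q}. 1 / (real q * real j * \<Psi>)) = 1 / (real q * \<Psi>) * (\<Sum>j\<in>{z<..q}. 1 / real j)"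
    by (simp add: sum_distrib_left mult_ac)
  also have "(\<Sum>j\<in>{z<..q}. 1 / real j) = harm q - harm z"
  proof -
    have "{1..q} = {1..z} \<union> {z<..q}" using zq by auto
    moreover have "(\<Sum>j\<in>{1..z} \<union> {z<..q}. 1 / real j) = (\<Sum>j=1..z. 1 / real j) + (\<Sum>j\<in>{z<..q}. 1 / real j)"
      by (intro sum.union_disjoint) auto
    ultimately have "harm q = harm z + (\<Sum>j\<in>{z<..q}. 1 / real j)"
      unfolding harm_def inverse_eq_divide by simp
    then show ?thesis by simp
  qed
  finally have "(\<Sum>j=1..q. min (1 / (real q * real j * \<Psi>)) (1 / (real q)\<^sup>2))
      \<le> 1 / (real q * \<Psi>) + 1 / (real q * \<Psi>) * (harm q - harm z)" by simp
  also have "\<dots> \<le> 1 / (real q * \<Psi>) + 1 / (real q * \<Psi>) * (1 + ln \<Psi>)"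
    using harm_diff assms by (intro add_left_mono mult_left_mono) auto
  also have "\<dots> = (2 + ln \<Psi>) / (real q * \<Psi>)"
    by (simp add: add_divide_distrib)
  finally show ?thesis .
qed

text \<open>The determinant condition \<open>p j - p' q = \<plusminus>1\<close> leaves one residue class modulo \<open>q\<close> for \<open>p\<close> for each
  sign.\<close>

lemma card_unit_residues_le:
  fixes q j :: int
  assumes "2 \<le> q"
  shows "finite {p. 0 \<le> p \<and> p \<le> q \<and> (q dvd p * j - 1 \<or> q dvd p * j + 1)}"
    "card {p. 0 \<le> p \<and> p \<le> q \<and> (q dvd p * j - 1 \<or> q dvd p * j + 1)} \<le> 2"
proof -
  let ?A = "\<lambda>e. {p. 0 \<le> p \<and> p \<le> q \<and> q dvd p * j - e}"
  have *: "card (?A e) \<le> 1" if e: "\<bar>e\<bar> = 1" for e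
  proof -
    have fin: "finite (?A e)" by (rule finite_subset[of _ "{0..q}"]) auto
    have "p1 = p2" if "p1 \<in> ?A e" "p2 \<in> ?A e" for p1 p2
    proof -
      have less: "p < q" if "p \<in> ?A e" for p
      proof (rule ccontr)
        assume "\<not> p < q"
        then have "p = q" using that by auto
        then have "q dvd e" using that by (auto simp: dvd_diff_right_iff)
        moreover have "e = 1 \<or> e = -1" using e by linarith
        ultimately have "q dvd 1" by auto
        then show False using assms zdvd_imp_le[of q 1] by simp
      qed
      have dvd: "q dvd p1 * j - e" "q dvd p2 * j - e" using that by auto
      have "coprime j q"
      proof (rule coprimeI)
        fix d assume d: "d dvd j" "d dvd q"
        have "d dvd p1 * j - e" using d(2) dvd(1) by (rule dvd_trans)
        moreover have "d dvd p1 * j" using d(1) by (rule dvd_mult)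
        ultimately have "d dvd p1 * j - (p1 * j - e)" using dvd_diff by blast
        then have "d dvd e" by (simp only: diff_diff_eq2 add_diff_cancel_left')
        moreover have "e = 1 \<or> e = -1" using e by linarith
        ultimately show "is_unit d" by auto
      qed
      have "q dvd (p1 * j - e) - (p2 * j - e)" using dvd by (rule dvd_diff)
      then have "q dvd (p1 - p2) * j" by (simp add: algebra_simps)
      then have "q dvd p1 - p2" using \<open>coprime j q\<close> by (simp add: coprime_commute coprime_dvd_mult_left_iff)
      moreover have "\<bar>p1 - p2\<bar> < q" using less[OF that(1)] less[OF that(2)] that by auto
      ultimately show ?thesis using dvd_imp_le_int[of "p1 - p2" q] assms by linarith
    qed
    then have "\<forall>p1\<in>?A e. \<forall>p2\<in>?A e. p1 = p2" by blast
    then show ?thesis by (simp only: One_nat_def card_le_Suc0_iff_eq[OF fin])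
  qed
  have eq: "{p. 0 \<le> p \<and> p \<le> q \<and> (q dvd p * j - 1 \<or> q dvd p * j + 1)} = ?A 1 \<union> ?A (-1)" by auto
  show "finite {p. 0 \<le> p \<and> p \<le> q \<and> (q dvd p * j - 1 \<or> q dvd p * j + 1)}"
    by (rule finite_subset[of _ "{0..q}"]) auto
  show "card {p. 0 \<le> p \<and> p \<le> q \<and> (q dvd p * j - 1 \<or> q dvd p * j + 1)} \<le> 2"
    unfolding eq using card_Un_le[of "?A 1" "?A (-1)"] *[of 1] *[of "-1"] by simp
qed

context slow_gauge
begin

text \<open>All intervals involved have length at least \<open>1 / (q\<^sup>2 \<Psi>)\<close>, where \<open>f r / r\<close> is largest; with this
  factor taken out, only the sum of the lengths remains.\<close>

lemma sum_gauge_convergent_intervals: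
  assumes \<Psi>: "1 \<le> \<Psi>" and q: "0 < q" "2 / (real q)\<^sup>2 \<le> r\<^sub>0"
  shows "(\<Sum>j=1..q. f (2 * min (1 / (real q * real j * \<Psi>)) (1 / (real q)\<^sup>2)))
      \<le> 2 * (2 + ln \<Psi>) * (real q * f (1 / ((real q)\<^sup>2 * \<Psi>)))"
proof -
  define s0 where "s0 = 1 / ((real q)\<^sup>2 * \<Psi>)"
  define s where "s j = min (1 / (real q * real j * \<Psi>)) (1 / (real q)\<^sup>2)" for j
  have s0: "0 < s0" using assms by (simp add: s0_def)
  have "f (2 * s j) \<le> (2 * f s0 / s0) * s j" if j: "j \<in> {1..q}" for j
  proof -
    have "real q * real j * \<Psi> \<le> (real q)\<^sup>2 * \<Psi>" using j \<Psi> by (simp add: power2_eq_square)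
    then have "s0 \<le> 1 / (real q * real j * \<Psi>)"
      unfolding s0_def using j \<Psi> q by (intro divide_left_mono) auto
    moreover have "s0 \<le> 1 / (real q)\<^sup>2"
      unfolding s0_def using \<Psi> q by (intro divide_left_mono) (auto simp: mult_le_cancel_left1)
    ultimately have "s0 \<le> s j" by (simp add: s_def)
    moreover have "2 * s j \<le> r\<^sub>0" using q(2) by (simp add: s_def)
    ultimately have "f (2 * s j) / (2 * s j) \<le> f s0 / s0"
      using s0 by (intro ratio_antimono) auto
    then show ?thesis using s0 \<open>s0 \<le> s j\<close> by (simp add: field_simps)
  qed
  then have "(\<Sum>j=1..q. f (2 * s j)) \<le> (2 * f s0 / s0) * (\<Sum>j=1..q. s j)"
    unfolding sum_distrib_left by (rule sum_mono)
  also have "\<dots> \<le> (2 * f s0 / s0) * ((2 + ln \<Psi>) / (real q * \<Psi>))"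
    unfolding s_def using s0 gauge_pos[OF s0] sum_min_inverse_le[OF \<Psi> q(1)]
    by (intro mult_left_mono) auto
  also have "\<dots> = 2 * (2 + ln \<Psi>) * (real q * f s0)"
    using \<Psi> q by (simp add: s0_def power2_eq_square)
  finally show ?thesis by (simp add: s_def s0_def)
qed

text \<open>The intervals around all \<open>p/q\<close> with \<open>q \<ge> N\<close> cover the set, and their cost is bounded by a tail of
  the series. Since \<open>ln \<Psi>(q)\<close> stays away from \<open>0\<close>, the bound \<open>2 + ln \<Psi>(q)\<close> can be absorbed into a
  multiple of \<open>ln \<Psi>(q)\<close>.\<close>

lemma measure_zero_of_summable:
  fixes \<psi> :: "real \<Rightarrow> real" and t\<^sub>0 t\<^sub>1 :: real
  assumes psi_pos: "\<forall>t>0. 0 < \<psi> t"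
    and psi_noninc: "antimono_on {0<..} \<psi>"
    and t0: "1 \<le> t\<^sub>0" "\<forall>t\<ge>t\<^sub>0. t * \<psi> t < 1"
    and Psi_mono: "mono_on {t\<^sub>0..} (Psi \<psi>)"
    and t1: "t\<^sub>0 \<le> t\<^sub>1" "1 < Psi \<psi> t\<^sub>1"
    and summable: "summable (\<lambda>q. if t\<^sub>0 \<le> real q then series_term \<psi> f q else 0)"
  shows "hausdorff_measure f (dirichlet_non_improvable \<psi>) = 0"
proof (rule hausdorff_measure_zeroI)
  fix \<rho> e :: real assume \<rho>: "0 < \<rho>" and e: "0 < e"
  define c where "c = Psi \<psi> t\<^sub>1"
  \<comment> \<open>\<open>2 + ln \<Psi> \<le> K ln \<Psi>\<close> as soon as \<open>\<Psi> \<ge> c\<close>\<close>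
  define K where "K = 2 / ln c + 1"
  have c: "1 < c" using t1 by (simp add: c_def)
  have K: "0 < K" using c by (simp add: K_def add_pos_pos)
  have Psi_ge: "c \<le> Psi \<psi> t" if "t\<^sub>1 \<le> t" for t
    unfolding c_def using Psi_mono t1 that by (auto simp: monotone_on_def)
  have log_le: "2 + ln (Psi \<psi> t) \<le> K * ln (Psi \<psi> t)" if "t\<^sub>1 \<le> t" for t
  proof -
    have "ln c \<le> ln (Psi \<psi> t)" using Psi_ge[OF that] c by simp
    then have "2 \<le> 2 / ln c * ln (Psi \<psi> t)" using c by (simp add: field_simps)
    then show ?thesis by (simp add: K_def algebra_simps)
  qed
  from summable obtain N0 where N0: "\<And>m n. N0 \<le> m \<Longrightarrow>
      \<bar>\<Sum>q=m..<n. if t\<^sub>0 \<le> real q then series_term \<psi> f q else 0\<bar> < e / (4 * K)"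
    using e K unfolding summable_Cauchy real_norm_def by (metis divide_pos_pos mult_pos_pos zero_less_numeral)
  define N where "N = Max {N0, nat \<lceil>t\<^sub>1\<rceil>, 2, nat \<lceil>2 / r\<^sub>0\<rceil>, nat \<lceil>2 / \<rho>\<rceil>}"
  have N_ge: "N0 \<le> N" "t\<^sub>1 \<le> real N" "2 \<le> N" "2 / r\<^sub>0 \<le> real N" "2 / \<rho> \<le> real N"
  proof -
    have le: "j \<le> N" if "j \<in> {N0, nat \<lceil>t\<^sub>1\<rceil>, 2, nat \<lceil>2 / r\<^sub>0\<rceil>, nat \<lceil>2 / \<rho>\<rceil>}" for j
      unfolding N_def by (rule Max_ge) (use that in auto)
    show "N0 \<le> N" "2 \<le> N" by (auto intro: le)
    show "t\<^sub>1 \<le> real N" using le[of "nat \<lceil>t\<^sub>1\<rceil>"] by (auto simp: nat_le_iff ceiling_le_iff)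
    show "2 / r\<^sub>0 \<le> real N" using le[of "nat \<lceil>2 / r\<^sub>0\<rceil>"] by (auto simp: nat_le_iff ceiling_le_iff)
    show "2 / \<rho> \<le> real N" using le[of "nat \<lceil>2 / \<rho>\<rceil>"] by (auto simp: nat_le_iff ceiling_le_iff)
  qed
  have small: "2 / (real q)\<^sup>2 \<le> y" if "2 / y \<le> real N" "0 < y" "N \<le> q" for q y
  proof -
    have "1 \<le> real q" "2 / y \<le> real q" using that N_ge by linarith+
    then have "2 \<le> y * real q" using that by (simp add: field_simps)
    also have "\<dots> \<le> y * (real q)\<^sup>2"
      using that \<open>1 \<le> real q\<close> by (simp add: power2_eq_square)
    finally show ?thesis using \<open>1 \<le> real q\<close> by (simp add: field_simps)
  qed
  define s where "s q j = min (1 / (real q * real j * Psi \<psi> (real q))) (1 / (real q)\<^sup>2)" for q j :: nat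
  define P where "P q j = {p::int. 0 \<le> p \<and> p \<le> int q \<and> (int q dvd p * int j - 1 \<or> int q dvd p * int j + 1)}" for q j :: nat
  define I where "I = (SIGMA q:{N..}. SIGMA j:{1..q}. P q j)"
  define g where "g = (\<lambda>(q, j, p). ball (of_int p / real q) (s q j))"
  have s_pos: "0 < s q j" if "N \<le> q" "1 \<le> j" for q j
  proof -
    have "0 < Psi \<psi> (real q)" using Psi_ge[of "real q"] that N_ge c by simp
    then show ?thesis using that N_ge by (simp add: s_def)
  qed
  have diam: "diameter (g (q, j, p)) = 2 * s q j" if "N \<le> q" "1 \<le> j" for q j p
    using s_pos[OF that] by (simp add: g_def diameter_ball)
  show "\<exists>\<B>\<in>ball_covers \<rho> (dirichlet_non_improvable \<psi>).
         \<forall>F. finite F \<and> F \<subseteq> \<B> \<longrightarrow> (\<Sum>B\<in>F. ennreal (f (diameter B))) \<le> ennreal e"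
  proof (intro bexI[of _ "g ` I"] allI impI)
    fix F assume "finite F \<and> F \<subseteq> g ` I"
    then obtain C where C: "C \<subseteq> I" "F = g ` C" "inj_on g C"
      by (meson subset_image_inj)
    have "finite C" using C(2,3) \<open>finite F \<and> F \<subseteq> g ` I\<close> by (metis finite_imageD)
    obtain M where M: "\<And>i. i \<in> C \<Longrightarrow> fst i < M"
      using \<open>finite C\<close> by (metis finite_imageI finite_nat_set_iff_bounded imageI)
    define J where "J = (SIGMA q:{N..<M}. SIGMA j:{1..q}. P q j)"
    have finP: "finite (P q j)" "card (P q j) \<le> 2" if "N \<le> q" for q j
      unfolding P_def using card_unit_residues_le[of "int q" "int j"] that N_ge(3) by auto
    have "finite J" unfolding J_def using finP by (intro finite_SigmaI) auto
    have "C \<subseteq> J" using C(1) M by (fastforce simp: J_def I_def)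
    have f_nonneg: "0 \<le> f (diameter (g i))" if "i \<in> J" for i
    proof -
      obtain q j p where i: "i = (q, j, p)" by (cases i)
      then have "N \<le> q" "1 \<le> j" using that by (auto simp: J_def)
      then show ?thesis using gauge_pos[of "2 * s q j"] s_pos diam i by fastforce
    qed
    have "(\<Sum>B\<in>F. f (diameter B)) = (\<Sum>i\<in>C. f (diameter (g i)))"
      using C by (simp add: sum.reindex)
    also have "\<dots> \<le> (\<Sum>i\<in>J. f (diameter (g i)))"
      by (rule sum_mono2) (use \<open>finite J\<close> \<open>C \<subseteq> J\<close> f_nonneg in auto)
    also have "\<dots> = (\<Sum>q=N..<M. \<Sum>j=1..q. \<Sum>p\<in>P q j. f (diameter (g (q, j, p))))"
    proof -
      have "(\<Sum>i\<in>J. f (diameter (g i))) = (\<Sum>q=N..<M. \<Sum>y\<in>Sigma {1..q} (P q). f (diameter (g (q, y))))"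
        unfolding J_def by (subst sum.Sigma) (use finP in \<open>auto simp: case_prod_unfold\<close>)
      also have "\<dots> = (\<Sum>q=N..<M. \<Sum>j=1..q. \<Sum>p\<in>P q j. f (diameter (g (q, j, p))))"
        by (rule sum.cong[OF refl], subst sum.Sigma) (use finP in \<open>auto simp: case_prod_unfold\<close>)
      finally show ?thesis .
    qed
    also have "\<dots> = (\<Sum>q=N..<M. \<Sum>j=1..q. \<Sum>p\<in>P q j. f (2 * s q j))"
      by (intro sum.cong refl) (simp add: diam)
    also have "\<dots> \<le> (\<Sum>q=N..<M. \<Sum>j=1..q. 2 * f (2 * s q j))"
    proof (intro sum_mono)
      fix q j assume "q \<in> {N..<M}" "j \<in> {1..q}"
      then have "0 < f (2 * s q j)" "card (P q j) \<le> 2" using s_pos finP by (auto intro!: gauge_pos)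
      then show "(\<Sum>p\<in>P q j. f (2 * s q j)) \<le> 2 * f (2 * s q j)"
        by simp
    qed
    also have "\<dots> \<le> (\<Sum>q=N..<M. 4 * K * (if t\<^sub>0 \<le> real q then series_term \<psi> f q else 0))"
    proof (rule sum_mono)
      fix q assume "q \<in> {N..<M}"
      then have q: "N \<le> q" "t\<^sub>1 \<le> real q" "0 < q" using N_ge by auto
      have fpos: "0 < f (1 / ((real q)\<^sup>2 * Psi \<psi> (real q)))"
        using Psi_ge[OF q(2)] c q by (intro gauge_pos) simp
      have "(\<Sum>j=1..q. 2 * f (2 * s q j)) = 2 * (\<Sum>j=1..q. f (2 * s q j))"
        by (simp add: sum_distrib_left)
      also have "\<dots> \<le> 2 * (2 * (2 + ln (Psi \<psi> (real q))) * (real q * f (1 / ((real q)\<^sup>2 * Psi \<psi> (real q)))))"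
        unfolding s_def using Psi_ge[OF q(2)] c q small[OF N_ge(4) r0_pos q(1)]
        by (intro mult_left_mono sum_gauge_convergent_intervals) auto
      also have "\<dots> \<le> 2 * (2 * (K * ln (Psi \<psi> (real q))) * (real q * f (1 / ((real q)\<^sup>2 * Psi \<psi> (real q)))))"
        using log_le[OF q(2)] fpos q by (intro mult_left_mono mult_right_mono) auto
      also have "\<dots> = 4 * K * series_term \<psi> f q" by (simp add: series_term_def)
      finally show "(\<Sum>j=1..q. 2 * f (2 * s q j)) \<le> 4 * K * (if t\<^sub>0 \<le> real q then series_term \<psi> f q else 0)"
        using q t1 by simp
    qed
    also have "\<dots> = 4 * K * (\<Sum>q=N..<M. if t\<^sub>0 \<le> real q then series_term \<psi> f q else 0)"
      by (simp add: sum_distrib_left)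
    also have "\<dots> \<le> 4 * K * (e / (4 * K))"
      using N0[OF N_ge(1), of M] K by (intro mult_left_mono) auto
    also have "\<dots> = e" using K by simp
    finally have le: "(\<Sum>B\<in>F. f (diameter B)) \<le> e" .
    have "(\<Sum>B\<in>F. ennreal (f (diameter B))) = ennreal (\<Sum>B\<in>F. f (diameter B))"
      using C(2) \<open>C \<subseteq> J\<close> f_nonneg by (intro sum_ennreal) auto
    then show "(\<Sum>B\<in>F. ennreal (f (diameter B))) \<le> ennreal e"
      using le by (simp add: ennreal_leI)
  next
    have "countable I" unfolding I_def by (intro countable_SIGMA countableI_type)
    moreover have "(\<exists>c r. 0 < r \<and> g i = ball c r) \<and> diameter (g i) \<le> \<rho>" if "i \<in> I" for i
    proof -
      obtain q j p where "i = (q, j, p)" by (cases i)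
      with that have i: "i = (q, j, p)" "N \<le> q" "1 \<le> j" by (auto simp: I_def)
      have "2 * s q j \<le> 2 / (real q)\<^sup>2" by (simp add: s_def)
      also have "\<dots> \<le> \<rho>" using small[OF N_ge(5) \<rho> i(2)] .
      finally have "diameter (g i) \<le> \<rho>" using diam i by simp
      moreover have "g i = ball (of_int p / real q) (s q j)" by (simp add: i g_def)
      ultimately show ?thesis using s_pos[OF i(2,3)] by blast
    qed
    moreover have "dirichlet_non_improvable \<psi> \<subseteq> \<Union> (g ` I)"
    proof
      fix x assume x: "x \<in> dirichlet_non_improvable \<psi>"
      have irr: "x \<notin> \<rat>" using rational_improvable[OF psi_pos] x by blast
      have x01: "0 \<le> x" "x < 1" using x by (auto simp: dirichlet_non_improvable_iff)
      obtain t where t: "real N < t" "non_improvable_at \<psi> t x"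
        using x by (auto simp: dirichlet_non_improvable_iff)
      then have "1 < t" using N_ge(3) by linarith
      obtain p q p' q' :: int where pq: "0 < q'" "q' < q" "t \<le> of_int q" "\<bar>p * q' - p' * q\<bar> = 1"
        "\<bar>of_int q * x - of_int p\<bar> < 1 / of_int q"
        "of_int q' * \<bar>of_int q * x - of_int p\<bar> \<le> 1 - of_int q * \<psi> (of_int q)"
        by (rule non_improvable_cover[OF psi_noninc irr \<open>1 < t\<close> t(2)])
      define Q j where "Q = nat q" and "j = nat q'"
      have Q: "real_of_int q = real Q" "q = int Q" "real_of_int q' = real j" "q' = int j"
        using pq by (auto simp: Q_def j_def)
      have QN: "N \<le> Q" "1 \<le> j" "j \<le> Q" using pq t Q by linarith+
      have Qt: "t\<^sub>1 \<le> real Q" using QN N_ge by linarith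
      have Q0: "0 < real Q" "1 \<le> real Q" using QN by linarith+
      have \<Psi>: "1 < Psi \<psi> (real Q)" using Psi_ge[OF Qt] c by simp
      have "1 - real Q * \<psi> (real Q) = 1 / (1 + Psi \<psi> (real Q))"
        using t0(2)[rule_format, of "real Q"] Qt t1 by (simp add: Psi_def field_simps)
      also have "\<dots> < 1 / Psi \<psi> (real Q)" using \<Psi> by (intro divide_strict_left_mono) auto
      finally have "real j * \<bar>real Q * x - of_int p\<bar> < 1 / Psi \<psi> (real Q)" using pq(6) Q by simp
      moreover have absx: "\<bar>real Q * x - of_int p\<bar> = real Q * \<bar>x - of_int p / real Q\<bar>"
      proof -
        have "real Q * x - of_int p = real Q * (x - of_int p / real Q)" using Q0 by (simp add: field_simps)
        then show ?thesis by (simp only: abs_mult abs_of_nat)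
      qed
      ultimately have "\<bar>x - of_int p / real Q\<bar> < 1 / (real Q * real j * Psi \<psi> (real Q))"
        using Q0 QN \<Psi> by (simp add: field_simps)
      moreover have "\<bar>x - of_int p / real Q\<bar> < 1 / (real Q)\<^sup>2"
        using pq(5) absx Q Q0 by (simp add: field_simps power2_eq_square)
      ultimately have "x \<in> g (Q, j, p)"
        by (simp add: g_def s_def dist_real_def abs_minus_commute)
      moreover have "p \<in> P Q j"
      proof -
        have "\<bar>real Q * x - of_int p\<bar> < 1"
          using pq(5) Q Q0 by (smt (verit) divide_le_eq_1)
        moreover have "0 \<le> real Q * x" "real Q * x < real Q" using x01 Q0 by auto
        ultimately have "-1 < real_of_int p" "real_of_int p < real Q + 1" by linarith+
        then have "0 \<le> p" "p \<le> int Q" by linarith+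
        moreover have "p * int j - p' * int Q = 1 \<or> p * int j - p' * int Q = -1"
          using pq(4) Q by auto
        then have "int Q dvd p * int j - 1 \<or> int Q dvd p * int j + 1"
        proof
          assume "p * int j - p' * int Q = 1"
          then have "p * int j - 1 = int Q * p'" by (simp add: algebra_simps)
          then show ?thesis by (metis dvd_triv_left)
        next
          assume "p * int j - p' * int Q = -1"
          then have "p * int j + 1 = int Q * p'" by (simp add: algebra_simps)
          then show ?thesis by (metis dvd_triv_left)
        qed
        ultimately show ?thesis by (simp add: P_def)
      qed
      then have "(Q, j, p) \<in> I" using QN by (simp add: I_def)
      ultimately show "x \<in> \<Union> (g ` I)" by blast
    qed
    ultimately show "g ` I \<in> ball_covers \<rho> (dirichlet_non_improvable \<psi>)"
      by (auto simp: ball_covers_def)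
  qed
qed

end

section \<open>Counting fractions in an interval\<close>

lemma length_le_sum_of_cover:
  fixes a b :: real and c r :: "'i \<Rightarrow> real"
  assumes "finite I" "a \<le> b" and r: "\<And>i. i \<in> I \<Longrightarrow> 0 \<le> r i"
    and cover: "{a..b} \<subseteq> (\<Union>i\<in>I. {c i - r i..c i + r i})"
  shows "b - a \<le> (\<Sum>i\<in>I. 2 * r i)"
proof -
  have "b - a = measure lborel {a..b}" using \<open>a \<le> b\<close> by simp
  also have "\<dots> \<le> measure lborel (\<Union>i\<in>I. {c i - r i..c i + r i})"
    by (intro measure_mono_fmeasurable cover fmeasurable.finite_UN assms(1) fmeasurableI)
      (auto simp: emeasure_lborel_Icc_eq)
  also have "\<dots> \<le> (\<Sum>i\<in>I. measure lborel {c i - r i..c i + r i})"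
    by (intro measure_UNION_le assms(1)) auto
  also have "\<dots> = (\<Sum>i\<in>I. 2 * r i)" using r by (intro sum.cong) auto
  finally show ?thesis .
qed

lemma card_integers_between:
  fixes a b :: real
  assumes "a \<le> b"
  shows "finite {p::int. a \<le> of_int p \<and> of_int p \<le> b}"
    "real (card {p::int. a \<le> of_int p \<and> of_int p \<le> b}) \<le> b - a + 1"
proof -
  have eq: "{p::int. a \<le> of_int p \<and> of_int p \<le> b} = {\<lceil>a\<rceil>..\<lfloor>b\<rfloor>}"
    by (auto simp: ceiling_le_iff le_floor_iff)
  show "finite {p::int. a \<le> of_int p \<and> of_int p \<le> b}" unfolding eq by simp
  show "real (card {p::int. a \<le> of_int p \<and> of_int p \<le> b}) \<le> b - a + 1"
    unfolding eq using assms by (simp add: of_nat_diff) linarith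
qed

text \<open>Points at distance at least \<open>s\<close> lie in different cells of length \<open>s\<close>.\<close>

lemma card_le_of_separated:
  fixes A :: "real set"
  assumes s: "0 < s" and d: "0 \<le> d" and sub: "A \<subseteq> {a..a + d}"
    and sep: "\<And>x y. x \<in> A \<Longrightarrow> y \<in> A \<Longrightarrow> x \<noteq> y \<Longrightarrow> s \<le> \<bar>x - y\<bar>"
  shows "finite A" "real (card A) \<le> d / s + 1"
proof -
  define h where "h x = \<lfloor>(x - a) / s\<rfloor>" for x
  have inj: "inj_on h A"
  proof (rule inj_onI, rule ccontr)
    fix x y assume xy: "x \<in> A" "y \<in> A" "h x = h y" "x \<noteq> y"
    have "\<bar>(x - a) / s - (y - a) / s\<bar> < 1" using xy(3) unfolding h_def by linarith
    also have "(x - a) / s - (y - a) / s = (x - y) / s" by (simp add: diff_divide_distrib)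
    finally have "\<bar>x - y\<bar> < s" using s by (simp add: field_simps)
    then show False using sep xy by force
  qed
  have img: "h ` A \<subseteq> {p::int. 0 \<le> real_of_int p \<and> of_int p \<le> d / s}"
  proof
    fix p assume "p \<in> h ` A"
    then obtain x where x: "x \<in> A" "p = h x" by blast
    then have "0 \<le> (x - a) / s" "(x - a) / s \<le> d / s"
      using sub s by (auto intro!: divide_right_mono)
    then show "p \<in> {p. 0 \<le> real_of_int p \<and> of_int p \<le> d / s}" unfolding x(2) h_def by auto linarith
  qed
  have nn: "0 \<le> d / s" using s d by simp
  note ints = card_integers_between[OF nn]
  show "finite A" using inj img ints(1) by (metis finite_imageD finite_subset)
  have "card A = card (h ` A)" using inj by (simp add: card_image)
  also have "\<dots> \<le> card {p::int. 0 \<le> real_of_int p \<and> of_int p \<le> d / s}"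
    by (intro card_mono img ints)
  finally show "real (card A) \<le> d / s + 1" using ints(2) by simp
qed

lemma fraction_gap:
  fixes p q p' q' :: int
  assumes "0 < q" "0 < q'" "real_of_int p / of_int q \<noteq> of_int p' / of_int q'"
  shows "1 / (of_int q * of_int q') \<le> \<bar>real_of_int p / of_int q - of_int p' / of_int q'\<bar>"
proof -
  have eq: "real_of_int p / of_int q - of_int p' / of_int q' = of_int (p * q' - p' * q) / (of_int q * of_int q')"
    using assms by (simp add: field_simps)
  have "p * q' - p' * q \<noteq> 0"
  proof
    assume "p * q' - p' * q = 0"
    with eq have "real_of_int p / of_int q - of_int p' / of_int q' = of_int 0 / (of_int q * of_int q')"
      by (simp only:)
    then show False using assms(3) by simp
  qed
  then have "1 \<le> \<bar>p * q' - p' * q\<bar>" by linarith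
  then have "1 \<le> \<bar>real_of_int (p * q' - p' * q)\<bar>" by linarith
  then show ?thesis unfolding eq abs_divide using assms
    by (simp add: divide_right_mono abs_mult del: of_int_diff of_int_mult)
qed

lemma coprime_fraction_unique:
  fixes p q p' q' :: int
  assumes "0 < q" "0 < q'" "coprime p q" "coprime p' q'"
    and "real_of_int p / of_int q = of_int p' / of_int q'"
  shows "p = p' \<and> q = q'"
proof -
  have "real_of_int (p * q') = real_of_int (p' * q)" using assms by (simp add: field_simps)
  then have eq: "p * q' = p' * q" by linarith
  then have "q dvd p * q'" "q' dvd p' * q" by (metis dvd_triv_right)+
  then have "q dvd q'" "q' dvd q"
    using assms(3,4) by (simp_all add: coprime_commute coprime_dvd_mult_right_iff)
  then have "q = q'" using assms(1,2) by (simp add: zdvd_antisym_nonneg)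
  then show ?thesis using eq assms by simp
qed

text \<open>A level spans a factor 16 in the denominators, which is enough for the fractions of a single level
  to come close to most points of an interval.\<close>

definition farey :: "nat \<Rightarrow> real \<Rightarrow> real \<Rightarrow> (int \<times> int) set" where
  "farey k u v = {(p, q). coprime p q \<and> 16 ^ k \<le> q \<and> q < 16 ^ Suc k \<and>
     u \<le> of_int p / of_int q \<and> of_int p / of_int q \<le> v}"

lemma card_farey_le:
  assumes "0 \<le> d"
  shows "finite (farey k u (u + d))" "real (card (farey k u (u + d))) \<le> d * (16 ^ Suc k)\<^sup>2 + 1"
proof -
  define h where "h = (\<lambda>(p, q). real_of_int p / real_of_int q)"
  have pos: "(0::int) < 16 ^ k" by simp
  have q_pos: "0 < q" if "(p, q) \<in> farey k u (u + d)" for p q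
    using that pos unfolding farey_def by (auto intro: less_le_trans)
  have inj: "inj_on h (farey k u (u + d))"
  proof (rule inj_onI)
    fix x y assume xy: "x \<in> farey k u (u + d)" "y \<in> farey k u (u + d)" "h x = h y"
    obtain p q p' q' where eq: "x = (p, q)" "y = (p', q')" by (cases x, cases y)
    have "0 < q" "0 < q'" using xy eq q_pos by auto
    moreover have "coprime p q" "coprime p' q'" using xy eq by (auto simp: farey_def)
    ultimately show "x = y" using coprime_fraction_unique[of q q' p p'] xy(3) by (simp add: eq h_def)
  qed
  have sub: "h ` farey k u (u + d) \<subseteq> {u..u + d}" by (auto simp: h_def farey_def)
  have sep: "1 / (16 ^ Suc k)\<^sup>2 \<le> \<bar>x - y\<bar>"
    if xy: "x \<in> h ` farey k u (u + d)" "y \<in> h ` farey k u (u + d)" "x \<noteq> y" for x y :: real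
  proof -
    obtain p q p' q' where eq: "x = h (p, q)" "y = h (p', q')"
      and mem: "(p, q) \<in> farey k u (u + d)" "(p', q') \<in> farey k u (u + d)"
      using xy(1,2) by (elim imageE) (metis surj_pair)
    have q: "0 < q" "0 < q'" using mem q_pos by auto
    have "q \<le> 16 ^ Suc k" "q' \<le> 16 ^ Suc k" using mem by (auto simp: farey_def)
    then have "real_of_int q \<le> 16 ^ Suc k" "real_of_int q' \<le> 16 ^ Suc k"
      by (metis of_int_le_iff of_int_numeral of_int_power)+
    then have "real_of_int q * of_int q' \<le> 16 ^ Suc k * 16 ^ Suc k"
      using q by (intro mult_mono) auto
    then have "1 / (16 ^ Suc k)\<^sup>2 \<le> 1 / (real_of_int q * of_int q')"
      using q by (intro divide_left_mono) (auto simp: power2_eq_square)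
    also have "\<dots> \<le> \<bar>x - y\<bar>" using fraction_gap[OF q, of p p'] xy(3) by (simp add: eq h_def)
    finally show ?thesis .
  qed
  have "finite (h ` farey k u (u + d))"
    "real (card (h ` farey k u (u + d))) \<le> d / (1 / (16 ^ Suc k)\<^sup>2) + 1"
    using card_le_of_separated[OF _ assms sub sep] by auto
  then show "finite (farey k u (u + d))" "real (card (farey k u (u + d))) \<le> d * (16 ^ Suc k)\<^sup>2 + 1"
    using inj by (auto simp: finite_image_iff card_image)
qed

lemma harm_le: "0 < n \<Longrightarrow> harm n \<le> 1 + ln (real n)"
  using euler_mascheroni_sequence_decreasing[of 1 n] by (simp add: harm_def)

text \<open>By Dirichlet's theorem with \<open>Q = 16^(k+1)\<close>, each point of the middle half of the interval is
  within \<open>2 / (q Q)\<close> of a reduced \<open>p/q\<close> with \<open>q < Q\<close>. The points that are served only by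
  denominators \<open>q < Q / 16\<close> fill at most about a quarter of the length (up to a logarithmic term
  over \<open>Q\<close>); the rest is covered by intervals of length \<open>64 / Q\<^sup>2\<close> around fractions of level \<open>k\<close>,
  so there must be many of these.\<close>

lemma card_farey_ge:
  fixes u d :: real
  assumes d: "0 < d"
  shows "\<exists>k\<^sub>0. \<forall>k\<ge>k\<^sub>0. d * (16 ^ k)\<^sup>2 \<le> real (card (farey k u (u + d)))"
proof -
  have "(\<lambda>k. (8 / 16 ^ Suc k) * (1 + ln (16 ^ Suc k)) :: real) \<longlonglongrightarrow> 0"
  proof -
    have "(\<lambda>n. 8 * (1 / real n) + 8 * (ln (real n) / real n)) \<longlonglongrightarrow> 8 * 0 + 8 * 0"
      by (intro tendsto_add tendsto_mult tendsto_const lim_1_over_n lim_ln_over_n)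
    then have lim: "(\<lambda>n. 8 / real n * (1 + ln (real n))) \<longlonglongrightarrow> 0"
      by (simp add: distrib_left)
    have "strict_mono (\<lambda>k. 16 ^ Suc k :: nat)" by (intro strict_monoI power_strict_increasing) auto
    from LIMSEQ_subseq_LIMSEQ[OF lim this] show ?thesis
      by (simp only: o_def of_nat_power of_nat_numeral)
  qed
  then have "\<forall>\<^sub>F k in sequentially. \<bar>(8 / 16 ^ Suc k) * (1 + ln (16 ^ Suc k)) :: real\<bar> < d / 8"
    using d by (intro order_tendstoD(2)[where y=0] tendsto_rabs_zero) auto
  moreover have "\<forall>\<^sub>F k in sequentially. 8 / d \<le> real k"
    using eventually_ge_at_top[of "nat \<lceil>8 / d\<rceil>"] by eventually_elim linarith
  ultimately have "\<forall>\<^sub>F k in sequentially. d * (16 ^ k)\<^sup>2 \<le> real (card (farey k u (u + d)))"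
  proof eventually_elim
    case (elim k)
    define Q :: nat where "Q = 16 ^ Suc k"
    \<comment> \<open>the margin \<open>d / 4\<close> keeps the fractions found near the middle half inside the interval\<close>
    define v m where "v = u + d / 4" and "m = d / 2"
    have Q16: "Q = 16 * 16 ^ k" by (simp add: Q_def)
    have Qpos: "0 < real Q" and Q2: "16 \<le> Q" by (auto simp: Q_def)
    have "k < 16 ^ k" by (rule less_exp[THEN order_less_le_trans]) (simp add: power_mono)
    then have "real k \<le> real Q" unfolding Q16 by (simp flip: of_nat_power)
    then have "8 / d \<le> real Q" using elim by linarith
    then have Qd: "2 / real Q \<le> d / 4" using d Qpos by (simp add: field_simps)
    define G where "G = farey k u (u + d)"
    define Z where "Z q = {p::int. real q * v - 2 / real Q \<le> of_int p \<and> of_int p \<le> real q * (v + m) + 2 / real Q}" for q :: nat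
    define Bad where "Bad = (SIGMA q:{1..<16 ^ k}. Z q)"
    have m: "0 < m" using d by (simp add: m_def)
    have Z_le: "real q * v - 2 / real Q \<le> real q * (v + m) + 2 / real Q" for q
      using m Qpos by (simp add: algebra_simps)
    have finZ: "finite (Z q)" for q unfolding Z_def by (rule card_integers_between[OF Z_le])
    have cardZ: "real (card (Z q)) \<le> real q * m + 2" for q
    proof -
      have "4 / real Q \<le> 1" using Q2 by simp
      then show ?thesis using card_integers_between(2)[OF Z_le[of q]] by (simp add: Z_def algebra_simps)
    qed
    have finG: "finite G" unfolding G_def using card_farey_le d by simp
    have finBad: "finite Bad" unfolding Bad_def using finZ by auto
    define I where "I = Inl ` G \<union> Inr ` Bad"
    define c where "c i = (case i of Inl (p, q) \<Rightarrow> real_of_int p / of_int q | Inr (q, p) \<Rightarrow> real_of_int p / real q)"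
      for i :: "int \<times> int + nat \<times> int"
    define r where "r i = (case i of Inl (p, q) \<Rightarrow> 32 / (real Q)\<^sup>2 | Inr (q, p) \<Rightarrow> 2 / (real q * real Q))"
      for i :: "int \<times> int + nat \<times> int"
    have cover: "{v..v + m} \<subseteq> (\<Union>i\<in>I. {c i - r i..c i + r i})"
    proof
      fix x assume x: "x \<in> {v..v + m}"
      have "0 < Q - 1" using Q2 by simp
      then obtain h l where hl: "coprime h l" "0 < l" "l \<le> int (Q - 1)" "\<bar>of_int l * x - of_int h\<bar> < 1 / real (Q - 1)"
        by (rule Dirichlet_approx_coprime)
      define q where "q = nat l"
      have q: "l = int q" "0 < q" "real_of_int l = real q" using hl by (auto simp: q_def)
      have "1 / real (Q - 1) \<le> 2 / real Q" using Q2 by (simp add: field_simps of_nat_diff)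
      then have close: "\<bar>real q * x - of_int h\<bar> \<le> 2 / real Q" using hl(4) q by simp
      have "x - of_int h / real q = (real q * x - of_int h) / real q" using q by (simp add: field_simps)
      then have "\<bar>x - of_int h / real q\<bar> = \<bar>real q * x - of_int h\<bar> / real q" by simp
      also have "\<dots> \<le> (2 / real Q) / real q" using close by (intro divide_right_mono) auto
      finally have near: "\<bar>x - of_int h / real q\<bar> \<le> 2 / (real q * real Q)" by (simp add: mult.commute)
      show "x \<in> (\<Union>i\<in>I. {c i - r i..c i + r i})"
      proof (cases "q < 16 ^ k")
        case True
        have "real q * v \<le> real q * x" "real q * x \<le> real q * (v + m)"
          using x by (auto intro!: mult_left_mono)
        then have "h \<in> Z q" unfolding Z_def using close by auto
        then have "Inr (q, h) \<in> I" using True q by (auto simp: I_def Bad_def)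
        then show ?thesis using near by (intro UN_I[of "Inr (q, h)"]) (auto simp: c_def r_def abs_le_iff)
      next
        case False
        then have q_ge: "real Q \<le> 16 * real q" unfolding Q16 by (simp flip: of_nat_power)
        have "2 / (real q * real Q) \<le> 2 / (real Q / 16 * real Q)"
          using q_ge q Qpos by (intro divide_left_mono mult_right_mono) auto
        then have near2: "\<bar>x - of_int h / real q\<bar> \<le> 32 / (real Q)\<^sup>2"
          using near by (simp add: power2_eq_square)
        have "2 / (real q * real Q) \<le> 2 / (1 * real Q)"
          using q Qpos by (intro divide_left_mono mult_right_mono) auto
        then have "\<bar>x - of_int h / real q\<bar> \<le> d / 4" using near Qd by simp
        moreover have "u + d / 4 \<le> x" "x \<le> u + d / 4 + d / 2" using x by (auto simp: v_def m_def)
        ultimately have "u \<le> of_int h / real q" "of_int h / real q \<le> u + d"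
          unfolding abs_le_iff using d by linarith+
        moreover have "l < 16 ^ Suc k" using hl(3) Q2 unfolding Q_def by (simp add: of_nat_diff)
        moreover have "16 ^ k \<le> l" using False unfolding q(1) by (simp flip: of_nat_power add: not_less)
        ultimately have "(h, l) \<in> G" using hl(1) by (simp add: G_def farey_def q)
        then have "Inl (h, l) \<in> I" by (simp add: I_def)
        then show ?thesis using near2 by (intro UN_I[of "Inl (h, l)"]) (auto simp: c_def r_def abs_le_iff q(3))
      qed
    qed
    have "m \<le> (\<Sum>i\<in>I. 2 * r i)"
      using length_le_sum_of_cover[OF _ _ _ cover] m finG finBad
      by (auto simp: I_def r_def split: sum.splits prod.splits)
    also have "\<dots> = (\<Sum>i\<in>Inl ` G. 2 * r i) + (\<Sum>i\<in>Inr ` Bad. 2 * r i)"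
      unfolding I_def using finG finBad by (intro sum.union_disjoint) auto
    also have "(\<Sum>i\<in>Inl ` G. 2 * r i) = real (card G) * (64 / (real Q)\<^sup>2)"
      by (simp add: sum.reindex r_def split_beta)
    also have "(\<Sum>i\<in>Inr ` Bad. 2 * r i) = (\<Sum>(q, p)\<in>Bad. 4 / (real q * real Q))"
      by (simp add: sum.reindex r_def split_beta)
    also have "\<dots> = (\<Sum>q=1..<16 ^ k. real (card (Z q)) * (4 / (real q * real Q)))"
      unfolding Bad_def using finZ by (simp add: sum.Sigma[symmetric])
    also have "\<dots> \<le> (\<Sum>q=1..<16 ^ k. 4 * m / real Q + 8 / real Q * inverse (real q))"
    proof (rule sum_mono)
      fix q :: nat assume "q \<in> {1..<16 ^ k}"
      then have q: "0 < real q" by simp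
      have "real (card (Z q)) * (4 / (real q * real Q)) \<le> (real q * m + 2) * (4 / (real q * real Q))"
        using cardZ by (intro mult_right_mono) auto
      also have "\<dots> = 4 * m / real Q + 8 / real Q * inverse (real q)"
        using q Qpos by (simp add: field_simps)
      finally show "real (card (Z q)) * (4 / (real q * real Q)) \<le> 4 * m / real Q + 8 / real Q * inverse (real q)" .
    qed
    also have "\<dots> = real (16 ^ k - 1) * (4 * m / real Q) + 8 / real Q * (\<Sum>q=1..<16 ^ k. inverse (real q))"
      by (simp add: sum.distrib sum_distrib_left)
    also have "\<dots> \<le> real (16 ^ k) * (4 * m / real Q) + 8 / real Q * (1 + ln (real Q))"
    proof (intro add_mono mult_mono)
      have "(\<Sum>q=1..<16 ^ k. inverse (real q)) \<le> harm Q"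
        unfolding harm_def by (intro sum_mono2) (auto simp: Q16)
      also have "\<dots> \<le> 1 + ln (real Q)" using Qpos by (intro harm_le) simp
      finally show "(\<Sum>q=1..<16 ^ k. inverse (real q)) \<le> 1 + ln (real Q)" .
    qed (use m Qpos in \<open>auto intro!: sum_nonneg\<close>)
    also have "real (16 ^ k) * (4 * m / real Q) = m / 4" unfolding Q16 by simp
    also have "8 / real Q * (1 + ln (real Q)) \<le> m / 4"
    proof -
      have "8 / real Q * (1 + ln (real Q)) < d / 8"
        using elim(1) unfolding Q_def abs_less_iff by (simp only: of_nat_power of_nat_numeral)
      then show ?thesis by (simp add: m_def)
    qed
    finally have "m / 2 \<le> real (card G) * (64 / (real Q)\<^sup>2)" by simp
    then have "m / 128 * (real Q)\<^sup>2 \<le> real (card G)" using Qpos by (simp add: field_simps)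
    moreover have "m / 128 * (real Q)\<^sup>2 = d * (16 ^ k)\<^sup>2"
      by (simp add: m_def Q16 power_mult_distrib)
    ultimately show ?case by (simp add: G_def)
  qed
  then show ?thesis by (simp add: eventually_sequentially)
qed

section \<open>The children of a fraction\<close>

text \<open>The fraction \<open>p''/q''\<close> to the right of \<open>p'/q'\<close> with \<open>p'' q' - p' q'' = 1\<close> and \<open>1 \<le> q'' \<le> q'\<close>.\<close>

definition mate :: "int \<times> int \<Rightarrow> int \<times> int" where
  "mate x = (SOME y. 1 \<le> snd y \<and> snd y \<le> snd x \<and> fst y * snd x - fst x * snd y = 1)"

lemma mate:
  assumes "coprime (fst x) (snd x)" "1 \<le> snd x"
  shows "1 \<le> snd (mate x)" "snd (mate x) \<le> snd x" "fst (mate x) * snd x - fst x * snd (mate x) = 1"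
proof -
  obtain p q where x: "x = (p, q)" by (cases x)
  have q: "1 \<le> q" "coprime p q" using assms by (auto simp: x)
  obtain a b where "a * p + b * q = gcd p q" using bezout_int by blast
  then have ab: "a * p + b * q = 1" using q by simp
  define t where "t = (- a - 1) div q"
  define s where "s = (- a - 1) mod q + 1"
  have "s = - a - q * t" unfolding s_def t_def by (simp add: minus_mult_div_eq_mod[symmetric])
  then have "q * t + s = - a" by simp
  then have "b * q - p * (q * t + s) = b * q - p * (- a)" by (simp only:)
  then have "(b - p * t) * q - p * s = a * p + b * q" by (simp add: algebra_simps)
  moreover have "0 \<le> (- a - 1) mod q" "(- a - 1) mod q < q" using q by simp_all
  then have "1 \<le> s" "s \<le> q" unfolding s_def by linarith+
  ultimately have "\<exists>y. 1 \<le> snd y \<and> snd y \<le> snd x \<and> fst y * snd x - fst x * snd y = 1"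
    using ab by (intro exI[of _ "(b - p * t, s)"]) (simp add: x)
  from someI_ex[OF this] show "1 \<le> snd (mate x)" "snd (mate x) \<le> snd x"
    "fst (mate x) * snd x - fst x * snd (mate x) = 1"
    unfolding mate_def by auto
qed

text \<open>The children of \<open>x = p'/q'\<close> are the fractions \<open>(b p' + p'') / (b q' + q'')\<close>; they decrease to \<open>x\<close>
  as \<open>b\<close> grows, and \<open>x\<close> is a neighbour of each of them.\<close>

definition child_num :: "int \<times> int \<Rightarrow> nat \<Rightarrow> int" where
  "child_num x b = int b * fst x + fst (mate x)"

definition child_den :: "int \<times> int \<Rightarrow> nat \<Rightarrow> int" where
  "child_den x b = int b * snd x + snd (mate x)"

definition child :: "int \<times> int \<Rightarrow> nat \<Rightarrow> real" where
  "child x b = of_int (child_num x b) / of_int (child_den x b)"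

text \<open>The length of the interval to the left of a child on which the system has no solution at \<open>t\<close> equal
  to the denominator of the child, as soon as \<open>1 + \<Psi>(t) \<le> M\<close>.\<close>

definition window :: "real \<Rightarrow> int \<times> int \<Rightarrow> nat \<Rightarrow> real" where
  "window M x b = 1 / (of_int (child_den x b) * of_int (snd x) * M)"

context
  fixes x :: "int \<times> int"
  assumes x: "coprime (fst x) (snd x)" "1 \<le> snd x"
begin

lemma child_unimodular: "child_num x b * snd x - fst x * child_den x b = 1"
  using mate(3)[OF x] by (simp add: child_num_def child_den_def algebra_simps)

lemma child_den_bounds: "int b * snd x < child_den x b" "child_den x b \<le> (int b + 1) * snd x"
  using mate(1,2)[OF x] by (simp_all add: child_den_def algebra_simps)

lemma child_den_pos: "0 < child_den x b"
  using child_den_bounds(1)[of b] x(2) by (smt (verit) mult_nonneg_nonneg of_nat_0_le_iff)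

lemma parent_den_le: "1 \<le> b \<Longrightarrow> real_of_int (snd x) \<le> of_int (child_den x b)"
proof -
  assume "1 \<le> b"
  then have "1 * snd x \<le> int b * snd x" using x(2) by (intro mult_right_mono) auto
  then show ?thesis using child_den_bounds(1)[of b] by simp
qed

lemma child_den_Suc: "child_den x (Suc b) = child_den x b + snd x"
  by (simp add: child_den_def algebra_simps)

lemma coprime_child: "coprime (child_num x b) (child_den x b)"
proof (rule coprimeI)
  fix d assume "d dvd child_num x b" "d dvd child_den x b"
  then have "d dvd child_num x b * snd x - fst x * child_den x b" by (intro dvd_diff) auto
  then show "is_unit d" by (simp add: child_unimodular)
qed

lemma child_eq: "child x b = of_int (fst x) / of_int (snd x) + 1 / (of_int (child_den x b) * of_int (snd x))"
proof -
  have "of_int (child_num x b) * of_int (snd x) - of_int (fst x) * of_int (child_den x b) = (1::real)"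
    using child_unimodular[of b] by (metis of_int_1 of_int_diff of_int_mult)
  then show ?thesis using child_den_pos[of b] x(2) by (simp add: child_def field_simps)
qed

lemma child_gap: "child x b - child x (Suc b) = 1 / (of_int (child_den x b) * of_int (child_den x (Suc b)))"
proof -
  have "1 / (d * s) - 1 / ((d + s) * s) = 1 / (d * (d + s))" if "0 < d" "0 < s" for d s :: real
  proof -
    have "d + s \<noteq> 0" using that by simp
    then show ?thesis using that by (simp add: divide_simps)
  qed
  from this[of "of_int (child_den x b)" "of_int (snd x)"] show ?thesis
    using child_den_pos[of b] x(2) by (simp add: child_eq child_den_Suc)
qed

lemma child_antimono: "b \<le> c \<Longrightarrow> child x c \<le> child x b"
proof (induction rule: dec_induct)
  case (step n)
  have "0 \<le> child x n - child x (Suc n)"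
    unfolding child_gap using child_den_pos[of n] child_den_pos[of "Suc n"] by simp
  then show ?case using step by simp
qed simp

lemma window_pos: "0 < M \<Longrightarrow> 0 < window M x b"
  using child_den_pos[of b] x(2) by (simp add: window_def)

text \<open>With \<open>b \<le> M\<close> the windows of one parent are no longer than the gaps between its children up to a
  factor, which is why the sum of their lengths over an interval can be telescoped.\<close>

lemma window_le_gap:
  assumes "1 \<le> b" "real b \<le> M"
  shows "window M x b \<le> 3 * (child x b - child x (Suc b))"
proof -
  have "child_den x (Suc b) \<le> (int b + 2) * snd x" using child_den_bounds(2)[of "Suc b"] by (simp add: algebra_simps)
  also have "\<dots> \<le> (3 * int b) * snd x" using assms x(2) by (intro mult_right_mono) auto
  finally have "real_of_int (child_den x (Suc b)) \<le> of_int (3 * int b * snd x)" by (simp only: of_int_le_iff)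
  also have "\<dots> = 3 * real b * of_int (snd x)" by simp
  also have "\<dots> \<le> 3 * M * of_int (snd x)" using assms x(2) by (intro mult_right_mono mult_left_mono) auto
  finally have le: "real_of_int (child_den x (Suc b)) \<le> 3 * (of_int (snd x) * M)" by (simp add: mult_ac)
  have M: "0 < M" using assms by linarith
  have "window M x b = 3 * (1 / (of_int (child_den x b) * (3 * (of_int (snd x) * M))))"
    by (simp add: window_def)
  also have "\<dots> \<le> 3 * (1 / (of_int (child_den x b) * of_int (child_den x (Suc b))))"
    using le child_den_pos[of b] child_den_pos[of "Suc b"] M x(2)
    by (intro mult_left_mono divide_left_mono mult_left_mono mult_pos_pos) auto
  finally show ?thesis by (simp add: child_gap)
qed

lemma window_bounds:
  assumes "1 \<le> b" "0 < M"
  shows "window M x b \<le> 1 / (real b * (of_int (snd x))\<^sup>2 * M)"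
    and "1 / (2 * real b * (of_int (snd x))\<^sup>2 * M) \<le> window M x b"
proof -
  have q: "0 < real_of_int (snd x)" using x(2) by simp
  have "real_of_int (int b * snd x) \<le> of_int (child_den x b)"
    using child_den_bounds(1)[of b] by (simp only: of_int_le_iff)
  then have lo: "real b * of_int (snd x) \<le> of_int (child_den x b)" by simp
  have "(int b + 1) * snd x \<le> (2 * int b) * snd x" using assms x(2) by (intro mult_right_mono) auto
  then have "real_of_int (child_den x b) \<le> of_int (2 * int b * snd x)"
    using child_den_bounds(2)[of b] by (simp only: of_int_le_iff)
  then have hi: "of_int (child_den x b) \<le> 2 * real b * of_int (snd x)" by simp
  show "window M x b \<le> 1 / (real b * (of_int (snd x))\<^sup>2 * M)"
    unfolding window_def power2_eq_square mult.assoc[symmetric]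
    using lo q assms child_den_pos[of b] by (intro divide_left_mono mult_right_mono mult_pos_pos) auto
  show "1 / (2 * real b * (of_int (snd x))\<^sup>2 * M) \<le> window M x b"
    unfolding window_def power2_eq_square mult.assoc[symmetric]
    using hi q assms child_den_pos[of b] by (intro divide_left_mono mult_right_mono mult_pos_pos) auto
qed

end

text \<open>For a given reduced fraction the neighbour on the left with smaller denominator is unique, its
  denominator being the inverse of the numerator modulo the denominator.\<close>

lemma child_determines_parent:
  assumes x: "coprime (fst x) (snd x)" "1 \<le> snd x" and y: "coprime (fst y) (snd y)" "1 \<le> snd y"
    and b: "1 \<le> b" "1 \<le> c" and eq: "child x b = child y c"
  shows "x = y \<and> b = c"
proof -
  have nd: "child_num x b = child_num y c" "child_den x b = child_den y c"
    using coprime_fraction_unique[OF child_den_pos[OF x] child_den_pos[OF y] coprime_child[OF x] coprime_child[OF y]] eq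
    by (auto simp: child_def)
  define n d where "n = child_num x b" and "d = child_den x b"
  have det: "n * snd x - fst x * d = 1" "n * snd y - fst y * d = 1"
    using child_unimodular[OF x, of b] child_unimodular[OF y, of c] nd by (auto simp: n_def d_def)
  then have eq2: "n * (snd x - snd y) = d * (fst x - fst y)" by (simp add: algebra_simps)
  have "coprime d n" using coprime_child[OF x, of b] by (simp add: n_def d_def coprime_commute)
  moreover have "d dvd n * (snd x - snd y)" unfolding eq2 by simp
  ultimately have "d dvd snd x - snd y" by (simp add: coprime_dvd_mult_right_iff)
  moreover have "snd x < d" "snd y < d"
  proof -
    have "1 * snd x \<le> int b * snd x" "1 * snd y \<le> int c * snd y"
      using b x y by (auto intro!: mult_right_mono)
    then show "snd x < d" "snd y < d"
      using child_den_bounds(1)[OF x, of b] child_den_bounds(1)[OF y, of c] nd by (auto simp: d_def)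
  qed
  ultimately have snd_eq: "snd x = snd y"
    using dvd_imp_le_int[of "snd x - snd y" d] x(2) y(2) by linarith
  then have "d * (fst x - fst y) = 0" using eq2 by simp
  then have "fst x = fst y" using child_den_pos[OF x, of b] by (auto simp: d_def)
  with snd_eq have xy: "x = y" by (simp add: prod_eq_iff)
  then have "int b * snd x = int c * snd x" using nd by (simp add: child_den_def)
  with xy show ?thesis using x(2) by simp
qed

lemma farey_props:
  assumes "x \<in> farey k u v"
  shows "coprime (fst x) (snd x)" "1 \<le> snd x" "16 ^ k \<le> real_of_int (snd x)" "real_of_int (snd x) < 16 ^ Suc k"
    "u \<le> of_int (fst x) / of_int (snd x)" "of_int (fst x) / of_int (snd x) \<le> v"
proof -
  obtain p q where x: "x = (p, q)" by (cases x)
  have q: "16 ^ k \<le> q" "q < 16 ^ Suc k" using assms by (auto simp: x farey_def)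
  have "(1::int) \<le> 16 ^ k" by simp
  then show "1 \<le> snd x" using q by (simp add: x)
  have "real_of_int (16 ^ k) \<le> of_int q" "real_of_int q < of_int (16 ^ Suc k)"
    using q by (simp_all only: of_int_le_iff of_int_less_iff)
  then show "16 ^ k \<le> real_of_int (snd x)" "real_of_int (snd x) < 16 ^ Suc k"
    by (simp_all add: x)
qed (use assms in \<open>auto simp: farey_def\<close>)

lemma farey_level_unique:
  assumes "x \<in> farey k u v" "x \<in> farey l u' v'"
  shows "k = l"
proof -
  have "k < Suc l" "l < Suc k"
    using farey_props(3,4)[OF assms(1)] farey_props(3,4)[OF assms(2)]
    by (metis le_less_trans power_less_imp_less_exp one_less_numeral_iff semiring_norm(76))+
  then show ?thesis by simp
qed

lemma child_offset:
  assumes x: "x \<in> farey k u v" and b: "1 \<le> b"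
  shows "of_int (fst x) / of_int (snd x) < child x b"
    "child x b \<le> of_int (fst x) / of_int (snd x) + 1 / (16 ^ k)\<^sup>2"
proof -
  note xp = farey_props[OF x]
  have pos: "0 < real_of_int (child_den x b) * of_int (snd x)"
    using child_den_pos[OF xp(1,2), of b] xp(2) by simp
  then have "0 < 1 / (real_of_int (child_den x b) * of_int (snd x))" by simp
  then show "of_int (fst x) / of_int (snd x) < child x b" unfolding child_eq[OF xp(1,2)] by linarith
  have "(16 ^ k) * (16 ^ k) \<le> real_of_int (child_den x b) * of_int (snd x)"
    using parent_den_le[OF xp(1,2) b] xp(3) child_den_pos[OF xp(1,2), of b] by (intro mult_mono) auto
  then have "1 / (real_of_int (child_den x b) * of_int (snd x)) \<le> 1 / (16 ^ k)\<^sup>2"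
    unfolding power2_eq_square using pos by (intro divide_left_mono) auto
  then show "child x b \<le> of_int (fst x) / of_int (snd x) + 1 / (16 ^ k)\<^sup>2"
    unfolding child_eq[OF xp(1,2)] by linarith
qed

section \<open>Mass of the windows of one family\<close>

abbreviation arity :: "(nat \<Rightarrow> real) \<Rightarrow> nat \<Rightarrow> nat" where "arity m k \<equiv> nat \<lfloor>m k\<rfloor>"

context slow_gauge
begin

definition ratio :: "real \<Rightarrow> real" where "ratio r = f r / r"

lemma gauge_eq: "0 < r \<Longrightarrow> f r = r * ratio r"
  by (simp add: ratio_def)

lemma ratio_pos: "0 < r \<Longrightarrow> 0 < ratio r"
  by (simp add: ratio_def gauge_pos)

lemma ratio_le: "0 < r \<Longrightarrow> r \<le> s \<Longrightarrow> s \<le> r\<^sub>0 \<Longrightarrow> ratio s \<le> ratio r"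
  unfolding ratio_def by (rule ratio_antimono)

lemma gauge_le: "0 < r \<Longrightarrow> r \<le> s \<Longrightarrow> f r \<le> f s"
  using gauge_mono by (auto simp: monotone_on_def)

lemma D_ge_one: "1 \<le> D"
proof -
  have "r\<^sub>0\<^sup>2 \<le> r\<^sub>0" using r0_pos r0_less by (simp add: power2_eq_square mult_left_le)
  then have "ratio r\<^sub>0 \<le> ratio (r\<^sub>0\<^sup>2)" using r0_pos by (intro ratio_le) auto
  also have "\<dots> \<le> D * ratio r\<^sub>0" unfolding ratio_def by (rule ratio_square) (use r0_pos in auto)
  finally show ?thesis using ratio_pos[OF r0_pos] by simp
qed

text \<open>Iterated squaring: \<open>r\<close> may be replaced by any fixed power at the cost of a constant.\<close>

lemma ratio_power_le:
  assumes "0 < r" "r \<le> r\<^sub>0"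
  shows "ratio (r ^ 2 ^ n) \<le> D ^ n * ratio r"
proof (induction n)
  case (Suc n)
  have "r \<le> 1" using assms r0_less by simp
  then have "r ^ 2 ^ n \<le> r" using assms power_decreasing[of 1 "2 ^ n" r] by simp
  then have le: "r ^ 2 ^ n \<le> r\<^sub>0" using assms by simp
  have "ratio (r ^ 2 ^ Suc n) = ratio ((r ^ 2 ^ n)\<^sup>2)" by (simp add: power_mult[symmetric] mult.commute)
  also have "\<dots> \<le> D * ratio (r ^ 2 ^ n)"
    unfolding ratio_def by (rule ratio_square) (use assms le in auto)
  also have "\<dots> \<le> D * (D ^ n * ratio r)" using Suc D_ge_one by (intro mult_left_mono) auto
  finally show ?case by simp
qed simp

text \<open>Up to constants, the \<open>f\<close>-mass per unit length of the windows of level \<open>k\<close>: a fraction of level \<open>k\<close>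
  accounts for length \<open>16^(-2k)\<close>, and its windows have lengths \<open>16^(-2k) / (b m\<^sub>k)\<close> for \<open>b \<le> m\<^sub>k\<close>.\<close>

definition level_weight :: "(nat \<Rightarrow> real) \<Rightarrow> nat \<Rightarrow> real" where
  "level_weight m k = ratio (1 / 16 ^ k) * harm (arity m k) / m k"

text \<open>The bound \<open>m k \<le> 16^k\<close> keeps all windows of level \<open>k\<close> longer than \<open>16^(-8k)\<close>, so that \<open>ratio\<close> is
  constant on them up to a bounded factor.\<close>

definition admissible :: "(nat \<Rightarrow> real) \<Rightarrow> nat \<Rightarrow> bool" where
  "admissible m k \<longleftrightarrow> 2 \<le> k \<and> 1 / 16 ^ k \<le> r\<^sub>0 \<and> 2 \<le> m k \<and> m k \<le> 16 ^ k"

lemma level_weight_nonneg: "admissible m k \<Longrightarrow> 0 \<le> level_weight m k"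
  using ratio_pos[of "1 / 16 ^ k"] by (auto simp: level_weight_def admissible_def harm_nonneg)

text \<open>Denominators of level \<open>k\<close> differ from \<open>16^k\<close> by a factor of at most 16, which makes the lengths
  explicit up to the constant \<open>512 = 2 \<cdot> 16\<^sup>2\<close>, and \<open>f\<close> proportional to the length up to the
  factor \<open>D\<^sup>3\<close>.\<close>

lemma window_level:
  assumes adm: "admissible m k" and x: "x \<in> farey k u v" and b: "1 \<le> b" "b \<le> arity m k"
  shows "real b \<le> m k" (is ?a)
    and "0 < window (m k) x b" (is ?b)
    and "window (m k) x b \<le> 1 / (16 ^ k)\<^sup>2 * (1 / (real b * m k))" (is ?c)
    and "1 / (512 * (16 ^ k)\<^sup>2) * (1 / (real b * m k)) \<le> window (m k) x b" (is ?d)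
    and "window (m k) x b \<le> 1 / (16 ^ k)\<^sup>2" (is ?e)
    and "(1 / 16 ^ k) ^ 8 \<le> window (m k) x b" (is ?f)
    and "f (window (m k) x b) \<le> D ^ 3 * ratio (1 / 16 ^ k) * window (m k) x b" (is ?g)
    and "ratio (1 / 16 ^ k) * window (m k) x b \<le> f (window (m k) x b)" (is ?h)
proof -
  define R :: real where "R = 16 ^ k"
  define M where "M = m k"
  define q where "q = real_of_int (snd x)"
  note xp = farey_props[OF x]
  have M: "2 \<le> M" "M \<le> R" "1 / R \<le> r\<^sub>0" using adm by (auto simp: admissible_def M_def R_def)
  have "(16::real) ^ 1 \<le> 16 ^ k" by (rule power_increasing) (use adm in \<open>auto simp: admissible_def\<close>)
  then have R: "16 \<le> R" by (simp add: R_def)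
  have q: "R \<le> q" "q \<le> 16 * R" using xp(3,4) by (auto simp: q_def R_def)
  show a: ?a using b(2) M(1) by (simp add: M_def) linarith
  then have bM: "real b \<le> M" "1 \<le> real b" using b by (auto simp: M_def)
  show pos: ?b using xp M by (intro window_pos) (auto simp: M_def)
  have q2: "R\<^sup>2 \<le> q\<^sup>2" "q\<^sup>2 \<le> (16 * R)\<^sup>2" using q R by (intro power_mono; simp)+
  have "window M x b \<le> 1 / (real b * q\<^sup>2 * M)"
    using window_bounds(1)[OF xp(1,2) b(1), of M] M by (simp add: q_def)
  also have "\<dots> \<le> 1 / (real b * R\<^sup>2 * M)"
    using q2 q bM M R by (intro divide_left_mono mult_right_mono mult_left_mono mult_pos_pos) auto
  finally show c: ?c by (simp add: R_def M_def mult_ac)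
  have "1 / (512 * R\<^sup>2) * (1 / (real b * M)) = 1 / (2 * real b * (16 * R)\<^sup>2 * M)"
    by (simp add: power_mult_distrib mult_ac)
  also have "\<dots> \<le> 1 / (2 * real b * q\<^sup>2 * M)"
    using q2 q bM M R by (intro divide_left_mono mult_right_mono mult_left_mono mult_pos_pos) auto
  also have "\<dots> \<le> window M x b"
    using window_bounds(2)[OF xp(1,2) b(1), of M] M by (simp add: q_def)
  finally show d: ?d by (simp add: R_def M_def)
  have bm1: "1 \<le> real b * M" using bM M by (metis mult_mono' mult_1 order_trans one_le_numeral zero_le_one)
  have "1 / (real b * M) \<le> 1" using bm1 by simp
  then have "1 / R\<^sup>2 * (1 / (real b * M)) \<le> 1 / R\<^sup>2 * 1" by (intro mult_left_mono) auto
  then show e: ?e using c by (simp add: R_def M_def)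
  have "real b * M \<le> R * R" using bM M by (intro mult_mono) auto
  then have "512 * R\<^sup>2 * (real b * M) \<le> R ^ 4 * (R\<^sup>2 * (R * R))"
  proof -
    have "(512::real) \<le> 16 ^ 4" by simp
    also have "(16::real) ^ 4 \<le> R ^ 4" using R by (intro power_mono) auto
    finally have c512: "512 \<le> R ^ 4" .
    have "R\<^sup>2 * (real b * M) \<le> R\<^sup>2 * (R * R)"
      using \<open>real b * M \<le> R * R\<close> by (intro mult_left_mono) auto
    then have "512 * (R\<^sup>2 * (real b * M)) \<le> R ^ 4 * (R\<^sup>2 * (R * R))"
      using c512 bm1 by (intro mult_mono[OF c512]) auto
    then show ?thesis by (simp add: mult_ac)
  qed
  also have "\<dots> = R ^ 8" by (simp add: power2_eq_square eval_nat_numeral mult_ac)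
  finally have "1 / R ^ 8 \<le> 1 / (512 * R\<^sup>2 * (real b * M))"
    using bm1 R by (intro divide_left_mono) auto
  then show ff: ?f using d by (simp add: R_def M_def power_one_over)
  have "1 / R\<^sup>2 \<le> 1 / R" using R by (simp add: field_simps power2_eq_square)
  then have le: "window M x b \<le> 1 / R" using e by (simp add: R_def M_def)
  have "ratio (window M x b) \<le> ratio ((1 / R) ^ 8)"
    using ff le M R by (intro ratio_le) (auto simp: R_def M_def)
  also have "\<dots> \<le> D ^ 3 * ratio (1 / R)" using ratio_power_le[of "1 / R" 3] M R by simp
  finally show ?g using pos gauge_eq[OF pos] by (simp add: R_def M_def mult.commute mult_left_mono)
  have "ratio (1 / R) \<le> ratio (window M x b)" using le M pos by (intro ratio_le) (auto simp: M_def)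
  then show ?h using pos gauge_eq[OF pos] by (simp add: R_def M_def mult.commute mult_left_mono)
qed

lemma sum_windows_bounds:
  assumes adm: "admissible m k" and x: "x \<in> farey k u v"
  shows "(\<Sum>b=1..arity m k. f (window (m k) x b)) \<le> D ^ 3 / (16 ^ k)\<^sup>2 * level_weight m k" (is ?up)
    and "level_weight m k / (512 * (16 ^ k)\<^sup>2) \<le> (\<Sum>b=1..arity m k. f (window (m k) x b))" (is ?lo)
proof -
  note wl = window_level[OF adm x]
  have rp: "0 < ratio (1 / 16 ^ k)" by (intro ratio_pos) simp
  have harm: "(\<Sum>b=1..arity m k. 1 / (real b * m k)) = harm (arity m k) / m k"
    by (simp add: harm_def sum_divide_distrib inverse_eq_divide)
  have "(\<Sum>b=1..arity m k. f (window (m k) x b))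
      \<le> (\<Sum>b=1..arity m k. D ^ 3 * ratio (1 / 16 ^ k) * (1 / (16 ^ k)\<^sup>2 * (1 / (real b * m k))))"
  proof (rule sum_mono)
    fix b assume b: "b \<in> {1..arity m k}"
    have "f (window (m k) x b) \<le> D ^ 3 * ratio (1 / 16 ^ k) * window (m k) x b" using wl(7) b by simp
    also have "\<dots> \<le> D ^ 3 * ratio (1 / 16 ^ k) * (1 / (16 ^ k)\<^sup>2 * (1 / (real b * m k)))"
      using wl(3)[of b] b rp D_ge_one by (intro mult_left_mono) auto
    finally show "f (window (m k) x b) \<le> \<dots>" .
  qed
  also have "\<dots> = D ^ 3 * ratio (1 / 16 ^ k) * (1 / (16 ^ k)\<^sup>2) * (\<Sum>b=1..arity m k. 1 / (real b * m k))"
    unfolding sum_distrib_left by (rule sum.cong[OF refl]) (simp add: mult_ac)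
  finally show ?up unfolding harm by (simp add: level_weight_def mult_ac)
  have "level_weight m k / (512 * (16 ^ k)\<^sup>2) = ratio (1 / 16 ^ k) * (1 / (512 * (16 ^ k)\<^sup>2)) * (\<Sum>b=1..arity m k. 1 / (real b * m k))"
    unfolding harm by (simp add: level_weight_def mult_ac)
  also have "\<dots> = (\<Sum>b=1..arity m k. ratio (1 / 16 ^ k) * (1 / (512 * (16 ^ k)\<^sup>2) * (1 / (real b * m k))))"
    unfolding sum_distrib_left by (rule sum.cong[OF refl]) (simp add: mult_ac)
  also have "\<dots> \<le> (\<Sum>b=1..arity m k. f (window (m k) x b))"
  proof (rule sum_mono)
    fix b assume b: "b \<in> {1..arity m k}"
    have "ratio (1 / 16 ^ k) * (1 / (512 * (16 ^ k)\<^sup>2) * (1 / (real b * m k))) \<le> ratio (1 / 16 ^ k) * window (m k) x b"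
      using wl(4)[of b] b rp by (intro mult_left_mono) auto
    also have "\<dots> \<le> f (window (m k) x b)" using wl(8) b by simp
    finally show "ratio (1 / 16 ^ k) * (1 / (512 * (16 ^ k)\<^sup>2) * (1 / (real b * m k))) \<le> f (window (m k) x b)" .
  qed
  finally show ?lo .
qed

text \<open>A window is indexed by its level, the parent fraction and the number of the child.\<close>

definition family :: "(nat \<Rightarrow> real) \<Rightarrow> nat set \<Rightarrow> real \<Rightarrow> real \<Rightarrow> (nat \<times> (int \<times> int) \<times> nat) set" where
  "family m K u v = (SIGMA k:K. SIGMA x:farey k u v. {1..arity m k})"

definition pt :: "nat \<times> (int \<times> int) \<times> nat \<Rightarrow> real" where
  "pt i = (case i of (k, x, b) \<Rightarrow> child x b)"

definition width :: "(nat \<Rightarrow> real) \<Rightarrow> nat \<times> (int \<times> int) \<times> nat \<Rightarrow> real" where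
  "width m i = (case i of (k, x, b) \<Rightarrow> window (m k) x b)"

lemma finite_farey: "finite (farey k u v)"
proof (cases "u \<le> v")
  case True
  then show ?thesis using card_farey_le(1)[of "v - u" k u] by simp
next
  case False
  then have "farey k u v = {}" by (auto simp: farey_def)
  then show ?thesis by simp
qed

lemma finite_family: "finite K \<Longrightarrow> finite (family m K u v)"
  unfolding family_def by (intro finite_SigmaI finite_farey) auto

lemma sum_family:
  assumes "finite K"
  shows "(\<Sum>i\<in>family m K u v. f (width m i))
    = (\<Sum>k\<in>K. \<Sum>x\<in>farey k u v. \<Sum>b=1..arity m k. f (window (m k) x b))"
proof -
  have "(\<Sum>i\<in>family m K u v. f (width m i))
      = (\<Sum>k\<in>K. \<Sum>y\<in>(SIGMA x:farey k u v. {1..arity m k}). f (width m (k, y)))"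
    unfolding family_def
    by (subst sum.Sigma) (use assms in \<open>auto simp: case_prod_unfold finite_farey\<close>)
  also have "\<dots> = (\<Sum>k\<in>K. \<Sum>x\<in>farey k u v. \<Sum>b=1..arity m k. f (width m (k, x, b)))"
    by (rule sum.cong[OF refl], subst sum.Sigma) (auto simp: case_prod_unfold finite_farey)
  finally show ?thesis by (simp add: width_def)
qed

lemma family_lower:
  assumes "finite K" and adm: "\<And>k. k \<in> K \<Longrightarrow> admissible m k"
    and many: "\<And>k. k \<in> K \<Longrightarrow> d * (16 ^ k)\<^sup>2 \<le> real (card (farey k u v))"
  shows "d * (\<Sum>k\<in>K. level_weight m k) / 512 \<le> (\<Sum>i\<in>family m K u v. f (width m i))"
  unfolding sum_family[OF assms(1)] sum_distrib_left sum_divide_distrib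
proof (rule sum_mono)
  fix k assume k: "k \<in> K"
  have "d * level_weight m k / 512 = d * (16 ^ k)\<^sup>2 * (level_weight m k / (512 * (16 ^ k)\<^sup>2))" by simp
  also have "\<dots> \<le> real (card (farey k u v)) * (level_weight m k / (512 * (16 ^ k)\<^sup>2))"
    using many[OF k] level_weight_nonneg[OF adm[OF k]] by (intro mult_right_mono) auto
  also have "\<dots> = (\<Sum>x\<in>farey k u v. level_weight m k / (512 * (16 ^ k)\<^sup>2))" by simp
  also have "\<dots> \<le> (\<Sum>x\<in>farey k u v. \<Sum>b=1..arity m k. f (window (m k) x b))"
    by (intro sum_mono sum_windows_bounds(2) adm k)
  finally show "d * level_weight m k / 512 \<le> \<dots>" .
qed

lemma family_props:
  assumes "i \<in> family m K u v"
  shows "\<exists>k x b. i = (k, x, b) \<and> k \<in> K \<and> x \<in> farey k u v \<and> 1 \<le> b \<and> b \<le> arity m k \<and>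
    pt i = child x b \<and> width m i = window (m k) x b"
  using assms by (auto simp: family_def pt_def width_def)

text \<open>At these levels the parent of a window with right endpoint in \<open>[z, z + 2\<beta>]\<close> is within a constant
  times \<open>\<beta>\<close> of this interval, and \<open>\<beta>\<close> is at least of the order of the spacing of the parents. So
  counting the parents gives the right order of magnitude.\<close>

lemma family_upper_fine:
  assumes K: "finite K" and adm: "\<And>k. k \<in> K \<Longrightarrow> admissible m k"
    and \<beta>: "0 < \<beta>" "\<beta> \<le> r\<^sub>0" and fine: "\<And>k. k \<in> K \<Longrightarrow> 1 < 16384 * \<beta> * (16 ^ k)\<^sup>2"
  shows "(\<Sum>i\<in>{i \<in> family m K u v. z \<le> pt i \<and> pt i \<le> z + 2 * \<beta>}. f (width m i))
      \<le> 4211200 * D ^ 3 * (\<beta> * (\<Sum>k\<in>K. level_weight m k))"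
proof -
  let ?T = "{i \<in> family m K u v. z \<le> pt i \<and> pt i \<le> z + 2 * \<beta>}"
  let ?F = "family m K (z - 16384 * \<beta>) (z + 2 * \<beta>)"
  have "?T \<subseteq> ?F"
  proof
    fix i assume i: "i \<in> ?T"
    then have "i \<in> family m K u v" by simp
    from family_props[OF this] obtain k x b where kxb: "i = (k, x, b)" "k \<in> K" "x \<in> farey k u v" "1 \<le> b"
      "b \<le> arity m k" "pt i = child x b" by blast
    have "1 / (16 ^ k)\<^sup>2 \<le> 16384 * \<beta>" using fine[OF kxb(2)] by (simp add: field_simps)
    moreover have "z \<le> child x b" "child x b \<le> z + 2 * \<beta>" using i kxb(6) by auto
    ultimately have "z - 16384 * \<beta> \<le> of_int (fst x) / of_int (snd x)" "of_int (fst x) / of_int (snd x) \<le> z + 2 * \<beta>"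
      using child_offset[OF kxb(3,4)] by linarith+
    then have "x \<in> farey k (z - 16384 * \<beta>) (z + 2 * \<beta>)" using kxb(3) by (auto simp: farey_def)
    then show "i \<in> ?F" using kxb by (simp add: family_def)
  qed
  moreover have "0 \<le> f (width m i)" if "i \<in> ?F" for i
  proof -
    from family_props[OF that] obtain k x b where kxb: "k \<in> K" "x \<in> farey k (z - 16384 * \<beta>) (z + 2 * \<beta>)"
      "1 \<le> b" "b \<le> arity m k" "width m i = window (m k) x b" by blast
    then show ?thesis using window_level(2)[OF adm[OF kxb(1)] kxb(2,3,4)] gauge_pos by (simp add: less_imp_le)
  qed
  ultimately have "(\<Sum>i\<in>?T. f (width m i)) \<le> (\<Sum>i\<in>?F. f (width m i))"
    by (intro sum_mono2 finite_family K) auto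
  also have "\<dots> \<le> (\<Sum>k\<in>K. 4211200 * D ^ 3 * (\<beta> * level_weight m k))"
    unfolding sum_family[OF K]
  proof (rule sum_mono)
    fix k assume k: "k \<in> K"
    let ?X = "farey k (z - 16384 * \<beta>) (z + 2 * \<beta>)"
    define R :: real where "R = 16 ^ k"
    have R: "0 < R" by (simp add: R_def)
    have "(\<Sum>x\<in>?X. \<Sum>b=1..arity m k. f (window (m k) x b)) \<le> (\<Sum>x\<in>?X. D ^ 3 / R\<^sup>2 * level_weight m k)"
      unfolding R_def by (intro sum_mono sum_windows_bounds(1) adm k)
    also have "\<dots> = real (card ?X) * (D ^ 3 / R\<^sup>2 * level_weight m k)" by simp
    also have "\<dots> \<le> (4211200 * \<beta> * R\<^sup>2) * (D ^ 3 / R\<^sup>2 * level_weight m k)"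
    proof (rule mult_right_mono)
      have "?X = farey k (z - 16384 * \<beta>) (z - 16384 * \<beta> + 16386 * \<beta>)" by (simp add: algebra_simps)
      then have "real (card ?X) \<le> 16386 * \<beta> * (16 * R)\<^sup>2 + 1"
        using card_farey_le(2)[of "16386 * \<beta>" k "z - 16384 * \<beta>"] \<beta> by (simp add: R_def)
      also have "\<dots> \<le> 16386 * \<beta> * (16 * R)\<^sup>2 + 16384 * \<beta> * R\<^sup>2" using fine[OF k] by (simp add: R_def)
      \<comment> \<open>\<open>4211200 = 16386 \<cdot> 16\<^sup>2 + 16384\<close>\<close>
      also have "\<dots> = 4211200 * \<beta> * R\<^sup>2" by (simp add: power_mult_distrib algebra_simps)
      finally show "real (card ?X) \<le> 4211200 * \<beta> * R\<^sup>2" .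
      show "0 \<le> D ^ 3 / R\<^sup>2 * level_weight m k" using level_weight_nonneg[OF adm[OF k]] D_ge_one by simp
    qed
    also have "\<dots> = 4211200 * D ^ 3 * (\<beta> * level_weight m k)" using R by simp
    finally show "(\<Sum>x\<in>?X. \<Sum>b=1..arity m k. f (window (m k) x b)) \<le> 4211200 * D ^ 3 * (\<beta> * level_weight m k)" .
  qed
  also have "\<dots> = 4211200 * D ^ 3 * (\<beta> * (\<Sum>k\<in>K. level_weight m k))"
    by (simp add: sum_distrib_left)
  finally show ?thesis .
qed

text \<open>Two different children with denominators below \<open>1 / (2 \<surd>\<beta>)\<close> are further apart than \<open>2\<beta>\<close>. So at
  most one window contributes, whatever the number of levels.\<close>

lemma family_upper_short:
  fixes z :: real
  assumes K: "finite K" and \<beta>: "0 < \<beta>" and adm: "\<And>k. k \<in> K \<Longrightarrow> admissible m k"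
  shows "(\<Sum>i\<in>{i \<in> family m K u v. width m i \<le> \<beta> \<and> z \<le> pt i \<and> pt i \<le> z + 2 * \<beta>
      \<and> 4 * \<beta> * (of_int (child_den (fst (snd i)) (snd (snd i))))\<^sup>2 < 1}. f (width m i)) \<le> f \<beta>" (is "sum _ ?T \<le> _")
proof -
  have unique: "i = j" if ij: "i \<in> ?T" "j \<in> ?T" for i j
  proof -
    obtain k x b where i: "i = (k, x, b)" "x \<in> farey k u v" "1 \<le> b" "pt i = child x b"
      using family_props[of i m K u v] CollectD[OF ij(1)] by blast
    obtain l y c where j: "j = (l, y, c)" "y \<in> farey l u v" "1 \<le> c" "pt j = child y c"
      using family_props[of j m K u v] CollectD[OF ij(2)] by blast
    note xp = farey_props[OF i(2)] and yp = farey_props[OF j(2)]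
    define p q where "p = real_of_int (child_den x b)" and "q = real_of_int (child_den y c)"
    have pq: "0 < p" "0 < q" using child_den_pos[OF xp(1,2)] child_den_pos[OF yp(1,2)] by (auto simp: p_def q_def)
    have sq: "4 * \<beta> * p\<^sup>2 < 1" "4 * \<beta> * q\<^sup>2 < 1" using ij i j by (auto simp: p_def q_def)
    have "child x b = child y c"
    proof (rule ccontr)
      assume "child x b \<noteq> child y c"
      then have "1 / (p * q) \<le> \<bar>child x b - child y c\<bar>"
        using fraction_gap[OF child_den_pos[OF xp(1,2)] child_den_pos[OF yp(1,2)]]
        by (simp add: child_def p_def q_def)
      also have "\<dots> \<le> 2 * \<beta>" using ij i j by auto
      finally have "1 \<le> 2 * \<beta> * (p * q)" using pq by (simp add: field_simps)
      moreover have "4 * \<beta> * (p * q) \<le> 4 * \<beta> * ((p\<^sup>2 + q\<^sup>2) / 2)"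
        using \<beta> sum_squares_bound[of p q] by (intro mult_left_mono) auto
      ultimately show False using sq by (simp add: field_simps)
    qed
    then have "x = y \<and> b = c" using child_determines_parent[OF xp(1,2) yp(1,2) i(3) j(3)] by blast
    moreover have "k = l" using farey_level_unique i(2) j(2) calculation by blast
    ultimately show ?thesis by (simp add: i j)
  qed
  show ?thesis
  proof (cases "?T = {}")
    case True
    then show ?thesis using gauge_pos[OF \<beta>] by (simp only: sum.empty less_imp_le)
  next
    case False
    then obtain i where i: "i \<in> ?T" by blast
    then have T: "?T = {i}" using unique by blast
    obtain k x b where kxb: "k \<in> K" "x \<in> farey k u v" "1 \<le> b" "b \<le> arity m k"
      "width m i = window (m k) x b" using family_props[of i m K u v] CollectD[OF i] by blast
    have "0 < width m i" unfolding kxb(5) by (rule window_level(2)[OF adm[OF kxb(1)] kxb(2,3,4)])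
    then have "f (width m i) \<le> f \<beta>" using i by (intro gauge_le) auto
    then show ?thesis unfolding T by simp
  qed
qed

text \<open>Since \<open>16384 = 64 \<cdot> 16\<^sup>2\<close>, the denominator of the parent is at most \<open>1 / (8 \<surd>\<beta>)\<close> and that of the
  child at least \<open>1 / (2 \<surd>\<beta>)\<close>, so the parent is a very good approximation to every point near \<open>z\<close>,
  and two different parents would be too close to each other. The windows of a single parent are
  then compared with the gaps between its children.\<close>

lemma family_upper_long:
  fixes z :: real
  assumes K: "finite K" and \<beta>: "0 < \<beta>" "\<beta> \<le> r\<^sub>0" and adm: "\<And>k. k \<in> K \<Longrightarrow> admissible m k"
    and coarse: "\<And>k. k \<in> K \<Longrightarrow> 16384 * \<beta> * (16 ^ k)\<^sup>2 \<le> 1"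
  shows "(\<Sum>i\<in>{i \<in> family m K u v. width m i \<le> \<beta> \<and> z \<le> pt i \<and> pt i \<le> z + 2 * \<beta>
      \<and> 1 \<le> 4 * \<beta> * (of_int (child_den (fst (snd i)) (snd (snd i))))\<^sup>2}. f (width m i)) \<le> (1 + 6 * D\<^sup>2) * f \<beta>"
    (is "sum _ ?T \<le> _")
proof (cases "?T = {}")
  case True
  show ?thesis unfolding True using gauge_pos[OF \<beta>(1)] by simp
next
  case False
  have same: "fst j = fst i \<and> fst (snd j) = fst (snd i)" if ij: "i \<in> ?T" "j \<in> ?T" for i j
  proof -
    obtain k x b where i: "i = (k, x, b)" "k \<in> K" "x \<in> farey k u v" "1 \<le> b" "pt i = child x b"
      using family_props[of i m K u v] CollectD[OF ij(1)] by blast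
    obtain l y c where j: "j = (l, y, c)" "l \<in> K" "y \<in> farey l u v" "1 \<le> c" "pt j = child y c"
      using family_props[of j m K u v] CollectD[OF ij(2)] by blast
    note xp = farey_props[OF i(3)] and yp = farey_props[OF j(3)]
    define p q s t where "p = real_of_int (child_den x b)" and "q = real_of_int (child_den y c)"
      and "s = real_of_int (snd x)" and "t = real_of_int (snd y)"
    have pos: "0 < p" "0 < q" "0 < s" "0 < t"
      using child_den_pos[OF xp(1,2)] child_den_pos[OF yp(1,2)] xp(2) yp(2) by (auto simp: p_def q_def s_def t_def)
    have pq: "1 \<le> 4 * \<beta> * p\<^sup>2" "1 \<le> 4 * \<beta> * q\<^sup>2" using ij i j by (auto simp: p_def q_def)
    have small: "64 * \<beta> * w\<^sup>2 \<le> 1" if "0 < w" "w < 16 ^ Suc n" "n \<in> K" for w n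
    proof -
      have "w\<^sup>2 \<le> (16 ^ Suc n)\<^sup>2" using that by (intro power_mono) auto
      then have "64 * \<beta> * w\<^sup>2 \<le> 64 * \<beta> * (16 ^ Suc n)\<^sup>2" using \<beta> by (intro mult_left_mono) auto
      also have "\<dots> = 16384 * \<beta> * (16 ^ n)\<^sup>2" by (simp add: power_mult_distrib)
      finally show ?thesis using coarse[OF that(3)] by simp
    qed
    have st: "64 * \<beta> * s\<^sup>2 \<le> 1" "64 * \<beta> * t\<^sup>2 \<le> 1"
      using small[OF pos(3) _ i(2)] small[OF pos(4) _ j(2)] xp(4) yp(4) by (auto simp: s_def t_def)
    have four: "4 * w \<le> w'" if "64 * \<beta> * w\<^sup>2 \<le> 1" "1 \<le> 4 * \<beta> * w'\<^sup>2" "0 < w'" for w w'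
    proof (rule power2_le_imp_le)
      have "4 * \<beta> * (4 * w)\<^sup>2 \<le> 4 * \<beta> * w'\<^sup>2" using that by (simp add: power_mult_distrib)
      then show "(4 * w)\<^sup>2 \<le> w'\<^sup>2" using \<beta> by simp
    qed (use that in simp)
    have "of_int (fst x) / s = of_int (fst y) / t"
    proof (rule ccontr)
      assume ne: "of_int (fst x) / s \<noteq> of_int (fst y) / t"
      have "1 / (s * t) \<le> \<bar>of_int (fst x) / s - of_int (fst y) / t\<bar>"
        using fraction_gap[of "snd x" "snd y" "fst x" "fst y"] xp(2) yp(2) ne by (simp add: s_def t_def)
      also have "\<dots> \<le> 2 * \<beta> + 1 / (p * s) + 1 / (q * t)"
      proof -
        have "child x b = of_int (fst x) / s + 1 / (p * s)" "child y c = of_int (fst y) / t + 1 / (q * t)"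
          using child_eq[OF xp(1,2)] child_eq[OF yp(1,2)] by (auto simp: p_def q_def s_def t_def)
        moreover have "\<bar>child x b - child y c\<bar> \<le> 2 * \<beta>" using ij i j by auto
        moreover have "0 < 1 / (p * s)" "0 < 1 / (q * t)" using pos by auto
        ultimately show ?thesis by linarith
      qed
      finally have "1 / (s * t) * (s * t) \<le> (2 * \<beta> + 1 / (p * s) + 1 / (q * t)) * (s * t)"
        using pos by (intro mult_right_mono) auto
      also have "\<dots> = 2 * \<beta> * (s * t) + t / p + s / q" using pos by (simp add: field_simps)
      also have "\<dots> \<le> 1 / 32 + 1 / 4 + 1 / 4"
      proof (intro add_mono)
        have "64 * \<beta> * (s * t) \<le> 64 * \<beta> * ((s\<^sup>2 + t\<^sup>2) / 2)"
          using \<beta> sum_squares_bound[of s t] by (intro mult_left_mono) auto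
        also have "\<dots> \<le> 1" using st by (simp add: algebra_simps)
        finally show "2 * \<beta> * (s * t) \<le> 1 / 32" by simp
        show "t / p \<le> 1 / 4" using four[OF st(2) pq(1) pos(1)] pos by (simp add: field_simps)
        show "s / q \<le> 1 / 4" using four[OF st(1) pq(2) pos(2)] pos by (simp add: field_simps)
      qed
      finally show False using pos by simp
    qed
    then have "fst x = fst y \<and> snd x = snd y"
      using coprime_fraction_unique[of "snd x" "snd y" "fst x" "fst y"] xp(1,2) yp(1,2) by (simp add: s_def t_def)
    then have xy: "x = y" by (simp add: prod_eq_iff)
    then have "k = l" using farey_level_unique[OF i(3)] j(3) by blast
    then show ?thesis by (simp add: i(1) j(1) xy)
  qed
  obtain i\<^sub>0 where i0: "i\<^sub>0 \<in> ?T" using False by blast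
  obtain k x b\<^sub>0 where kx: "i\<^sub>0 = (k, x, b\<^sub>0)" "k \<in> K" "x \<in> farey k u v"
    using family_props[of i\<^sub>0 m K u v] CollectD[OF i0] by blast
  note xp = farey_props[OF kx(3)] and wl = window_level[OF adm[OF kx(2)] kx(3)]
  define S where "S = (\<lambda>i. snd (snd i)) ` ?T"
  have T_eq: "i = (k, x, snd (snd i))" if "i \<in> ?T" for i
    using same[OF i0 that] by (simp add: kx(1) prod_eq_iff)
  have inj: "inj_on (\<lambda>i. snd (snd i)) ?T" using T_eq by (metis (no_types, lifting) inj_onI)
  have finT: "finite ?T" by (rule finite_subset[OF _ finite_family[OF K]]) auto
  then have finS: "finite S" "S \<noteq> {}" using False by (auto simp: S_def)
  have S: "1 \<le> b" "b \<le> arity m k" "window (m k) x b \<le> \<beta>" "z \<le> child x b" "child x b \<le> z + 2 * \<beta>"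
    if b: "b \<in> S" for b
  proof -
    obtain i where i: "i \<in> ?T" "b = snd (snd i)" using b by (auto simp: S_def)
    then have i_eq: "i = (k, x, b)" using T_eq by simp
    then show "1 \<le> b" "b \<le> arity m k" "window (m k) x b \<le> \<beta>" "z \<le> child x b" "child x b \<le> z + 2 * \<beta>"
      using i(1) by (auto simp: family_def pt_def width_def)
  qed
  have sum_eq: "(\<Sum>i\<in>?T. f (width m i)) = (\<Sum>b\<in>S. f (window (m k) x b))"
    unfolding S_def sum.reindex[OF inj] o_def
  proof (rule sum.cong[OF refl])
    fix i assume "i \<in> ?T"
    from T_eq[OF this] have "width m i = width m (k, x, snd (snd i))" by (rule arg_cong)
    then show "f (width m i) = f (window (m k) x (snd (snd i)))" by (simp add: width_def)
  qed
  define B where "B = Max S"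
  have B: "B \<in> S" "\<And>b. b \<in> S \<Longrightarrow> b \<le> B" using finS by (auto simp: B_def)
  define A where "A = Min S"
  have A: "A \<in> S" "\<And>b. b \<in> S \<Longrightarrow> A \<le> b" using finS by (auto simp: A_def)
  have "(\<Sum>b\<in>S - {B}. window (m k) x b) \<le> (\<Sum>b\<in>S - {B}. 3 * (child x b - child x (Suc b)))"
    using wl(1) S by (intro sum_mono window_le_gap[OF xp(1,2)]) auto
  also have "\<dots> \<le> (\<Sum>b=A..<B. 3 * (child x b - child x (Suc b)))"
    using A B child_antimono[OF xp(1,2)] by (intro sum_mono2) (force simp: order.strict_iff_order)+
  also have "\<dots> = 3 * (child x A - child x B)"
  proof -
    have "(\<Sum>b=A..<B. child x b - child x (Suc b)) = child x A - child x B"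
      using A(2)[OF B(1)] sum_Suc_diff'[of A B "\<lambda>b. - child x b"] by simp
    then show ?thesis by (simp only: flip: sum_distrib_left)
  qed
  also have "\<dots> \<le> 6 * \<beta>" using S(5)[OF A(1)] S(4)[OF B(1)] by simp
  finally have total: "(\<Sum>b\<in>S - {B}. window (m k) x b) \<le> 6 * \<beta>" .
  have ratio_bound: "ratio (window (m k) x b) \<le> D\<^sup>2 * ratio \<beta>" if b: "b \<in> S" for b
  proof -
    have "\<beta> * (16 ^ k)\<^sup>2 \<le> 16384 * \<beta> * (16 ^ k)\<^sup>2" using \<beta> by simp
    then have "\<beta> * (16 ^ k)\<^sup>2 \<le> 1" using coarse[OF kx(2)] by linarith
    then have "\<beta> \<le> (1 / 16 ^ k)\<^sup>2" by (simp add: field_simps)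
    then have "\<beta> ^ 4 \<le> ((1 / 16 ^ k)\<^sup>2) ^ 4" using \<beta> by (intro power_mono) auto
    also have "\<dots> = (1 / 16 ^ k) ^ 8" by (simp flip: power_mult)
    also have "\<dots> \<le> window (m k) x b" using wl(6) S b by blast
    finally have "ratio (window (m k) x b) \<le> ratio (\<beta> ^ 4)"
      using S(3)[OF b] \<beta> by (intro ratio_le) auto
    also have "\<dots> \<le> D\<^sup>2 * ratio \<beta>" using ratio_power_le[OF \<beta>, of 2] by simp
    finally show ?thesis .
  qed
  have "(\<Sum>b\<in>S. f (window (m k) x b)) = f (window (m k) x B) + (\<Sum>b\<in>S - {B}. f (window (m k) x b))"
    using finS B by (simp add: sum.remove)
  also have "\<dots> \<le> f \<beta> + (\<Sum>b\<in>S - {B}. D\<^sup>2 * ratio \<beta> * window (m k) x b)"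
  proof (intro add_mono sum_mono)
    show "f (window (m k) x B) \<le> f \<beta>" using S[OF B(1)] wl(2) by (intro gauge_le) auto
    fix b assume b: "b \<in> S - {B}"
    then have pos: "0 < window (m k) x b" using S wl(2) by blast
    show "f (window (m k) x b) \<le> D\<^sup>2 * ratio \<beta> * window (m k) x b"
      unfolding gauge_eq[OF pos] using ratio_bound[of b] b pos by (simp add: mult.commute mult_left_mono)
  qed
  also have "\<dots> = f \<beta> + D\<^sup>2 * ratio \<beta> * (\<Sum>b\<in>S - {B}. window (m k) x b)"
    by (simp add: sum_distrib_left)
  also have "\<dots> \<le> f \<beta> + D\<^sup>2 * ratio \<beta> * (6 * \<beta>)"
    using total ratio_pos[OF \<beta>(1)] by (intro add_left_mono mult_left_mono) auto
  also have "\<dots> = (1 + 6 * D\<^sup>2) * f \<beta>" using gauge_eq[OF \<beta>(1)] by (simp add: algebra_simps)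
  finally show ?thesis unfolding sum_eq .
qed

text \<open>Dominates the constants of the three estimates, \<open>4211200 D\<^sup>3\<close> and \<open>2 + 6 D\<^sup>2\<close>.\<close>

definition spread :: real where "spread = 5000000 * D ^ 3"

text \<open>The term \<open>\<beta> W\<close> comes from the levels that resolve \<open>\<beta>\<close>, the term \<open>f \<beta>\<close> from the coarser ones, where
  a single parent and a single child of small denominator account for everything, so that the
  number of levels does not enter.\<close>

lemma family_upper:
  fixes z :: real
  assumes K: "finite K" and \<beta>: "0 < \<beta>" "\<beta> \<le> r\<^sub>0" and adm: "\<And>k. k \<in> K \<Longrightarrow> admissible m k"
  shows "(\<Sum>i\<in>{i \<in> family m K u v. width m i \<le> \<beta> \<and> z \<le> pt i \<and> pt i \<le> z + 2 * \<beta>}. f (width m i))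
      \<le> spread * (\<beta> * (\<Sum>k\<in>K. level_weight m k) + f \<beta>)" (is "sum ?g ?T \<le> _")
proof -
  define K1 K2 where "K1 = {k \<in> K. 1 < 16384 * \<beta> * (16 ^ k)\<^sup>2}" and "K2 = {k \<in> K. 16384 * \<beta> * (16 ^ k)\<^sup>2 \<le> 1}"
  have K12: "finite K1" "finite K2" "K1 \<subseteq> K" "K2 \<subseteq> K" using K by (auto simp: K1_def K2_def)
  let ?A = "{i \<in> family m K1 u v. z \<le> pt i \<and> pt i \<le> z + 2 * \<beta>}"
  let ?B = "{i \<in> family m K2 u v. width m i \<le> \<beta> \<and> z \<le> pt i \<and> pt i \<le> z + 2 * \<beta>
      \<and> 4 * \<beta> * (of_int (child_den (fst (snd i)) (snd (snd i))))\<^sup>2 < 1}"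
  let ?C = "{i \<in> family m K2 u v. width m i \<le> \<beta> \<and> z \<le> pt i \<and> pt i \<le> z + 2 * \<beta>
      \<and> 1 \<le> 4 * \<beta> * (of_int (child_den (fst (snd i)) (snd (snd i))))\<^sup>2}"
  have fin: "finite ?A" "finite ?B" "finite ?C"
    using finite_family[OF K12(1)] finite_family[OF K12(2)] by (auto intro: finite_subset)
  have nonneg: "0 \<le> ?g i" if i: "i \<in> family m K' u v" and K': "K' \<subseteq> K" for i K'
  proof -
    obtain k x b where kxb: "k \<in> K'" "x \<in> farey k u v" "1 \<le> b" "b \<le> arity m k"
      "width m i = window (m k) x b" using family_props[OF i] by blast
    then show ?thesis using window_level(2)[OF adm kxb(2,3,4)] K' gauge_pos by (auto simp: less_imp_le)
  qed
  have nn: "0 \<le> sum ?g ?A" "0 \<le> sum ?g ?B" "0 \<le> sum ?g ?C"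
    using nonneg K12 by (auto intro!: sum_nonneg)
  have sub: "?T \<subseteq> ?A \<union> (?B \<union> ?C)"
    by (auto simp: family_def K1_def K2_def)
  have "sum ?g ?T \<le> sum ?g (?A \<union> (?B \<union> ?C))"
    by (rule sum_mono2) (use fin sub nonneg K12 in auto)
  also have "\<dots> \<le> sum ?g ?A + (sum ?g ?B + sum ?g ?C)"
  proof -
    have "sum ?g (?A \<union> (?B \<union> ?C)) = sum ?g ?A + sum ?g (?B \<union> ?C)"
      by (rule sum.union_disjoint) (use fin in \<open>auto simp: family_def K1_def K2_def\<close>)
    also have "sum ?g (?B \<union> ?C) = sum ?g ?B + sum ?g ?C"
      by (rule sum.union_disjoint) (use fin in auto)
    finally show ?thesis by simp
  qed
  also have "sum ?g ?A \<le> 4211200 * D ^ 3 * (\<beta> * (\<Sum>k\<in>K1. level_weight m k))"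
    by (rule family_upper_fine) (use K12 adm \<beta> in \<open>auto simp: K1_def\<close>)
  also have "sum ?g ?B \<le> f \<beta>"
    by (rule family_upper_short) (use K12 adm \<beta> in \<open>auto simp: K2_def\<close>)
  also have "sum ?g ?C \<le> (1 + 6 * D\<^sup>2) * f \<beta>"
    by (rule family_upper_long) (use K12 adm \<beta> in \<open>auto simp: K2_def\<close>)
  also have "4211200 * D ^ 3 * (\<beta> * (\<Sum>k\<in>K1. level_weight m k)) + (f \<beta> + (1 + 6 * D\<^sup>2) * f \<beta>)
      \<le> spread * (\<beta> * (\<Sum>k\<in>K. level_weight m k)) + spread * f \<beta>"
  proof (rule add_mono)
    have "(\<Sum>k\<in>K1. level_weight m k) \<le> (\<Sum>k\<in>K. level_weight m k)"
      by (rule sum_mono2) (use K K12 level_weight_nonneg adm in auto)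
    then show "4211200 * D ^ 3 * (\<beta> * (\<Sum>k\<in>K1. level_weight m k)) \<le> spread * (\<beta> * (\<Sum>k\<in>K. level_weight m k))"
      unfolding spread_def using \<beta> D_ge_one level_weight_nonneg adm K12
      by (intro mult_mono mult_left_mono mult_nonneg_nonneg sum_nonneg) auto
    have D: "1 \<le> D ^ 3" "D\<^sup>2 \<le> D ^ 3" using D_ge_one by (auto intro: power_increasing one_le_power)
    have "f \<beta> + (1 + 6 * D\<^sup>2) * f \<beta> = (2 + 6 * D\<^sup>2) * f \<beta>" by (simp add: algebra_simps)
    also have "\<dots> \<le> spread * f \<beta>"
      unfolding spread_def using D gauge_pos[OF \<beta>(1)] by (intro mult_right_mono) linarith+
    finally show "f \<beta> + (1 + 6 * D\<^sup>2) * f \<beta> \<le> spread * f \<beta>" .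
  qed
  finally show ?thesis by (simp add: distrib_left)
qed

end

section \<open>A disjoint family of windows inside an interval\<close>

text \<open>Greedy selection: keep a longest interval, discard all that meet it, and continue with the rest.\<close>

lemma vitali_selection:
  fixes lo hi :: "'i \<Rightarrow> real"
  assumes "finite I"
  shows "\<exists>G\<subseteq>I. disjoint_family_on (\<lambda>i. {lo i..hi i}) G \<and>
    (\<forall>i\<in>I. \<exists>g\<in>G. hi i - lo i \<le> hi g - lo g \<and> (i = g \<or> {lo i..hi i} \<inter> {lo g..hi g} \<noteq> {}))"
  using assms
proof (induction "card I" arbitrary: I rule: less_induct)
  case less
  show ?case
  proof (cases "I = {}")
    case False
    obtain g where g: "g \<in> I" "\<And>i. i \<in> I \<Longrightarrow> hi i - lo i \<le> hi g - lo g"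
      using arg_min_if_finite(1)[OF less.prems False, of "\<lambda>i. lo i - hi i"]
        arg_min_least[OF less.prems False, of _ "\<lambda>i. lo i - hi i"] by force
    define I' where "I' = {i \<in> I. i \<noteq> g \<and> {lo i..hi i} \<inter> {lo g..hi g} = {}}"
    have I': "I' \<subset> I" using g(1) by (auto simp: I'_def)
    then have "card I' < card I" "finite I'" using less.prems by (auto simp: psubset_card_mono intro: finite_subset)
    from less.hyps[OF this] obtain G where G: "G \<subseteq> I'" "disjoint_family_on (\<lambda>i. {lo i..hi i}) G"
      "\<forall>i\<in>I'. \<exists>g\<in>G. hi i - lo i \<le> hi g - lo g \<and> (i = g \<or> {lo i..hi i} \<inter> {lo g..hi g} \<noteq> {})" by blast
    show ?thesis
    proof (intro exI[of _ "insert g G"] conjI ballI)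
      show "insert g G \<subseteq> I" using G(1) I' g(1) by blast
      have dis: "{lo h..hi h} \<inter> {lo g..hi g} = {}" if "h \<in> G" for h using that G(1) by (auto simp: I'_def)
      show "disjoint_family_on (\<lambda>i. {lo i..hi i}) (insert g G)"
        unfolding disjoint_family_on_def
      proof (intro ballI impI)
        fix a b assume ab: "a \<in> insert g G" "b \<in> insert g G" "a \<noteq> b"
        show "{lo a..hi a} \<inter> {lo b..hi b} = {}"
        proof (cases "a = g \<or> b = g")
          case True
          then show ?thesis using ab dis by (metis inf_commute insertE)
        next
          case False
          then show ?thesis using ab G(2) by (meson disjoint_family_onD insertE)
        qed
      qed
      fix i assume i: "i \<in> I"
      show "\<exists>g\<in>insert g G. hi i - lo i \<le> hi g - lo g \<and> (i = g \<or> {lo i..hi i} \<inter> {lo g..hi g} \<noteq> {})"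
      proof (cases "i \<in> I'")
        case True
        then show ?thesis using G(3) by blast
      next
        case False
        then show ?thesis using g i by (intro bexI[of _ g]) (auto simp: I'_def)
      qed
    qed
  qed (simp add: disjoint_family_on_def)
qed

lemma sum_UN_le:
  fixes g :: "'a \<Rightarrow> real"
  assumes "finite H" "\<And>h. h \<in> H \<Longrightarrow> finite (T h)" "\<And>h i. h \<in> H \<Longrightarrow> i \<in> T h \<Longrightarrow> 0 \<le> g i"
  shows "sum g (\<Union>h\<in>H. T h) \<le> (\<Sum>h\<in>H. sum g (T h))"
  using assms
proof (induction H rule: finite_induct)
  case (insert h H)
  have fin: "finite (T h)" "finite (\<Union>h\<in>H. T h)" using insert by auto
  have "0 \<le> sum g (T h \<inter> (\<Union>h\<in>H. T h))" using insert by (intro sum_nonneg) auto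
  then have "sum g (\<Union>h\<in>insert h H. T h) \<le> sum g (T h) + sum g (\<Union>h\<in>H. T h)"
    using sum_Un[OF fin, of g] by simp
  then show ?case using insert by fastforce
qed simp

text \<open>An interval longer than \<open>\<beta>\<close> that meets \<open>[z, z + \<beta>]\<close> contains one of its endpoints.\<close>

lemma card_long_disjoint_intervals:
  fixes lo hi :: "'i \<Rightarrow> real"
  assumes dis: "disjoint_family_on (\<lambda>i. {lo i..hi i}) G" and fin: "finite G"
    and long: "\<And>i. i \<in> G \<Longrightarrow> \<beta> < hi i - lo i" and hit: "\<And>i. i \<in> G \<Longrightarrow> {lo i..hi i} \<inter> {z..z + \<beta>} \<noteq> {}"
  shows "card G \<le> 2"
proof -
  have pick: "card {i \<in> G. w \<in> {lo i..hi i}} \<le> 1" for w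
  proof -
    have "i = j" if "i \<in> {i \<in> G. w \<in> {lo i..hi i}}" "j \<in> {i \<in> G. w \<in> {lo i..hi i}}" for i j
      using that dis unfolding disjoint_family_on_def by blast
    then show ?thesis using fin by (simp add: card_le_Suc0_iff_eq)
  qed
  have "G \<subseteq> {i \<in> G. z \<in> {lo i..hi i}} \<union> {i \<in> G. z + \<beta> \<in> {lo i..hi i}}"
  proof
    fix i assume i: "i \<in> G"
    have "z \<in> {lo i..hi i} \<or> z + \<beta> \<in> {lo i..hi i}"
      using long[OF i] hit[OF i] by (auto simp: not_le)
    then show "i \<in> {i \<in> G. z \<in> {lo i..hi i}} \<union> {i \<in> G. z + \<beta> \<in> {lo i..hi i}}" using i by auto
  qed
  then have "card G \<le> card ({i \<in> G. z \<in> {lo i..hi i}} \<union> {i \<in> G. z + \<beta> \<in> {lo i..hi i}})"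
    using fin by (intro card_mono) auto
  also have "\<dots> \<le> card {i \<in> G. z \<in> {lo i..hi i}} + card {i \<in> G. z + \<beta> \<in> {lo i..hi i}}" by (rule card_Un_le)
  also have "\<dots> \<le> 2" using pick[of z] pick[of "z + \<beta>"] by simp
  finally show ?thesis .
qed

text \<open>Either a single weight is already large, or all weights are small and partial sums do not
  overshoot by more than \<open>W\<close>. The upper bound on the sum is what makes the mass of a window
  dominate \<open>W\<close> times its length.\<close>

lemma finite_block_with_large_sum:
  fixes w l :: "nat \<Rightarrow> real"
  assumes nonneg: "\<And>k. 0 \<le> w k" and le: "\<And>k. k\<^sub>0 \<le> k \<Longrightarrow> w k \<le> l k" and W: "0 < W"
    and big: "\<And>k. k\<^sub>0 \<le> k \<Longrightarrow> 2 * W \<le> l k" and div: "\<not> summable w"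
  shows "\<exists>K. finite K \<and> K \<subseteq> {k\<^sub>0..} \<and> W \<le> sum w K \<and> (\<forall>k\<in>K. sum w K \<le> l k)"
proof (cases "\<exists>k\<ge>k\<^sub>0. W \<le> w k")
  case True
  then obtain k where "k\<^sub>0 \<le> k" "W \<le> w k" by blast
  then show ?thesis using le by (intro exI[of _ "{k}"]) auto
next
  case False
  then have small: "w k < W" if "k\<^sub>0 \<le> k" for k
    using that by (metis not_le)
  have "\<exists>n. W \<le> (\<Sum>k=k\<^sub>0..<n. w k)"
  proof (rule ccontr)
    assume "\<nexists>n. W \<le> (\<Sum>k=k\<^sub>0..<n. w k)"
    then have lt: "(\<Sum>k=k\<^sub>0..<n. w k) < W" for n by (simp add: not_le)
    have "(\<Sum>k<n. w k) \<le> (\<Sum>k<k\<^sub>0. w k) + W" for n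
    proof -
      have "(\<Sum>k<n. w k) \<le> (\<Sum>k\<in>{..<k\<^sub>0} \<union> {k\<^sub>0..<n}. w k)" using nonneg by (intro sum_mono2) auto
      also have "\<dots> = (\<Sum>k<k\<^sub>0. w k) + (\<Sum>k=k\<^sub>0..<n. w k)" by (intro sum.union_disjoint) auto
      finally show ?thesis using lt[of n] by simp
    qed
    then have "summable w" using nonneg by (intro summableI_nonneg_bounded) auto
    with div show False ..
  qed
  define n where "n = (LEAST n. W \<le> (\<Sum>k=k\<^sub>0..<n. w k))"
  have n: "W \<le> (\<Sum>k=k\<^sub>0..<n. w k)"
    unfolding n_def using \<open>\<exists>n. W \<le> (\<Sum>k=k\<^sub>0..<n. w k)\<close> by (rule LeastI_ex)
  then have "k\<^sub>0 < n" using W by (cases "k\<^sub>0 < n") auto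
  then obtain n' where n': "n = Suc n'" "k\<^sub>0 \<le> n'" by (cases n) auto
  have "\<not> W \<le> (\<Sum>k=k\<^sub>0..<n'. w k)" using not_less_Least[of n' "\<lambda>n. W \<le> (\<Sum>k=k\<^sub>0..<n. w k)"] n' by (simp add: n_def)
  then have "(\<Sum>k=k\<^sub>0..<n. w k) \<le> 2 * W" using n' small[of n'] by simp
  then show ?thesis using n big by (intro exI[of _ "{k\<^sub>0..<n}"]) (auto intro: order_trans)
qed

abbreviation seg :: "real \<times> real \<Rightarrow> real set" where "seg A \<equiv> {fst A..snd A}"

abbreviation len :: "real \<times> real \<Rightarrow> real" where "len A \<equiv> snd A - fst A"

abbreviation near :: "real \<times> real \<Rightarrow> real \<Rightarrow> real \<Rightarrow> bool" where
  "near A z \<beta> \<equiv> seg A \<inter> {z..z + \<beta>} \<noteq> {}"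

text \<open>What has to be remembered of a window to conclude that its points are non-improvable at \<open>t = q\<close>.
  The range of \<open>q\<close> is the one in which \<open>m k\<close> bounds \<open>1 + \<Psi>\<close>.\<close>

definition good_window :: "(nat \<Rightarrow> real) \<Rightarrow> nat \<Rightarrow> real \<times> real \<Rightarrow> bool" where
  "good_window m k A \<longleftrightarrow> (\<exists>p q p' q' :: int. p * q' - p' * q = 1 \<and> 0 < q' \<and>
     16 ^ k \<le> real_of_int q \<and> real_of_int q \<le> 16 ^ (3 * k) \<and>
     fst A = of_int p / of_int q - 1 / (of_int q * of_int q' * m k) \<and> snd A = of_int p / of_int q)"

context slow_gauge
begin

lemma spread_ge_one: "1 \<le> spread"
proof -
  have "1 \<le> D ^ 3" using D_ge_one by (simp add: one_le_power)
  then show ?thesis unfolding spread_def by linarith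
qed

lemma filterlim_scale: "filterlim (\<lambda>k. 1 / 16 ^ k :: real) (at_right 0) sequentially"
proof -
  have "(\<lambda>k. (1 / 16) ^ k :: real) \<longlonglongrightarrow> 0" by (rule LIMSEQ_realpow_zero) auto
  then show ?thesis by (simp add: filterlim_at power_one_over)
qed

lemma good_window_family:
  assumes "admissible m k" "x \<in> farey k u v" "1 \<le> b" "b \<le> arity m k"
  shows "good_window m k (child x b - window (m k) x b, child x b)"
proof -
  note xp = farey_props[OF assms(2)] and wl = window_level[OF assms]
  define R :: real where "R = 16 ^ k"
  have "(16::real) ^ 2 \<le> 16 ^ k" by (rule power_increasing) (use assms in \<open>auto simp: admissible_def\<close>)
  then have R: "256 \<le> R" by (simp add: R_def)
  have "real_of_int (snd x) \<le> of_int (child_den x b)" by (rule parent_den_le[OF xp(1,2) assms(3)])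
  then have lo: "16 ^ k \<le> real_of_int (child_den x b)" using xp(3) by linarith
  have "real_of_int (child_den x b) \<le> of_int ((int b + 1) * snd x)"
    using child_den_bounds(2)[OF xp(1,2), of b] by (simp only: of_int_le_iff)
  also have "\<dots> = (real b + 1) * of_int (snd x)" by simp
  also have "\<dots> \<le> (R + 1) * (16 * R)"
  proof (rule mult_mono)
    show "real b + 1 \<le> R + 1" using wl(1) assms(1) unfolding admissible_def R_def by linarith
    show "real_of_int (snd x) \<le> 16 * R" using xp(4) by (simp add: R_def)
  qed (use xp(2) R in auto)
  also have "\<dots> \<le> (2 * R) * (16 * R)" using R by (intro mult_right_mono) auto
  also have "\<dots> = 32 * R\<^sup>2" by (simp add: power2_eq_square)
  also have "\<dots> \<le> R * R\<^sup>2" using R by (intro mult_right_mono) auto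
  also have "R * R\<^sup>2 = R ^ 3" by (simp add: power3_eq_cube power2_eq_square)
  also have "R ^ 3 = 16 ^ (3 * k)" by (simp add: R_def flip: power_mult)
  finally show ?thesis
    unfolding good_window_def using child_unimodular[OF xp(1,2), of b] xp(2) lo
    by (intro exI[of _ "child_num x b"] exI[of _ "child_den x b"] exI[of _ "fst x"] exI[of _ "snd x"])
      (auto simp: child_def window_def)
qed

text \<open>The selected windows retain a fixed proportion of the mass of the whole family: a discarded window
  meets a longer selected one, and \<open>family_upper\<close>, applied to the selected window, bounds the mass
  of all those discarded on its account by a multiple of its own mass.\<close>

lemma local_subfamily:
  assumes m: "\<And>k. 2 \<le> m k" and div: "\<not> summable (\<lambda>k. if m k \<le> 16 ^ k then level_weight m k else 0)"
    and d: "0 < d" and W: "0 < W"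
  shows "\<exists>G. finite G \<and> (\<forall>A\<in>G. u < fst A \<and> fst A < snd A \<and> snd A < u + d \<and> (\<exists>k\<ge>N. good_window m k A))
    \<and> W * d \<le> (\<Sum>A\<in>G. f (len A))
    \<and> (\<forall>\<beta> z. 0 < \<beta> \<longrightarrow> \<beta> \<le> r\<^sub>0 \<longrightarrow>
        (\<Sum>A\<in>{A \<in> G. len A \<le> \<beta> \<and> near A z \<beta>}. f (len A))
          \<le> 2048 * spread\<^sup>2 * (\<beta> / d * (\<Sum>A\<in>G. f (len A)) + f \<beta>))
    \<and> (\<forall>\<beta> z. card {A \<in> G. \<beta> < len A \<and> near A z \<beta>} \<le> 2)"
proof -
  \<comment> \<open>the factor compensates the losses from counting and from the selection\<close>
  define W' where "W' = 2048 * spread * W"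
  have W': "0 < W'" using W spread_ge_one by (simp add: W'_def)
  have "\<forall>\<^sub>F k in sequentially. 1 / 16 ^ k < min r\<^sub>0 (d / 4)"
    using filterlim_scale d r0_pos unfolding filterlim_at by (intro order_tendstoD(2)[of _ 0]) (auto simp: filterlim_at)
  moreover have "\<forall>\<^sub>F k in sequentially. 2 * W' \<le> ratio (1 / 16 ^ k)"
    using filterlim_compose[OF ratio_at_top filterlim_scale]
    unfolding filterlim_at_top ratio_def by blast
  moreover have "\<forall>\<^sub>F k in sequentially. d / 2 * (16 ^ k)\<^sup>2 \<le> real (card (farey k (u + d / 4) (u + d / 4 + d / 2)))"
    using card_farey_ge[of "d / 2" "u + d / 4"] d by (auto simp: eventually_sequentially)
  moreover have "\<forall>\<^sub>F k in sequentially. N + 2 \<le> k" by (rule eventually_ge_at_top)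
  ultimately have "\<forall>\<^sub>F k in sequentially. 1 / 16 ^ k < min r\<^sub>0 (d / 4) \<and> 2 * W' \<le> ratio (1 / 16 ^ k) \<and>
     d / 2 * (16 ^ k)\<^sup>2 \<le> real (card (farey k (u + d / 4) (u + d / 4 + d / 2))) \<and> N + 2 \<le> k"
    by eventually_elim auto
  then obtain k\<^sub>0 where k0: "\<And>k. k\<^sub>0 \<le> k \<Longrightarrow> 1 / 16 ^ k < r\<^sub>0" "\<And>k. k\<^sub>0 \<le> k \<Longrightarrow> 1 / 16 ^ k < d / 4"
    "\<And>k. k\<^sub>0 \<le> k \<Longrightarrow> 2 * W' \<le> ratio (1 / 16 ^ k)"
    "\<And>k. k\<^sub>0 \<le> k \<Longrightarrow> d / 2 * (16 ^ k)\<^sup>2 \<le> real (card (farey k (u + d / 4) (u + d / 4 + d / 2)))"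
    "\<And>k. k\<^sub>0 \<le> k \<Longrightarrow> N + 2 \<le> k"
    by (auto simp: eventually_sequentially)
  define w where "w k = (if m k \<le> 16 ^ k then level_weight m k else 0)" for k
  have lw: "0 \<le> level_weight m k" "level_weight m k \<le> ratio (1 / 16 ^ k)" for k
  proof -
    have rp: "0 < ratio (1 / 16 ^ k)" by (intro ratio_pos) simp
    have mk: "0 < m k" using m[of k] by simp
    show "0 \<le> level_weight m k" using rp mk by (simp add: level_weight_def harm_nonneg)
    have "harm (arity m k) \<le> (\<Sum>j=1..arity m k. 1 :: real)"
      unfolding harm_def by (intro sum_mono) (auto simp: field_simps)
    also have "\<dots> \<le> m k" using mk by simp
    finally have "harm (arity m k) \<le> m k" .
    then have "ratio (1 / 16 ^ k) * (harm (arity m k) / m k) \<le> ratio (1 / 16 ^ k) * 1"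
      using rp mk by (intro mult_left_mono) auto
    then show "level_weight m k \<le> ratio (1 / 16 ^ k)" by (simp add: level_weight_def)
  qed
  have "\<exists>K. finite K \<and> K \<subseteq> {k\<^sub>0..} \<and> W' \<le> sum w K \<and> (\<forall>k\<in>K. sum w K \<le> ratio (1 / 16 ^ k))"
  proof (rule finite_block_with_large_sum[OF _ _ W' k0(3)])
    show "\<not> summable w" using div by (simp add: w_def[abs_def])
    show "w k \<le> ratio (1 / 16 ^ k)" for k
      using lw(2)[of k] ratio_pos[of "1 / 16 ^ k"] by (simp add: w_def)
  qed (use lw in \<open>auto simp: w_def\<close>)
  then obtain K\<^sub>0 where K0: "finite K\<^sub>0" "K\<^sub>0 \<subseteq> {k\<^sub>0..}" "W' \<le> sum w K\<^sub>0" "\<forall>k\<in>K\<^sub>0. sum w K\<^sub>0 \<le> ratio (1 / 16 ^ k)"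
    by blast
  define K where "K = {k \<in> K\<^sub>0. m k \<le> 16 ^ k}"
  define V where "V = (\<Sum>k\<in>K. level_weight m k)"
  have "sum w K\<^sub>0 = V" unfolding V_def K_def w_def using K0(1) by (simp add: sum.If_cases Int_def)
  then have V: "W' \<le> V" "\<And>k. k \<in> K \<Longrightarrow> V \<le> ratio (1 / 16 ^ k)" using K0 by (auto simp: K_def)
  have K: "finite K" "\<And>k. k \<in> K \<Longrightarrow> k\<^sub>0 \<le> k" using K0 by (auto simp: K_def)
  have adm: "admissible m k" if k: "k \<in> K" for k
    using k0(1,5)[OF K(2)[OF k]] m k by (auto simp: admissible_def K_def less_imp_le)
  define I where "I = family m K (u + d / 4) (u + d / 4 + d / 2)"
  have finI: "finite I" unfolding I_def by (rule finite_family[OF K(1)])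
  have lower: "d / 2 * V / 512 \<le> (\<Sum>i\<in>I. f (width m i))"
    unfolding I_def V_def by (rule family_lower[OF K(1) adm]) (use k0(4) K(2) in auto)
  define lo where "lo i = pt i - width m i" for i
  have I_facts: "0 < width m i" "width m i * V \<le> f (width m i)" "u < lo i" "pt i < u + d"
    "\<exists>k\<ge>N. good_window m k (lo i, pt i)" "width m i \<le> r\<^sub>0" if i: "i \<in> I" for i
  proof -
    obtain k x b where kxb: "i = (k, x, b)" "k \<in> K" "x \<in> farey k (u + d / 4) (u + d / 4 + d / 2)"
      "1 \<le> b" "b \<le> arity m k" "pt i = child x b" "width m i = window (m k) x b"
      using family_props[OF i[unfolded I_def]] by blast
    note wl = window_level[OF adm[OF kxb(2)] kxb(3-5)] and xp = farey_props[OF kxb(3)]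
    note kk = k0[OF K(2)[OF kxb(2)]]
    define R :: real where "R = 16 ^ k"
    have R1: "1 \<le> R" by (simp add: R_def)
    then have "R * 1 \<le> R * R" by (intro mult_left_mono) auto
    then have sq: "1 / R\<^sup>2 \<le> 1 / R" using R1 by (intro divide_left_mono) (auto simp: power2_eq_square)
    show pos: "0 < width m i" using wl(2) by (simp add: kxb(6,7))
    show "width m i * V \<le> f (width m i)"
    proof -
      have "width m i * V \<le> width m i * ratio (1 / 16 ^ k)" using V(2)[OF kxb(2)] pos by (intro mult_left_mono) auto
      also have "\<dots> \<le> f (width m i)" using wl(8) by (simp add: kxb(6,7) mult.commute)
      finally show ?thesis .
    qed
    have small: "width m i \<le> 1 / R" using wl(5) sq by (simp add: kxb(6,7) R_def)
    then show "width m i \<le> r\<^sub>0" using kk(1) by (simp add: R_def)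
    note off = child_offset[OF kxb(3,4)]
    have "1 / (16 ^ k)\<^sup>2 < d / 4" using sq kk(2) by (simp add: R_def)
    then have "child x b < u + d" using xp(6) off(2) by linarith
    then show "pt i < u + d" by (simp add: kxb(6))
    have "u + d / 4 < child x b" using xp(5) off(1) by linarith
    then have "u + d / 4 < pt i" by (simp add: kxb(6))
    then show "u < lo i" using small kk(2) by (simp add: lo_def R_def)
    have "good_window m k (lo i, pt i)"
      using good_window_family[OF adm[OF kxb(2)] kxb(3-5)] by (simp add: lo_def kxb(6,7))
    then show "\<exists>k\<ge>N. good_window m k (lo i, pt i)" using kk(5) by (intro exI[of _ k]) auto
  qed
  note upper = family_upper[OF K(1) _ _ adm, of _ "u + d / 4" "u + d / 4 + d / 2", folded I_def V_def]
  obtain H where H: "H \<subseteq> I" "disjoint_family_on (\<lambda>i. {lo i..pt i}) H"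
    "\<forall>i\<in>I. \<exists>g\<in>H. pt i - lo i \<le> pt g - lo g \<and> (i = g \<or> {lo i..pt i} \<inter> {lo g..pt g} \<noteq> {})"
    using vitali_selection[OF finI, of lo pt] by blast
  have finH: "finite H" using H(1) finI finite_subset by blast
  have len: "pt i - lo i = width m i" for i by (simp add: lo_def)
  define S where "S = (\<Sum>i\<in>H. f (width m i))"
  have fnn: "0 \<le> f (width m i)" if "i \<in> I" for i using gauge_pos[OF I_facts(1)[OF that]] by simp
  have S_lower: "(\<Sum>i\<in>I. f (width m i)) \<le> 2 * spread * S"
  proof -
    define T where "T g = {i \<in> I. width m i \<le> width m g \<and> lo g \<le> pt i \<and> pt i \<le> lo g + 2 * width m g}" for g
    have "I \<subseteq> (\<Union>g\<in>H. T g)"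
    proof
      fix i assume i: "i \<in> I"
      then obtain g where g: "g \<in> H" "pt i - lo i \<le> pt g - lo g" "i = g \<or> {lo i..pt i} \<inter> {lo g..pt g} \<noteq> {}"
        using H(3) by blast
      have "g \<in> I" using g(1) H(1) by blast
      then have "0 < width m i" "0 < width m g" using i I_facts(1) by auto
      then have "i \<in> T g" using g(2,3) i by (auto simp: T_def lo_def)
      then show "i \<in> (\<Union>g\<in>H. T g)" using g(1) by blast
    qed
    moreover have finU: "finite (\<Union>g\<in>H. T g)" using finH finI by (auto simp: T_def)
    ultimately have "(\<Sum>i\<in>I. f (width m i)) \<le> (\<Sum>i\<in>(\<Union>g\<in>H. T g). f (width m i))"
      using fnn by (intro sum_mono2) (auto simp: T_def)
    also have "\<dots> \<le> (\<Sum>g\<in>H. \<Sum>i\<in>T g. f (width m i))"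
      by (rule sum_UN_le) (use finH finI fnn in \<open>auto simp: T_def\<close>)
    also have "\<dots> \<le> (\<Sum>g\<in>H. 2 * spread * f (width m g))"
    proof (rule sum_mono)
      fix g assume "g \<in> H"
      then have g: "g \<in> I" using H(1) by blast
      have "(\<Sum>i\<in>T g. f (width m i)) \<le> spread * (width m g * V + f (width m g))"
        unfolding T_def using I_facts(1,6)[OF g] by (rule upper)
      also have "\<dots> \<le> spread * (f (width m g) + f (width m g))"
        using I_facts(2)[OF g] spread_ge_one by (intro mult_left_mono add_right_mono) auto
      finally show "(\<Sum>i\<in>T g. f (width m i)) \<le> 2 * spread * f (width m g)" by simp
    qed
    also have "\<dots> = 2 * spread * S" by (simp add: S_def sum_distrib_left)
    finally show ?thesis .
  qed
  have VS: "d * V \<le> 2048 * spread * S" using lower S_lower by simp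
  have "W * d * (2048 * spread) = d * W'" by (simp add: W'_def)
  also have "\<dots> \<le> d * V" using V(1) d by (intro mult_left_mono) auto
  also note VS
  finally have WS: "W * d \<le> S" using spread_ge_one by simp
  define e where "e i = (lo i, pt i)" for i
  have inj: "inj_on e H"
  proof (rule inj_onI, rule ccontr)
    fix i j assume ij: "i \<in> H" "j \<in> H" "e i = e j" "i \<noteq> j"
    then have "{lo i..pt i} \<inter> {lo j..pt j} = {}" using H(2) by (simp add: disjoint_family_on_def)
    moreover have "lo i \<le> pt i" using I_facts(1)[of i] ij H(1) by (auto simp: lo_def)
    ultimately show False using ij by (auto simp: e_def)
  qed
  have fe: "fst (e i) = lo i" "snd (e i) = pt i" for i by (auto simp: e_def)
  show ?thesis
  proof (intro exI[of _ "e ` H"] conjI ballI allI impI)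
    show "finite (e ` H)" using finH by simp
    have eH: "\<exists>i\<in>I. A = (lo i, pt i)" if "A \<in> e ` H" for A using that H(1) by (auto simp: e_def)
    show "u < fst A" "fst A < snd A" "snd A < u + d" "\<exists>k\<ge>N. good_window m k A" if "A \<in> e ` H" for A
      using eH[OF that] I_facts(1,3,4,5) by (auto simp: lo_def)
    have sumS: "(\<Sum>A\<in>e ` H. f (len A)) = S"
      using inj by (simp add: sum.reindex fe len S_def)
    show "W * d \<le> (\<Sum>A\<in>e ` H. f (len A))" unfolding sumS by (rule WS)
    fix \<beta> z :: real
    have img: "{A \<in> e ` H. P (len A) \<and> near A z \<beta>}
      = e ` {i \<in> H. P (width m i) \<and> {lo i..pt i} \<inter> {z..z + \<beta>} \<noteq> {}}" for P
      by (auto simp: fe len)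
    have inj': "inj_on e {i \<in> H. P i}" for P using inj by (rule inj_on_subset) auto
    show "card {A \<in> e ` H. \<beta> < len A \<and> near A z \<beta>} \<le> 2"
      unfolding img[of "\<lambda>w. \<beta> < w"] card_image[OF inj']
    proof (rule card_long_disjoint_intervals)
      show "disjoint_family_on (\<lambda>i. {lo i..pt i}) {i \<in> H. \<beta> < width m i \<and> {lo i..pt i} \<inter> {z..z + \<beta>} \<noteq> {}}"
        using H(2) by (rule disjoint_family_on_mono[rotated]) auto
    qed (use finH len in auto)
    assume \<beta>: "0 < \<beta>" "\<beta> \<le> r\<^sub>0"
    have "(\<Sum>A\<in>{A \<in> e ` H. len A \<le> \<beta> \<and> near A z \<beta>}. f (len A))
      = (\<Sum>i\<in>{i \<in> H. width m i \<le> \<beta> \<and> {lo i..pt i} \<inter> {z..z + \<beta>} \<noteq> {}}. f (width m i))"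
      unfolding img[of "\<lambda>w. w \<le> \<beta>"] sum.reindex[OF inj'] o_def by (simp only: fe len)
    also have "\<dots> \<le> (\<Sum>i\<in>{i \<in> I. width m i \<le> \<beta> \<and> z \<le> pt i \<and> pt i \<le> z + 2 * \<beta>}. f (width m i))"
      by (rule sum_mono2) (use finI H(1) fnn in \<open>auto simp: lo_def\<close>)
    also have "\<dots> \<le> spread * (\<beta> * V + f \<beta>)" by (rule upper[OF \<beta>])
    also have "\<dots> \<le> spread * (2048 * spread * (\<beta> / d * S) + 2048 * spread * f \<beta>)"
    proof (intro mult_left_mono add_mono)
      have "\<beta> * V = \<beta> / d * (d * V)" using d by simp
      also have "\<dots> \<le> \<beta> / d * (2048 * spread * S)" using VS \<beta> d by (intro mult_left_mono) auto
      finally show "\<beta> * V \<le> 2048 * spread * (\<beta> / d * S)" by (simp add: mult_ac)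
      have "1 * f \<beta> \<le> 2048 * spread * f \<beta>" using spread_ge_one gauge_pos[OF \<beta>(1)] by (intro mult_right_mono) auto
      then show "f \<beta> \<le> 2048 * spread * f \<beta>" by simp
    qed (use spread_ge_one in auto)
    also have "\<dots> = 2048 * spread\<^sup>2 * (\<beta> / d * (\<Sum>A\<in>e ` H. f (len A)) + f \<beta>)"
      unfolding sumS by (simp add: power2_eq_square algebra_simps)
    finally show "(\<Sum>A\<in>{A \<in> e ` H. len A \<le> \<beta> \<and> near A z \<beta>}. f (len A))
      \<le> 2048 * spread\<^sup>2 * (\<beta> / d * (\<Sum>A\<in>e ` H. f (len A)) + f \<beta>)" .
  qed
qed

end

section \<open>A point outside a given cover\<close>

context slow_gauge
begin

abbreviation cost :: "real set \<Rightarrow> real" where "cost B \<equiv> f (diameter B)"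

text \<open>Suppose that each window of \<open>G\<close> is overcharged by finitely many balls that meet it. Exchanging the
  order of summation turns this into an inequality for a finite set of balls: a ball contributes
  to the windows shorter than itself at most their mass, and to each of the at most two longer
  windows at most \<open>\<kappa>\<close> times its own cost.\<close>

lemma averaging:
  assumes G: "finite G" and \<kappa>: "0 < \<kappa>" and width: "\<And>A. A \<in> G \<Longrightarrow> 0 < len A"
    and ball: "\<And>B. B \<in> \<B> \<Longrightarrow> 0 < diameter B \<and> (\<exists>z. B \<subseteq> {z..z + diameter B})"
    and short: "\<And>B z. B \<in> \<B> \<Longrightarrow> (\<Sum>A\<in>{A \<in> G. len A \<le> diameter B \<and>
        near A z (diameter B)}. f (len A)) \<le> h (diameter B)"
    and long: "\<And>\<beta> z. card {A \<in> G. \<beta> < len A \<and> near A z \<beta>} \<le> 2"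
    and charged: "\<And>A. A \<in> G \<Longrightarrow> \<exists>F. finite F \<and> F \<subseteq> {B \<in> \<B>. B \<inter> seg A \<noteq> {}} \<and>
        f (len A) < \<kappa> * (\<Sum>B\<in>F. cost B)"
  shows "\<exists>F. finite F \<and> F \<subseteq> {B \<in> \<B>. \<exists>A\<in>G. B \<inter> seg A \<noteq> {}} \<and>
    (\<Sum>A\<in>G. f (len A)) \<le> (\<Sum>B\<in>F. h (diameter B) + 2 * \<kappa> * cost B)"
proof -
  define charges where "charges A F \<longleftrightarrow> finite F \<and> F \<subseteq> {B \<in> \<B>. B \<inter> seg A \<noteq> {}} \<and>
    f (len A) < \<kappa> * (\<Sum>B\<in>F. cost B)" for A F
  have "\<forall>A\<in>G. \<exists>F. charges A F" unfolding charges_def using charged by (intro ballI)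
  from bchoice[OF this] obtain \<F> where "\<forall>A\<in>G. charges A (\<F> A)" by (elim exE)
  then have \<F>: "finite (\<F> A)" "\<F> A \<subseteq> {B \<in> \<B>. B \<inter> seg A \<noteq> {}}"
    "f (len A) < \<kappa> * (\<Sum>B\<in>\<F> A. cost B)" if "A \<in> G" for A
    using that by (simp_all only: charges_def)
  define F where "F = (\<Union>A\<in>G. \<F> A)"
  define hits where "hits A B \<longleftrightarrow> B \<inter> seg A \<noteq> {}" for A :: "real \<times> real" and B :: "real set"
  define g where "g A B = min (f (len A)) (\<kappa> * cost B)" for A :: "real \<times> real" and B :: "real set"
  have F: "finite F" "F \<subseteq> \<B>" unfolding F_def using G \<F>(1,2) by blast+
  have fA: "0 < f (len A)" if "A \<in> G" for A using width[OF that] by (rule gauge_pos)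
  have fB: "0 < cost B" if "B \<in> \<B>" for B using ball[OF that] gauge_pos by blast
  have g_nonneg: "0 \<le> g A B" if "A \<in> G" "B \<in> F" for A B
    using fA[OF that(1)] fB[of B] that F \<kappa> by (auto simp: g_def less_imp_le)
  have "(\<Sum>A\<in>G. f (len A)) \<le> (\<Sum>A\<in>G. \<Sum>B\<in>{B. B \<in> F \<and> hits A B}. g A B)"
  proof (rule sum_mono)
    fix A assume A: "A \<in> G"
    have nn: "0 \<le> g A B" if "B \<in> \<F> A" for B using g_nonneg[OF A] that A by (auto simp: F_def)
    have "f (len A) \<le> (\<Sum>B\<in>\<F> A. g A B)"
    proof (cases "\<exists>B\<in>\<F> A. f (len A) \<le> \<kappa> * cost B")
      case True
      then obtain B where B: "B \<in> \<F> A" "f (len A) \<le> \<kappa> * cost B" by blast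
      then have "f (len A) = g A B" by (simp add: g_def)
      also have "\<dots> \<le> (\<Sum>B\<in>\<F> A. g A B)" using B(1) nn \<F>(1)[OF A] by (intro member_le_sum) auto
      finally show ?thesis .
    next
      case False
      then have "(\<Sum>B\<in>\<F> A. g A B) = (\<Sum>B\<in>\<F> A. \<kappa> * cost B)"
        by (intro sum.cong) (auto simp: g_def)
      then show ?thesis using \<F>(3)[OF A] by (simp add: sum_distrib_left)
    qed
    also have "\<dots> \<le> (\<Sum>B\<in>{B. B \<in> F \<and> hits A B}. g A B)"
    proof (rule sum_mono2)
      show "\<F> A \<subseteq> {B. B \<in> F \<and> hits A B}" using \<F>(2)[OF A] A by (auto simp: F_def hits_def)
    qed (use F A g_nonneg in auto)
    finally show "f (len A) \<le> (\<Sum>B\<in>{B. B \<in> F \<and> hits A B}. g A B)" .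
  qed
  also have "\<dots> = (\<Sum>B\<in>F. \<Sum>A\<in>{A. A \<in> G \<and> hits A B}. g A B)"
    by (rule sum.swap_restrict[OF G F(1)])
  also have "\<dots> \<le> (\<Sum>B\<in>F. h (diameter B) + 2 * \<kappa> * cost B)"
  proof (rule sum_mono)
    fix B assume B: "B \<in> F"
    then have B': "B \<in> \<B>" using F by blast
    obtain z where z: "B \<subseteq> {z..z + diameter B}" using ball[OF B'] by blast
    let ?s = "{A \<in> G. len A \<le> diameter B \<and> near A z (diameter B)}"
    let ?l = "{A \<in> G. diameter B < len A \<and> near A z (diameter B)}"
    have "(\<Sum>A\<in>{A. A \<in> G \<and> hits A B}. g A B) \<le> (\<Sum>A\<in>?s \<union> ?l. g A B)"
      by (rule sum_mono2) (use G B g_nonneg z in \<open>auto simp: hits_def not_le\<close>)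
    also have "\<dots> = (\<Sum>A\<in>?s. g A B) + (\<Sum>A\<in>?l. g A B)" using G by (intro sum.union_disjoint) auto
    also have "(\<Sum>A\<in>?s. g A B) \<le> (\<Sum>A\<in>?s. f (len A))" by (intro sum_mono) (simp add: g_def)
    also have "\<dots> \<le> h (diameter B)" by (rule short[OF B'])
    also have "(\<Sum>A\<in>?l. g A B) \<le> (\<Sum>A\<in>?l. \<kappa> * cost B)" by (intro sum_mono) (simp add: g_def)
    also have "\<dots> = real (card ?l) * (\<kappa> * cost B)" by simp
    also have "\<dots> \<le> 2 * (\<kappa> * cost B)"
      using long[of "diameter B" z] fB[OF B'] \<kappa> by (intro mult_right_mono) auto
    finally show "(\<Sum>A\<in>{A. A \<in> G \<and> hits A B}. g A B) \<le> h (diameter B) + 2 * \<kappa> * cost B" by simp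
  qed
  finally have "(\<Sum>A\<in>G. f (len A)) \<le> (\<Sum>B\<in>F. h (diameter B) + 2 * \<kappa> * cost B)" .
  moreover have "F \<subseteq> {B \<in> \<B>. \<exists>A\<in>G. B \<inter> seg A \<noteq> {}}" using \<F>(2) by (fastforce simp: F_def)
  ultimately show ?thesis using F(1) by blast
qed

text \<open>A window satisfies \<open>inv\<close> if the balls of the cover that meet it cost at most \<open>1 / \<kappa>\<close> times its
  mass. Such a window contains a smaller one with the same property, and a first one exists in
  \<open>[0, r\<^sub>0]\<close> because the family can be chosen with a mass far above the total cost of the cover.\<close>

lemma measure_infinite_of_divergence:
  assumes m: "\<And>k. 2 \<le> m k" and div: "\<not> summable (\<lambda>k. if m k \<le> 16 ^ k then level_weight m k else 0)"
    and E: "\<And>x. 0 \<le> x \<Longrightarrow> x < 1 \<Longrightarrow> (\<And>N. \<exists>k\<ge>N. \<exists>A. good_window m k A \<and> fst A \<le> x \<and> x \<le> snd A) \<Longrightarrow> x \<in> E"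
  shows "hausdorff_measure f E = \<infinity>"
proof (rule ccontr)
  assume "hausdorff_measure f E \<noteq> \<infinity>"
  then obtain T\<^sub>0 where T0: "0 \<le> T\<^sub>0" "hausdorff_measure f E = ennreal T\<^sub>0" by (metis ennreal_cases infinity_ennreal_def)
  define T where "T = T\<^sub>0 + 1"
  have T: "0 < T" "hausdorff_measure f E < ennreal T" using T0 by (auto simp: T_def ennreal_less_iff)
  define C where "C = 2048 * spread\<^sup>2"
  \<comment> \<open>in the inductive step the expected total is at most \<open>(C + 1) / \<kappa>\<close>, which has to be below \<open>1\<close>\<close>
  define \<kappa> where "\<kappa> = C + 2"
  have C: "0 < C" using spread_ge_one by (simp add: C_def)
  have \<kappa>: "0 < \<kappa>" "1 < \<kappa>" using C by (auto simp: \<kappa>_def)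
  have "\<forall>\<^sub>F r in at_right 0. 4 * C * T / r\<^sub>0 \<le> ratio r"
    using ratio_at_top unfolding filterlim_at_top ratio_def by blast
  then obtain \<rho>\<^sub>1 where \<rho>1: "0 < \<rho>\<^sub>1" "\<And>r. 0 < r \<Longrightarrow> r < \<rho>\<^sub>1 \<Longrightarrow> 4 * C * T / r\<^sub>0 \<le> ratio r"
    by (auto simp: eventually_at_right_field)
  define \<rho> where "\<rho> = min (\<rho>\<^sub>1 / 2) r\<^sub>0"
  have \<rho>: "0 < \<rho>" "\<rho> \<le> r\<^sub>0" "\<rho> < \<rho>\<^sub>1" using \<rho>1 r0_pos by (auto simp: \<rho>_def)
  have "hausdorff_premeasure f \<rho> E < ennreal T"
    using T(2) \<rho>(1) unfolding hausdorff_measure_eq_SUP by (metis SUP_upper greaterThan_iff le_less_trans)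
  then obtain \<B> where \<B>: "\<B> \<in> ball_covers \<rho> E" "(\<Sum>\<^sub>\<infinity>B\<in>\<B>. ennreal (cost B)) < ennreal T"
    unfolding hausdorff_premeasure_def by (auto simp: INF_less_iff)
  have ball: "0 < diameter B \<and> (\<exists>z. B \<subseteq> {z..z + diameter B})" and diam: "diameter B \<le> \<rho>" if B: "B \<in> \<B>" for B
  proof -
    obtain c r where cr: "0 < r" "B = ball c r" "diameter B \<le> \<rho>" using \<B>(1) B by (auto simp: ball_covers_def)
    then have d: "diameter B = 2 * r" by (simp add: diameter_ball)
    have "B \<subseteq> {c - r..c - r + 2 * r}" by (auto simp: cr(2) dist_real_def abs_less_iff)
    then show "0 < diameter B \<and> (\<exists>z. B \<subseteq> {z..z + diameter B})"
      unfolding d using cr(1) by (intro conjI exI[of _ "c - r"]) auto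
    show "diameter B \<le> \<rho>" by fact
  qed
  have fB: "0 < cost B" if "B \<in> \<B>" for B using ball[OF that] gauge_pos by blast
  have total: "(\<Sum>B\<in>F. cost B) \<le> T" if F: "finite F" "F \<subseteq> \<B>" for F
  proof -
    have "ennreal (\<Sum>B\<in>F. cost B) = (\<Sum>B\<in>F. ennreal (cost B))"
      using F fB by (intro sum_ennreal[symmetric]) (auto simp: less_imp_le)
    also have "\<dots> = (\<Sum>\<^sub>\<infinity>B\<in>F. ennreal (cost B))" using F(1) by simp
    also have "\<dots> \<le> (\<Sum>\<^sub>\<infinity>B\<in>\<B>. ennreal (cost B))"
      by (rule infsum_mono_neutral) (use F in \<open>auto intro!: nonneg_summable_on_complete\<close>)
    also have "\<dots> < ennreal T" by fact
    finally have "ennreal (\<Sum>B\<in>F. cost B) < ennreal T" .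
    moreover have "0 \<le> (\<Sum>B\<in>F. cost B)"
      using F fB by (intro sum_nonneg) (auto simp: less_imp_le)
    ultimately show ?thesis by (simp add: ennreal_less_iff)
  qed
  define inv where "inv A \<longleftrightarrow> (\<forall>F. finite F \<longrightarrow> F \<subseteq> {B \<in> \<B>. B \<inter> seg A \<noteq> {}} \<longrightarrow>
    \<kappa> * (\<Sum>B\<in>F. cost B) \<le> f (len A))" for A :: "real \<times> real"
  define P where "P n A \<longleftrightarrow> inv A \<and> 0 \<le> fst A \<and> fst A < snd A \<and> snd A < 1 \<and> len A \<le> r\<^sub>0 \<and>
    (\<exists>k\<ge>n. good_window m k A)" for n and A :: "real \<times> real"
  \<comment> \<open>the common core of the initial step and of the inductive step\<close>
  have refine: "\<exists>A. u < fst A \<and> fst A < snd A \<and> snd A < u + d \<and> (\<exists>k\<ge>N. good_window m k A) \<and> inv A"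
    if d: "0 < d" "d \<le> r\<^sub>0" and W: "0 < W"
      and light: "\<And>F S. finite F \<Longrightarrow> F \<subseteq> {B \<in> \<B>. B \<inter> {u..u + d} \<noteq> {}} \<Longrightarrow> 0 < S \<Longrightarrow> W * d \<le> S \<Longrightarrow>
        (\<Sum>B\<in>F. C * (diameter B / d * S + cost B) + 2 * \<kappa> * cost B) < S"
    for u d W N
  proof (rule ccontr)
    assume none: "\<not> ?thesis"
    from local_subfamily[OF m div d(1) W, of u N, folded C_def] obtain G where G: "finite G"
      "\<forall>A\<in>G. u < fst A \<and> fst A < snd A \<and> snd A < u + d \<and> (\<exists>k\<ge>N. good_window m k A)"
      "W * d \<le> (\<Sum>A\<in>G. f (len A))"
      "\<forall>\<beta> z. 0 < \<beta> \<longrightarrow> \<beta> \<le> r\<^sub>0 \<longrightarrow>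
        (\<Sum>A\<in>{A \<in> G. len A \<le> \<beta> \<and> near A z \<beta>}. f (len A))
          \<le> C * (\<beta> / d * (\<Sum>A\<in>G. f (len A)) + f \<beta>)"
      "\<forall>\<beta> z. card {A \<in> G. \<beta> < len A \<and> near A z \<beta>} \<le> 2"
      by (elim exE conjE)
    define S where "S = (\<Sum>A\<in>G. f (len A))"
    have "\<exists>F. finite F \<and> F \<subseteq> {B \<in> \<B>. \<exists>A\<in>G. B \<inter> seg A \<noteq> {}} \<and>
      (\<Sum>A\<in>G. f (len A)) \<le> (\<Sum>B\<in>F. C * (diameter B / d * S + cost B) + 2 * \<kappa> * cost B)"
    proof (rule averaging[OF G(1) \<kappa>(1) _ ball])
      show "0 < len A" if "A \<in> G" for A using G(2) that by simp
      show "(\<Sum>A\<in>{A \<in> G. len A \<le> diameter B \<and> near A z (diameter B)}. f (len A))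
          \<le> C * (diameter B / d * S + cost B)" if "B \<in> \<B>" for B z
        unfolding S_def using ball[OF that] diam[OF that] \<rho>(2) by (intro G(4)[rule_format]) auto
      show "card {A \<in> G. \<beta> < len A \<and> near A z \<beta>} \<le> 2" for \<beta> z
        using G(5) by blast
      show "\<exists>F. finite F \<and> F \<subseteq> {B \<in> \<B>. B \<inter> seg A \<noteq> {}} \<and>
          f (len A) < \<kappa> * (\<Sum>B\<in>F. cost B)" if "A \<in> G" for A
      proof -
        have "\<not> inv A" using none G(2) that by blast
        then show ?thesis by (auto simp: inv_def not_le)
      qed
    qed
    then obtain F where F: "finite F" "F \<subseteq> {B \<in> \<B>. \<exists>A\<in>G. B \<inter> seg A \<noteq> {}}"
      "S \<le> (\<Sum>B\<in>F. C * (diameter B / d * S + cost B) + 2 * \<kappa> * cost B)"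
      unfolding S_def by blast
    have "F \<subseteq> {B \<in> \<B>. B \<inter> {u..u + d} \<noteq> {}}"
    proof
      fix B assume "B \<in> F"
      then obtain A where A: "B \<in> \<B>" "A \<in> G" "B \<inter> seg A \<noteq> {}" using F(2) by blast
      have "seg A \<subseteq> {u..u + d}" using G(2) A(2) by fastforce
      then show "B \<in> {B \<in> \<B>. B \<inter> {u..u + d} \<noteq> {}}" using A by blast
    qed
    moreover have "W * d \<le> S" using G(3) by (simp add: S_def)
    moreover have "0 < S" using \<open>W * d \<le> S\<close> W d by (meson less_le_trans mult_pos_pos)
    ultimately have "S < S" using light[OF F(1), of S] F(3) by simp
    then show False by simp
  qed
  have "\<exists>A. P 0 A"
  proof -
    \<comment> \<open>by the choice of \<open>W\<close> and of \<open>\<rho>\<close>, the balls account for at most half of the mass\<close>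
    define W where "W = 4 * (C + 2 * \<kappa>) * T / r\<^sub>0"
    have W: "0 < W" using C \<kappa> T r0_pos by (simp add: W_def)
    have "\<exists>A. 0 < fst A \<and> fst A < snd A \<and> snd A < 0 + r\<^sub>0 \<and> (\<exists>k\<ge>0. good_window m k A) \<and> inv A"
    proof (rule refine[OF r0_pos order_refl W])
      fix F and S :: real
      assume F: "finite F" "F \<subseteq> {B \<in> \<B>. B \<inter> {0..0 + r\<^sub>0} \<noteq> {}}" and S: "0 < S" "W * r\<^sub>0 \<le> S"
      have F': "F \<subseteq> \<B>" using F by blast
      have S4: "4 * (C + 2 * \<kappa>) * T \<le> S" using S(2) r0_pos by (simp add: W_def)
      have le: "C * (diameter B / r\<^sub>0 * S + cost B) + 2 * \<kappa> * cost B
          \<le> (S / (4 * T) + (C + 2 * \<kappa>)) * cost B" if B: "B \<in> F" for B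
      proof -
        have b: "0 < diameter B" "diameter B < \<rho>\<^sub>1" using ball[of B] diam[of B] \<rho> B F' by (auto intro: le_less_trans)
        have "4 * C * T / r\<^sub>0 * diameter B \<le> ratio (diameter B) * diameter B"
          using \<rho>1(2)[OF b] b(1) by (intro mult_right_mono) auto
        then have "4 * C * T / r\<^sub>0 * diameter B \<le> cost B" using gauge_eq[OF b(1)] by (simp add: mult.commute)
        then have "4 * C * T / r\<^sub>0 * diameter B * (S / (4 * T)) \<le> cost B * (S / (4 * T))"
          using S T by (intro mult_right_mono) auto
        then have "C * (diameter B / r\<^sub>0 * S) \<le> S / (4 * T) * cost B"
          using T r0_pos by (simp add: field_simps)
        then show ?thesis by (simp add: algebra_simps)
      qed
      have "(\<Sum>B\<in>F. C * (diameter B / r\<^sub>0 * S + cost B) + 2 * \<kappa> * cost B)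
          \<le> (\<Sum>B\<in>F. (S / (4 * T) + (C + 2 * \<kappa>)) * cost B)" by (rule sum_mono[OF le])
      also have "\<dots> = (S / (4 * T) + (C + 2 * \<kappa>)) * (\<Sum>B\<in>F. cost B)" by (simp add: sum_distrib_left)
      also have "\<dots> \<le> (S / (4 * T) + (C + 2 * \<kappa>)) * T"
        using total[OF F(1) F'] S T C \<kappa> by (intro mult_left_mono) auto
      also have "\<dots> = S / 4 + (C + 2 * \<kappa>) * T" using T by (simp add: distrib_right)
      also have "\<dots> < S" using S4 S(1) by linarith
      finally show "(\<Sum>B\<in>F. C * (diameter B / r\<^sub>0 * S + cost B) + 2 * \<kappa> * cost B) < S" .
    qed
    then show ?thesis using r0_less by (fastforce simp: P_def)
  qed
  moreover have "\<exists>A'. P (Suc n) A' \<and> (fst A \<le> fst A' \<and> snd A' \<le> snd A)" if A: "P n A" for n A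
  proof -
    define d where "d = len A"
    have d: "0 < d" "d \<le> r\<^sub>0" using A by (auto simp: P_def d_def)
    have fd: "0 < f d" by (rule gauge_pos[OF d(1)])
    \<comment> \<open>the windows have at least \<open>C + 2 \<kappa>\<close> times the mass of \<open>A\<close>, so the terms other than
        \<open>C (diameter B) / d\<close> contribute at most \<open>1\<close> to \<open>C + 1\<close>\<close>
    define W where "W = (C + 2 * \<kappa>) * ratio d"
    have W: "0 < W" using C \<kappa> ratio_pos[OF d(1)] by (simp add: W_def)
    have step: "\<exists>A'. fst A < fst A' \<and> fst A' < snd A' \<and> snd A' < fst A + d \<and> (\<exists>k\<ge>Suc n. good_window m k A') \<and> inv A'"
    proof (rule refine[OF d W])
      fix F and S :: real
      assume F: "finite F" "F \<subseteq> {B \<in> \<B>. B \<inter> {fst A..fst A + d} \<noteq> {}}" and S: "0 < S" "W * d \<le> S"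
      have iv: "\<kappa> * (\<Sum>B\<in>F'. cost B) \<le> f d" if "F' \<subseteq> F" for F'
        using A F finite_subset[OF that F(1)] that by (auto simp: P_def inv_def d_def)
      have S2: "(C + 2 * \<kappa>) * f d \<le> S" using S(2) gauge_eq[OF d(1)] by (simp add: W_def mult_ac)
      have le: "C * (diameter B / d * S + cost B) + 2 * \<kappa> * cost B
          \<le> (C + 1) * S / f d * cost B" if B: "B \<in> F" for B
      proof -
        have b: "0 < diameter B" and fb: "0 < cost B" using ball[of B] fB[of B] B F by auto
        have "\<kappa> * cost B \<le> f d" using iv[of "{B}"] B by simp
        then have "cost B < f d" using \<kappa>(2) fb by (smt (verit) mult_less_cancel_right1)
        then have "diameter B < d" using gauge_le[OF d(1), of "diameter B"] by linarith
        then have "ratio d \<le> ratio (diameter B)" using b d by (intro ratio_le) auto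
        then have "diameter B / d \<le> cost B / f d"
          using b d fd by (simp add: ratio_def field_simps)
        then have "C * (diameter B / d * S) \<le> C * (cost B / f d * S)"
          using C S by (intro mult_left_mono mult_right_mono) auto
        moreover have "(C + 2 * \<kappa>) * cost B \<le> S / f d * cost B"
          using S2 fd fb by (intro mult_right_mono) (auto simp: field_simps)
        moreover have "(C + 1) * S / f d * cost B = C * (cost B / f d * S) + S / f d * cost B"
          by (simp add: algebra_simps add_divide_distrib)
        ultimately show ?thesis by (simp add: algebra_simps)
      qed
      have "(\<Sum>B\<in>F. C * (diameter B / d * S + cost B) + 2 * \<kappa> * cost B)
          \<le> (\<Sum>B\<in>F. (C + 1) * S / f d * cost B)" by (rule sum_mono[OF le])
      also have "\<dots> = (C + 1) * S / f d * (\<Sum>B\<in>F. cost B)" by (simp add: sum_distrib_left)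
      also have "\<dots> \<le> (C + 1) * S / f d * (f d / \<kappa>)"
        using iv[OF order_refl] C S fd \<kappa> by (intro mult_left_mono) (auto simp: field_simps)
      also have "\<dots> = (C + 1) / \<kappa> * S" using fd by simp
      also have "\<dots> < 1 * S" using C S by (intro mult_strict_right_mono) (auto simp: \<kappa>_def)
      finally show "(\<Sum>B\<in>F. C * (diameter B / d * S + cost B) + 2 * \<kappa> * cost B) < S" by simp
    qed
    have "fst A + d = snd A" by (simp add: d_def)
    from step[unfolded this] obtain A' where "fst A < fst A' \<and> fst A' < snd A' \<and> snd A' < snd A \<and>
      (\<exists>k\<ge>Suc n. good_window m k A') \<and> inv A'" by (elim exE)
    then show ?thesis using A by (intro exI[of _ A']) (auto simp: P_def)
  qed
  ultimately obtain A where A: "\<And>n. P n (A n)" "\<And>n. fst (A n) \<le> fst (A (Suc n)) \<and> snd (A (Suc n)) \<le> snd (A n)"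
    using dependent_nat_choice[of P "\<lambda>n A A'. fst A \<le> fst A' \<and> snd A' \<le> snd A"] by metis
  have inc: "incseq (\<lambda>n. fst (A n))" and dec: "decseq (\<lambda>n. snd (A n))"
    using A(2) by (auto intro: incseq_SucI decseq_SucI)
  have lt: "fst (A n) < snd (A n)" for n using A(1)[of n] by (simp add: P_def)
  have cross: "fst (A i) \<le> snd (A j)" for i j
  proof -
    have "fst (A i) \<le> fst (A (max i j))" using incseqD[OF inc, of i "max i j"] by simp
    also have "\<dots> \<le> snd (A (max i j))" using lt by (simp add: less_imp_le)
    also have "\<dots> \<le> snd (A j)" using decseqD[OF dec, of j "max i j"] by simp
    finally show ?thesis .
  qed
  define x where "x = (SUP n. fst (A n))"
  have bdd: "bdd_above (range (\<lambda>n. fst (A n)))" using cross[of _ 0] by (intro bdd_aboveI2)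
  have x: "fst (A n) \<le> x" "x \<le> snd (A n)" for n
    unfolding x_def using bdd cross by (auto intro: cSUP_upper cSUP_least)
  have "0 \<le> x" "x < 1" using x[of 0] A(1)[of 0] by (auto simp: P_def)
  then have "x \<in> E"
  proof (rule E)
    fix N
    obtain k where "N \<le> k" "good_window m k (A N)" using A(1)[of N] by (auto simp: P_def)
    then show "\<exists>k\<ge>N. \<exists>A. good_window m k A \<and> fst A \<le> x \<and> x \<le> snd A"
      using x[of N] by (intro exI[of _ k] conjI exI[of _ "A N"])
  qed
  then obtain B where B: "B \<in> \<B>" "x \<in> B" using \<B>(1) by (auto simp: ball_covers_def)
  have low: "\<kappa> * cost B \<le> f (len (A n))" for n
  proof -
    have inv: "inv (A n)" using A(1) by (simp add: P_def)
    have sub: "{B} \<subseteq> {B \<in> \<B>. B \<inter> seg (A n) \<noteq> {}}" using B x[of n] by auto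
    from inv[unfolded inv_def, rule_format, OF _ sub] show ?thesis by simp
  qed
  have "0 < \<kappa> * cost B" using \<kappa> fB[OF B(1)] by simp
  with gauge_lim have "\<forall>\<^sub>F r in at_right 0. f r < \<kappa> * cost B" by (rule order_tendstoD(2))
  then obtain \<delta> where \<delta>: "0 < \<delta>" "\<And>r. 0 < r \<Longrightarrow> r < \<delta> \<Longrightarrow> f r < \<kappa> * cost B"
    by (auto simp: eventually_at_right_field)
  obtain n where n: "(1 / 16) ^ n < \<delta>" using real_arch_pow_inv[OF \<delta>(1), of "1 / 16"] by auto
  obtain k where k: "n \<le> k" "good_window m k (A n)" using A(1)[of n] by (auto simp: P_def)
  obtain p q p' q' :: int where pq: "0 < q'" "16 ^ k \<le> real_of_int q"
    "len (A n) = 1 / (of_int q * of_int q' * m k)"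
    using k(2) by (auto simp: good_window_def)
  have "0 < real_of_int q" using pq(2) by (rule less_le_trans[rotated]) simp
  then have "real_of_int q * 1 * 1 \<le> of_int q * of_int q' * m k"
    using pq(1) m[of k] by (intro mult_mono mult_nonneg_nonneg) auto
  then have "16 ^ k \<le> of_int q * of_int q' * m k" using pq(2) by linarith
  then have "len (A n) \<le> 1 / 16 ^ k"
    unfolding pq(3) using \<open>0 < real_of_int q\<close> pq(1) m[of k] by (intro divide_left_mono mult_pos_pos) auto
  also have "\<dots> \<le> (1 / 16) ^ n" using k(1) by (simp add: power_one_over power_increasing divide_left_mono)
  finally have "f (len (A n)) < \<kappa> * cost B" using lt[of n] n by (intro \<delta>(2)) auto
  then show False using low[of n] by simp
qed

end

section \<open>From the series to the level weights\<close>

text \<open>The derivative of \<open>(1 + ln x) / x\<close> is \<open>- ln x / x\<^sup>2\<close>; without the summand \<open>1\<close> the function would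
  only decrease from \<open>exp 1\<close> on.\<close>

lemma log_over_id_antimono:
  fixes x y :: real
  assumes "1 \<le> x" "x \<le> y"
  shows "(1 + ln y) / y \<le> (1 + ln x) / x"
proof -
  have "ln y = ln x + ln (y / x)" using assms by (simp add: ln_div)
  also have "ln (y / x) \<le> y / x - 1" using assms by (intro ln_le_minus_one) simp
  finally have "x * (1 + ln y) \<le> x * (1 + (ln x + (y / x - 1)))" using assms by (intro mult_left_mono) auto
  also have "\<dots> = y + x * ln x" using assms by (simp add: algebra_simps)
  also have "\<dots> \<le> y + y * ln x" using assms by (intro add_left_mono mult_right_mono) auto
  finally show ?thesis using assms by (simp add: field_simps)
qed

lemma sum_over_blocks_le:
  fixes a b :: "nat \<Rightarrow> real" and c :: "nat \<Rightarrow> nat"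
  assumes mono: "\<And>k. c k \<le> c (Suc k)" and block: "\<And>k. i \<le> k \<Longrightarrow> (\<Sum>q=c k..<c (Suc k). a q) \<le> b k" and "i \<le> n"
  shows "(\<Sum>q=c i..<c n. a q) \<le> (\<Sum>k=i..<n. b k)"
  using \<open>i \<le> n\<close>
proof (induction n rule: dec_induct)
  case (step n)
  have "c i \<le> c n" by (rule lift_Suc_mono_le[of c, OF mono step(1)])
  then have "(\<Sum>q=c i..<c (Suc n). a q) = (\<Sum>q=c i..<c n. a q) + (\<Sum>q=c n..<c (Suc n). a q)"
    using mono by (simp add: sum.atLeastLessThan_concat)
  then show ?case using step block[of n] by simp
qed simp

context slow_gauge
begin

text \<open>The slow growth of \<open>f r / r\<close> makes the terms with \<open>\<Psi>(q) \<ge> q powr (1/4)\<close> summable on their own, so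
  they do not matter for the divergence.\<close>

lemma term_le_power:
  assumes "1 \<le> q" "1 < \<Psi>" "q powr (1 / 4) \<le> \<Psi>" 
    and small: "ratio (1 / (q\<^sup>2 * \<Psi>)) \<le> (q\<^sup>2 * \<Psi>) powr (1 / 100)"
  shows "q * ln \<Psi> * f (1 / (q\<^sup>2 * \<Psi>)) \<le> 2 * q powr (- 11 / 10)"
proof -
  have pos: "0 < 1 / (q\<^sup>2 * \<Psi>)" using assms by simp
  have "q * ln \<Psi> * f (1 / (q\<^sup>2 * \<Psi>)) = ln \<Psi> / (q * \<Psi>) * ratio (1 / (q\<^sup>2 * \<Psi>))"
    using gauge_eq[OF pos] assms by (simp add: power2_eq_square)
  also have "\<dots> \<le> ln \<Psi> / (q * \<Psi>) * (q\<^sup>2 * \<Psi>) powr (1 / 100)"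
    using small assms by (intro mult_left_mono) auto
  also have "\<dots> \<le> (2 * \<Psi> powr (1 / 2)) / (q * \<Psi>) * (q\<^sup>2 * \<Psi>) powr (1 / 100)"
    using ln_powr_bound[of \<Psi> "1 / 2"] assms by (intro mult_right_mono divide_right_mono) auto
  also have "\<dots> = 2 * (\<Psi> powr (1 / 2) * \<Psi> powr (-1) * \<Psi> powr (1 / 100)) * (q powr (-1) * q powr (2 / 100))"
  proof -
    have "(q\<^sup>2 * \<Psi>) powr (1 / 100) = q powr (2 / 100) * \<Psi> powr (1 / 100)"
      using assms by (simp add: powr_mult powr_powr flip: powr_numeral)
    then show ?thesis using assms by (simp add: powr_minus field_simps)
  qed
  also have "\<Psi> powr (1 / 2) * \<Psi> powr (-1) * \<Psi> powr (1 / 100) = \<Psi> powr (- 49 / 100)"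
    unfolding powr_add[symmetric] by simp
  also have "q powr (-1) * q powr (2 / 100) = q powr (- 98 / 100)"
    unfolding powr_add[symmetric] by simp
  also have "2 * \<Psi> powr (- 49 / 100) * q powr (- 98 / 100) \<le> 2 * (q powr (1 / 4)) powr (- 49 / 100) * q powr (- 98 / 100)"
    using assms by (intro mult_right_mono mult_left_mono powr_mono2') auto
  also have "\<dots> = 2 * q powr (- 49 / 400 + - 98 / 100)"
    by (simp add: powr_powr flip: powr_add)
  also have "\<dots> \<le> 2 * q powr (- 11 / 10)"
    using assms by (intro mult_left_mono powr_mono) auto
  finally show ?thesis .
qed

text \<open>The terms with \<open>16^(3k) \<le> q < 16^(3k+3)\<close> are compared with the weight of level \<open>k\<close>: there \<open>\<Psi>(q)\<close>
  is at least \<open>m k - 1\<close>, the function \<open>(1 + ln x) / x\<close> is decreasing, and the block contains at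
  most \<open>4096 \<cdot> 16^(3k)\<close> numbers \<open>q\<close>. This requires \<open>\<Psi>(q) \<le> q\<close> and \<open>m k \<le> 16^k\<close>, to control
  \<open>f r / r\<close> at \<open>r = 1 / (q\<^sup>2 \<Psi>(q))\<close>; otherwise \<open>\<Psi>(q)\<close> exceeds a power of \<open>q\<close>, and the term is
  harmless by \<open>term_le_power\<close>. For large \<open>k\<close> the maximum in \<open>m k\<close> is \<open>1 + \<Psi>\<close>.\<close>

lemma level_weights_diverge:
  fixes \<psi> :: "real \<Rightarrow> real" and t\<^sub>0 t\<^sub>1 :: real
  defines "m \<equiv> \<lambda>k. max 2 (1 + Psi \<psi> (16 ^ (3 * k)))"
  assumes Psi_mono: "mono_on {t\<^sub>0..} (Psi \<psi>)"
    and t1: "t\<^sub>0 \<le> t\<^sub>1" "1 < Psi \<psi> t\<^sub>1"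
    and diverges: "filterlim (\<lambda>N. \<Sum>q | t\<^sub>0 \<le> real q \<and> q \<le> N. series_term \<psi> f q) at_top sequentially"
  shows "\<not> summable (\<lambda>k. if m k \<le> 16 ^ k then level_weight m k else 0)"
proof
  define w where "w k = (if m k \<le> 16 ^ k then level_weight m k else 0)" for k
  assume "summable (\<lambda>k. if m k \<le> 16 ^ k then level_weight m k else 0)"
  then have sw: "summable w" by (simp add: w_def[abs_def])
  have w_nonneg: "0 \<le> w k" for k
    using ratio_pos[of "1 / 16 ^ k"] by (auto simp: w_def level_weight_def m_def harm_nonneg)
  have Psi_le: "Psi \<psi> s \<le> Psi \<psi> t" if "t\<^sub>1 \<le> s" "s \<le> t" for s t
    using Psi_mono t1 that by (auto simp: monotone_on_def)
  have Psi_gt: "1 < Psi \<psi> t" if "t\<^sub>1 \<le> t" for t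
    using Psi_le[of t\<^sub>1 t] t1 that by simp
  obtain r\<^sub>2 where r2: "0 < r\<^sub>2" "\<And>r. 0 < r \<Longrightarrow> r < r\<^sub>2 \<Longrightarrow> ratio r \<le> (1 / r) powr (1 / 100)"
    using ratio_small unfolding eventually_at_right_field ratio_def by blast
  have "\<forall>\<^sub>F k in sequentially. 1 / 16 ^ k < min r\<^sub>0 r\<^sub>2"
    using filterlim_scale r0_pos r2 unfolding filterlim_at by (intro order_tendstoD(2)[of _ 0]) auto
  moreover have "\<forall>\<^sub>F k in sequentially. nat \<lceil>t\<^sub>1\<rceil> + 16 \<le> k" by (rule eventually_ge_at_top)
  ultimately have "\<forall>\<^sub>F k in sequentially. 1 / 16 ^ k < min r\<^sub>0 r\<^sub>2 \<and> nat \<lceil>t\<^sub>1\<rceil> + 16 \<le> k"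
    by eventually_elim auto
  then obtain k\<^sub>0 where "\<And>k. k\<^sub>0 \<le> k \<Longrightarrow> 1 / 16 ^ k < min r\<^sub>0 r\<^sub>2 \<and> nat \<lceil>t\<^sub>1\<rceil> + 16 \<le> k"
    unfolding eventually_sequentially by blast
  then have k0: "1 / 16 ^ k\<^sub>0 < r\<^sub>0" "1 / 16 ^ k\<^sub>0 < r\<^sub>2" "nat \<lceil>t\<^sub>1\<rceil> + 16 \<le> k\<^sub>0" by auto
  define c :: "nat \<Rightarrow> nat" where "c k = 16 ^ (3 * k)" for k
  have c_real: "real (c k) = (16 ^ k) ^ 3" for k by (simp add: c_def power_mult[symmetric] mult.commute)
  have c_mono: "c k \<le> c (Suc k)" for k by (simp add: c_def)
  have big: "real k \<le> 16 ^ k" for k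
    using of_nat_less_two_power[of k, where ?'a = real] power_mono[of 2 "16::real" k] by linarith
  have large: "t\<^sub>1 \<le> (16 ^ k :: real)" "1 / 16 ^ k < r\<^sub>0" "1 / 16 ^ k < r\<^sub>2" "(16::real) ^ 16 \<le> 16 ^ k" if k: "k\<^sub>0 \<le> k" for k
  proof -
    have "t\<^sub>1 \<le> real k" using k0(3) k by linarith
    then show "t\<^sub>1 \<le> (16 ^ k :: real)" using big[of k] by linarith
    have "1 / 16 ^ k \<le> (1 / 16 ^ k\<^sub>0 :: real)" using k by (intro divide_left_mono power_increasing) auto
    then show "1 / 16 ^ k < r\<^sub>0" "1 / 16 ^ k < r\<^sub>2" using k0 by auto
    show "(16::real) ^ 16 \<le> 16 ^ k" using k0(3) k by (intro power_increasing) auto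
  qed
  define a where "a q = series_term \<psi> f q - 2 * real q powr (- 11 / 10)" for q
  have term_pos: "0 \<le> series_term \<psi> f q" if "t\<^sub>1 \<le> real q" for q
  proof (cases "q = 0")
    case False
    then show ?thesis
      using Psi_gt[OF that] gauge_pos[of "1 / ((real q)\<^sup>2 * Psi \<psi> (real q))"] by (simp add: series_term_def)
  qed (simp add: series_term_def)
  have term_le: "a q \<le> 4 * D ^ 5 * w k / real (c k)" if k: "k\<^sub>0 \<le> k" and q: "c k \<le> q" "q < c (Suc k)" for k q
  proof -
    define R :: real where "R = 16 ^ k"
    define x where "x = real q"
    define \<Psi> where "\<Psi> = Psi \<psi> x"
    define M where "M = Psi \<psi> (R ^ 3)"
    note l = large[OF k]
    have R: "1 \<le> R" "16 ^ 16 \<le> R" "t\<^sub>1 \<le> R" using l by (auto simp: R_def)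
    have "R ^ 1 \<le> R ^ 3" using R by (intro power_increasing) auto
    then have R3: "R \<le> R ^ 3" by simp
    have "real (c k) \<le> x" using q(1) by (simp add: x_def)
    then have x: "R ^ 3 \<le> x" by (simp add: c_real R_def)
    have "x < real (c (Suc k))" using q(2) by (simp add: x_def)
    then have x2: "x < 4096 * R ^ 3" by (simp add: c_real R_def power_mult_distrib)
    have x1: "1 \<le> x" "t\<^sub>1 \<le> x" "R \<le> x" using x R R3 by linarith+
    have M: "1 < M" "M \<le> \<Psi>" unfolding M_def \<Psi>_def using R R3 x by (auto intro!: Psi_gt Psi_le)
    then have \<Psi>: "1 < \<Psi>" by simp
    have mk: "m k = 1 + M" using M by (simp add: m_def M_def R_def power_mult[symmetric] mult.commute)
    have st: "series_term \<psi> f q = x * ln \<Psi> * f (1 / (x\<^sup>2 * \<Psi>))" by (simp add: series_term_def x_def \<Psi>_def)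
    have pos: "0 < 1 / (x\<^sup>2 * \<Psi>)" using x1 \<Psi> by simp
    have le1: "1 / (x\<^sup>2 * \<Psi>) \<le> 1 / R"
    proof -
      have "R * 1 * 1 \<le> x * x * \<Psi>" using x1 \<Psi> R by (intro mult_mono) auto
      then show ?thesis using R x1 \<Psi> by (intro divide_left_mono) (auto simp: power2_eq_square)
    qed
    show ?thesis
    proof (cases "\<Psi> \<le> x \<and> m k \<le> R")
      case False
      have "x powr (1 / 4) \<le> \<Psi>"
      proof (cases "\<Psi> \<le> x")
        case True
        then have "R < 1 + \<Psi>" using False mk M by auto
        have "x powr (1 / 4) \<le> (4096 * R ^ 3) powr (1 / 4)" using x1 x2 by (intro powr_mono2) auto
        also have "\<dots> = 4096 powr (1 / 4) * R powr (3 / 4)"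
          using R by (simp add: powr_mult powr_powr flip: powr_numeral)
        also have "\<dots> \<le> 16 * R powr (3 / 4)"
        proof -
          have "4096 powr (1 / 4) \<le> (16 powr 4) powr (1 / 4 :: real)" by (intro powr_mono2) (auto simp: powr_numeral)
          then show ?thesis by (intro mult_right_mono) (auto simp: powr_powr)
        qed
        also have "\<dots> = 16 * (R powr (- 1 / 4) * R)"
          using R by (simp add: powr_mult_base[symmetric] powr_add[symmetric] field_simps powr_minus) 
        also have "\<dots> \<le> 16 * (1 / 32 * R)"
        proof -
          have "R powr (- 1 / 4) \<le> (16 powr 16) powr (- 1 / 4 :: real)" using R by (intro powr_mono2') (auto simp: powr_numeral)
          also have "\<dots> = 1 / 65536" by (simp add: powr_powr powr_minus powr_numeral)
          finally show ?thesis using R by (intro mult_left_mono mult_right_mono) auto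
        qed
        also have "\<dots> \<le> \<Psi>" using \<open>R < 1 + \<Psi>\<close> R by simp
        finally show ?thesis .
      next
        case False
        have "x powr (1 / 4) \<le> x powr 1" using x1 by (intro powr_mono) auto
        then show ?thesis using False x1 by simp
      qed
      moreover have "ratio (1 / (x\<^sup>2 * \<Psi>)) \<le> (x\<^sup>2 * \<Psi>) powr (1 / 100)"
        using r2(2)[OF pos] le1 l(3) by (simp add: R_def)
      ultimately have "series_term \<psi> f q \<le> 2 * x powr (- 11 / 10)"
        unfolding st by (intro term_le_power x1 \<Psi>)
      then have "a q \<le> 0" by (simp add: a_def x_def)
      also have "0 \<le> 4 * D ^ 5 * w k / real (c k)" using w_nonneg[of k] D_ge_one by simp
      finally show ?thesis .
    next
      case True
      have "x\<^sup>2 * \<Psi> \<le> x\<^sup>2 * x" using True x1 by (intro mult_left_mono) auto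
      also have "\<dots> = x ^ 3" by (simp add: power3_eq_cube power2_eq_square)
      also have "\<dots> \<le> (4096 * R ^ 3) ^ 3" using x1 x2 by (intro power_mono) auto
      also have "\<dots> \<le> R ^ 32"
      proof -
        have "(4096 * R ^ 3) ^ 3 = 4096 ^ 3 * R ^ 9" by (simp add: power_mult_distrib flip: power_mult)
        also have "\<dots> \<le> R * R ^ 9" using R by (intro mult_right_mono) auto
        also have "R * R ^ 9 = R ^ 10" by (simp flip: power_Suc)
        also have "\<dots> \<le> R ^ 32" using R by (intro power_increasing) auto
        finally show ?thesis .
      qed
      finally have "1 / R ^ 32 \<le> 1 / (x\<^sup>2 * \<Psi>)" using x1 \<Psi> R by (intro divide_left_mono) auto
      then have "ratio (1 / (x\<^sup>2 * \<Psi>)) \<le> ratio ((1 / R) ^ 32)"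
        using R le1 l(2) by (intro ratio_le) (auto simp: power_one_over R_def)
      also have "\<dots> \<le> D ^ 5 * ratio (1 / R)" using ratio_power_le[of "1 / R" 5] R l(2) by (simp add: R_def)
      finally have ratio: "ratio (1 / (x\<^sup>2 * \<Psi>)) \<le> D ^ 5 * ratio (1 / R)" .
      have rR: "0 < ratio (1 / R)" using R by (intro ratio_pos) simp
      have "ln \<Psi> / \<Psi> \<le> (1 + ln \<Psi>) / \<Psi>" using \<Psi> by (intro divide_right_mono) auto
      also have "\<dots> \<le> (1 + ln M) / M" using M by (intro log_over_id_antimono) auto
      also have "\<dots> \<le> (2 * harm (arity m k)) / (m k / 2)"
      proof (rule frac_le)
        have "1 = harm 1" by (simp add: harm_def)
        also have "harm 1 \<le> (harm (arity m k) :: real)" using mk M by (intro harm_mono) (simp add: le_nat_iff le_floor_iff)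
        finally have "1 \<le> (harm (arity m k) :: real)" .
        moreover have "ln M \<le> harm (arity m k)"
        proof -
          have "M \<le> real (arity m k) + 1" using mk M by linarith
          then have "ln M \<le> ln (real (arity m k) + 1)" using M by simp
          then show ?thesis using harm_ge_ln[of "arity m k"] by linarith
        qed
        ultimately show "1 + ln M \<le> 2 * harm (arity m k)" by simp
      qed (use mk M harm_nonneg[where ?'a = real] in auto)
      finally have log: "ln \<Psi> / \<Psi> \<le> 4 * (harm (arity m k) / m k)" by simp
      have "series_term \<psi> f q = ln \<Psi> / \<Psi> * ratio (1 / (x\<^sup>2 * \<Psi>)) / x"
        unfolding st using gauge_eq[OF pos] x1 \<Psi> by (simp add: power2_eq_square)
      also have "\<dots> \<le> 4 * (harm (arity m k) / m k) * (D ^ 5 * ratio (1 / R)) / x"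
      proof (intro divide_right_mono mult_mono log ratio)
        show "0 \<le> 4 * (harm (arity m k) / m k)" using mk M by (simp add: harm_nonneg)
      qed (use x1 ratio_pos[OF pos] in auto)
      also have "\<dots> = 4 * D ^ 5 * w k / x" using True by (simp add: w_def level_weight_def R_def)
      also have "\<dots> \<le> 4 * D ^ 5 * w k / real (c k)"
        using q(1) x1(1) w_nonneg[of k] D_ge_one by (intro divide_left_mono) (auto simp: x_def c_def)
      finally have "series_term \<psi> f q \<le> 4 * D ^ 5 * w k / real (c k)" .
      moreover have "0 \<le> 2 * real q powr (- 11 / 10)" by simp
      ultimately show ?thesis unfolding a_def by linarith
    qed
  qed
  have block: "(\<Sum>q=c k..<c (Suc k). a q) \<le> 16384 * D ^ 5 * w k" if k: "k\<^sub>0 \<le> k" for k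
  proof -
    have "(\<Sum>q=c k..<c (Suc k). a q) \<le> (\<Sum>q=c k..<c (Suc k). 4 * D ^ 5 * w k / real (c k))"
      by (intro sum_mono term_le k) auto
    also have "\<dots> = real (c (Suc k) - c k) * (4 * D ^ 5 * w k / real (c k))" by simp
    also have "\<dots> \<le> (4096 * real (c k)) * (4 * D ^ 5 * w k / real (c k))"
      using w_nonneg[of k] D_ge_one by (intro mult_right_mono) (auto simp: c_def power_add of_nat_diff)
    also have "\<dots> = 16384 * D ^ 5 * w k" by (simp add: c_def)
    finally show ?thesis .
  qed
  have spowr: "summable (\<lambda>q. real q powr (- 11 / 10))" by (simp add: summable_real_powr_iff)
  define Z where "Z = (\<Sum>q | t\<^sub>0 \<le> real q \<and> q < c k\<^sub>0. \<bar>series_term \<psi> f q\<bar>) + 16384 * D ^ 5 * (\<Sum>k. w k)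
    + 2 * (\<Sum>q. real q powr (- 11 / 10))"
  have "(\<Sum>q | t\<^sub>0 \<le> real q \<and> q \<le> N. series_term \<psi> f q) \<le> Z" for N
  proof -
    define n where "n = k\<^sub>0 + N"
    have "real n \<le> 16 ^ n" "(16::real) ^ n \<le> (16 ^ n) ^ 3" using big by (auto intro: self_le_power)
    then have "real N \<le> real (c n)" unfolding c_real by (simp add: n_def)
    then have Nc: "N \<le> c n" by simp
    have t1c: "t\<^sub>1 \<le> real q" if "c k\<^sub>0 \<le> q" for q
    proof -
      have "(16::real) ^ k\<^sub>0 \<le> (16 ^ k\<^sub>0) ^ 3" by (intro self_le_power) auto
      also have "\<dots> \<le> real q" using that by (simp flip: c_real)
      finally show ?thesis using large(1)[OF order_refl] by linarith
    qed
    have "c n < c (Suc n)" by (simp add: c_def)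
    with Nc have "N < c (Suc n)" by simp
    have "(\<Sum>q | t\<^sub>0 \<le> real q \<and> q \<le> N. series_term \<psi> f q)
      \<le> (\<Sum>q\<in>{q. t\<^sub>0 \<le> real q \<and> q < c k\<^sub>0} \<union> {c k\<^sub>0..<c (Suc n)}. if q < c k\<^sub>0 then \<bar>series_term \<psi> f q\<bar> else series_term \<psi> f q)"
    proof -
      have "(\<Sum>q | t\<^sub>0 \<le> real q \<and> q \<le> N. series_term \<psi> f q)
        \<le> (\<Sum>q | t\<^sub>0 \<le> real q \<and> q \<le> N. if q < c k\<^sub>0 then \<bar>series_term \<psi> f q\<bar> else series_term \<psi> f q)"
        by (intro sum_mono) auto
      also have "\<dots> \<le> (\<Sum>q\<in>{q. t\<^sub>0 \<le> real q \<and> q < c k\<^sub>0} \<union> {c k\<^sub>0..<c (Suc n)}. if q < c k\<^sub>0 then \<bar>series_term \<psi> f q\<bar> else series_term \<psi> f q)"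
        by (rule sum_mono2) (use \<open>N < c (Suc n)\<close> term_pos t1c in auto)
      finally show ?thesis .
    qed
    also have "\<dots> = (\<Sum>q | t\<^sub>0 \<le> real q \<and> q < c k\<^sub>0. \<bar>series_term \<psi> f q\<bar>) + (\<Sum>q=c k\<^sub>0..<c (Suc n). series_term \<psi> f q)"
      by (subst sum.union_disjoint) (auto intro!: sum.cong arg_cong2[where f = "(+)"])
    also have "(\<Sum>q=c k\<^sub>0..<c (Suc n). series_term \<psi> f q)
      = (\<Sum>q=c k\<^sub>0..<c (Suc n). a q) + 2 * (\<Sum>q=c k\<^sub>0..<c (Suc n). real q powr (- 11 / 10))"
      by (simp add: a_def sum_subtractf sum_distrib_left)
    also have "(\<Sum>q=c k\<^sub>0..<c (Suc n). a q) \<le> (\<Sum>k=k\<^sub>0..<Suc n. 16384 * D ^ 5 * w k)"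
      by (rule sum_over_blocks_le[where c = c and b = "\<lambda>k. 16384 * D ^ 5 * w k", OF c_mono block])
        (simp_all add: n_def)
    also have "\<dots> = 16384 * D ^ 5 * (\<Sum>k=k\<^sub>0..<Suc n. w k)" by (simp only: sum_distrib_left)
    also have "(\<Sum>k=k\<^sub>0..<Suc n. w k) \<le> (\<Sum>k. w k)"
      using sw w_nonneg by (intro sum_le_suminf) auto
    also have "(\<Sum>q=c k\<^sub>0..<c (Suc n). real q powr (- 11 / 10)) \<le> (\<Sum>q. real q powr (- 11 / 10))"
      using spowr by (intro sum_le_suminf) auto
    finally show ?thesis using D_ge_one by (simp add: Z_def mult_left_mono)
  qed
  moreover have "\<forall>\<^sub>F N in sequentially. Z + 1 \<le> (\<Sum>q | t\<^sub>0 \<le> real q \<and> q \<le> N. series_term \<psi> f q)"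
    using diverges by (simp add: filterlim_at_top)
  ultimately show False by (auto simp: eventually_sequentially) (metis add_le_same_cancel1 not_one_le_zero order.trans order_refl)
qed

text \<open>A window of level \<open>k\<close> belongs to a denominator between \<open>16^k\<close> and \<open>16^(3k)\<close>, where \<open>1 + \<Psi> \<le> m k\<close>
  by monotonicity.\<close>

lemma measure_infinite_of_series:
  fixes \<psi> :: "real \<Rightarrow> real" and t\<^sub>0 t\<^sub>1 :: real
  assumes t0: "1 \<le> t\<^sub>0" "\<forall>t\<ge>t\<^sub>0. t * \<psi> t < 1"
    and Psi_mono: "mono_on {t\<^sub>0..} (Psi \<psi>)"
    and t1: "t\<^sub>0 \<le> t\<^sub>1" "1 < Psi \<psi> t\<^sub>1"
    and diverges: "filterlim (\<lambda>N. \<Sum>q | t\<^sub>0 \<le> real q \<and> q \<le> N. series_term \<psi> f q) at_top sequentially"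
  shows "hausdorff_measure f (dirichlet_non_improvable \<psi>) = \<infinity>"
proof (rule measure_infinite_of_divergence)
  define m where "m = (\<lambda>k. max 2 (1 + Psi \<psi> (16 ^ (3 * k))))"
  show "2 \<le> m k" for k by (simp add: m_def)
  show "\<not> summable (\<lambda>k. if m k \<le> 16 ^ k then level_weight m k else 0)"
    unfolding m_def by (rule level_weights_diverge[OF Psi_mono t1 diverges])
  fix x :: real
  assume x: "0 \<le> x" "x < 1" and windows: "\<And>N. \<exists>k\<ge>N. \<exists>A. good_window m k A \<and> fst A \<le> x \<and> x \<le> snd A"
  have "\<exists>t>N. non_improvable_at \<psi> t x" for N
  proof -
    define n where "n = nat \<lceil>max N t\<^sub>0\<rceil> + 1"
    obtain k A where kA: "n \<le> k" "good_window m k A" "fst A \<le> x" "x \<le> snd A" using windows by blast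
    then obtain p q p' q' :: int where pq: "p * q' - p' * q = 1" "0 < q'" "16 ^ k \<le> real_of_int q"
      "real_of_int q \<le> 16 ^ (3 * k)" "fst A = of_int p / of_int q - 1 / (of_int q * of_int q' * m k)"
      "snd A = of_int p / of_int q" by (auto simp: good_window_def)
    have "real k \<le> 16 ^ k"
      using of_nat_less_two_power[of k, where ?'a = real] power_mono[of 2 "16::real" k] by linarith
    then have "real n \<le> of_int q" using kA(1) pq(3) by linarith
    then have q: "N < of_int q" "t\<^sub>0 \<le> of_int q" by (auto simp: n_def) linarith+
    then have q0: "0 < q" using t0(1) by (metis less_le_trans of_int_0_less_iff zero_less_one)
    define y where "y = of_int q * \<psi> (of_int q)"
    have y: "y < 1" using t0(2) q(2) by (simp add: y_def)
    have "t\<^sub>0 \<le> 16 ^ (3 * k)" using q(2) pq(4) by linarith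
    then have "Psi \<psi> (of_int q) \<le> Psi \<psi> (16 ^ (3 * k))"
      using q(2) pq(4) by (intro monotone_onD[OF Psi_mono]) (simp_all only: atLeast_iff)
    then have "1 + Psi \<psi> (of_int q) \<le> m k" by (simp add: m_def)
    moreover have "1 + Psi \<psi> (of_int q) = 1 / (1 - y)" using y by (simp add: Psi_def y_def field_simps)
    ultimately have "1 / (1 - y) \<le> m k" by simp
    then have "1 / m k \<le> 1 - y" using y by (simp add: field_simps m_def)
    then have psi: "of_int q * \<psi> (of_int q) \<le> 1 - 1 / m k" by (simp add: y_def)
    have "non_improvable_at \<psi> (of_int q) x"
      by (rule non_improvable_at_convergent[where \<psi> = \<psi>, OF pq(1,2) q0 _ psi]) (use kA pq in \<open>auto simp: m_def\<close>)
    then show ?thesis using q(1) by blast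
  qed
  then show "x \<in> dirichlet_non_improvable \<psi>" using x by (auto simp: dirichlet_non_improvable_iff)
qed

end

theorem corollary1p8:
  fixes \<psi> f :: "real \<Rightarrow> real" and t\<^sub>0 :: real and n :: nat and a :: "nat \<Rightarrow> real"
  assumes psi_pos: "\<forall>t>0. 0 < \<psi> t"
    and psi_noninc: "antimono_on {0<..} \<psi>"
    and t0: "1 \<le> t\<^sub>0" "\<forall>t\<ge>t\<^sub>0. t * \<psi> t < 1"
    and Psi_mono: "mono_on {t\<^sub>0..} (Psi \<psi>)"
    and Psi_nondegenerate: "\<exists>t\<ge>t\<^sub>0. 1 < Psi \<psi> t"
    and n: "1 \<le> n"
    and a_nonneg: "\<forall>i\<in>{1..n}. 0 \<le> a i"
    and a_nonzero: "\<exists>i\<in>{1..n}. a i \<noteq> 0"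
    and f_dim: "dimension_function f"
    and f_eq: "\<forall>\<^sub>F x in at_right 0. f x = x * (\<Prod>i=1..n. ((ln ^^ i) (1 / x)) powr a i)"
  shows "(summable (\<lambda>q. if t\<^sub>0 \<le> real q then series_term \<psi> f q else 0)
            \<longrightarrow> hausdorff_measure f (dirichlet_non_improvable \<psi>) = 0)
       \<and> (filterlim (\<lambda>N. \<Sum>q | t\<^sub>0 \<le> real q \<and> q \<le> N. series_term \<psi> f q) at_top sequentially
            \<longrightarrow> hausdorff_measure f (dirichlet_non_improvable \<psi>) = \<infinity>)"
proof -
  obtain D r\<^sub>0 where "slow_gauge f D r\<^sub>0"
    using gauge_of_iterated_logs[OF a_nonneg a_nonzero f_dim f_eq] by blast
  then interpret slow_gauge f D r\<^sub>0 .
  obtain t\<^sub>1 where t1: "t\<^sub>0 \<le> t\<^sub>1" "1 < Psi \<psi> t\<^sub>1" using Psi_nondegenerate by blast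
  show ?thesis
    using measure_zero_of_summable[OF psi_pos psi_noninc t0 Psi_mono t1]
      measure_infinite_of_series[OF t0 Psi_mono t1] by blast
qed

end
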